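(* Assume conditions $(\mathbf u)$ and $(\mathbf{fg})$. Let $(x^0,u^0)\in C(\mathbb T,\mathbb X)\times\mathfrak U$ be a uniformly overtaking optimal pair for the problem of maximizing $\lim_{T\to\infty}J_T(u)$ over $u\in\mathfrak U$. Then there exist $\lambda^0\in[0,1]$ and $\psi^0\in C(\mathbb T,\mathbb X)$ such that $(x^0,u^0,\lambda^0,\psi^0)\in\mathfrak Z$; that is, $x^0(0)=0$, $\|\psi^0(0)\|_{\mathbb X}+\lambda^0=1$, and for a.a. $t\in\mathbb T$ $$\dot x^0(t)=f(t,x^0(t),u^0(t)),\qquad \dot\psi^0(t)\in-\partial_x\mathcal H(x^0(t),t,u^0(t),\lambda^0,\psi^0(t)),$$ $$\sup_{p\in U(t)}\mathcal H(x^0(t),t,p,\lambda^0,\psi^0(t))=\mathcal H(x^0(t),t,u^0(t),\lambda^0,\psi^0(t)).$$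
   Context: Notation. $\mathbb T=\mathbb R_{\ge0}$, $\mathbb X=\mathbb R^m$, $\mathbb U$ is a finite-dimensional Euclidean space, $U:\mathbb T\rightsquigarrow\mathbb U$ is a set-valued map with graph $\mathrm{Gr}\,U$, and $\mathfrak U$ is the set of all Borel measurable selectors of $U$. $C(\mathbb T,E)$ is the set of continuous functions $\mathbb T\to E$. $\mathcal L^1_{loc}(\mathbb T,\mathbb T)$ is the set of nonnegative locally summable functions on $\mathbb T$. A function $a:\mathbb T\times E'\times\mathbb U\to E''$ ($E',E''$ finite-dimensional Euclidean spaces) is called: (1) Carathéodory if $a(\cdot,y,u)$ is measurable for all $y\in E'$ and all $u$ belonging to some $U(t)$, and $a(t,\cdot,\cdot):E'\times U(t)\to E''$ is continuous for all $t\in\mathbb T$; (2) locally Lipschitz continuous if for each compact $K\subset\mathbb T\times E'$ there is $L^a_K\in\mathcal L^1_{loc}(\mathbb T,\mathbb T)$ with $\|a(t,x',u)-a(t,x'',u)\|\le L^a_K(t)\|x'-x''\|$ for all $(t,x'),(t,x'')\in K$, $u\in U(t)$; (3) integrally bounded (on each compact subset) if for each compact $K\subset\mathbb T\times E'$ there is $M^a_K\in\mathcal L^1_{loc}(\mathbb T,\mathbb T)$ with $\|a(t,x,u)\|\le M^a_K(t)$ for all $(t,x)\in K$, $u\in U(t)$; (4) satisfying the continuability condition if it is locally Lipschitz continuous with $L^a_K$ independent of $K$ and it is integrally bounded on each compact subset. Condition $(\mathbf u)$: $U$ is compact-valued, integrally bounded on each compact subset of $\mathbb T$ (i.e. norms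 of elements of $U(t)$ are dominated by a locally summable function of $t$), and $\mathrm{Gr}\,U$ is a Borel subset of $\mathbb T\times\mathbb U$. Condition $(\mathbf{fg})$: $f:\mathbb T\times\mathbb X\times\mathbb U\to\mathbb X$ and $g:\mathbb T\times\mathbb X\times\mathbb U\to\mathbb R$ are locally Lipschitz continuous Carathéodory maps, integrally bounded on each compact subset, and $f$ satisfies the continuability condition. For $u\in\mathfrak U$, $\varphi[u]$ is the unique solution on $\mathbb T$ of $\dot x=f(t,x,u(t))$, $x(0)=0$, and $J_T(u)=\int_0^Tg(t,\varphi[u](t),u(t))\,dt$. A control $u^0\in\mathfrak U$ is uniformly overtaking optimal if for each $\varepsilon>0$ there is $T>0$ such that $J_t(u^0)\ge J_t(u)-\varepsilon$ for all $u\in\mathfrak U$, $t\ge T$; the pair $(x^0,u^0)$ is then called uniformly overtaking optimal, where $x^0=\varphi[u^0]$. $\mathcal H(x,t,u,\lambda,\psi)=\psi f(t,x,u)+\lambda g(t,x,u)$ (with $\psi$ regarded as a row vector), and $\partial_x$ denotes the Clarke generalized gradient with respect to $x$. $\mathfrak Z$ is the set of $(x,u,\lambda,\psi)$ with $x,\psi:\mathbb T\to\mathbb X$ locally absolutely continuous, $u\in\mathfrak U$, $\lambda\in[0,1]$, satisfying $x(0)=0$, $\|\psi(0)\|_{\mathbb X}+\lambda=1$ and, a.e. on $\mathbb T$, the three relations displayed in the claim (with $(x,u,\lambda,\psi)$ in place of $(x^0,u^0,\lambda^0,\psi^0)$).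
   Formalization: Added assumption: for every control u in 𝔘 and every y, the maps t↦f(t,y,u(t)) and t↦g(t,y,u(t)) are measurable; clause (1) of the Carathéodory definition does not imply this, and the claim fails without it (e.g. U(t)={t} with non-measurable coefficients). *)

theory Defs
  imports "HOL-Analysis.Analysis"
begin

(* Time is the half-line {0..}. Functions of time have type real \<Rightarrow> _ and only their values on
   {0..} matter. *)

definition abs_cont_on :: "real \<Rightarrow> real \<Rightarrow> (real \<Rightarrow> 'e::euclidean_space) \<Rightarrow> bool" where
  "abs_cont_on a b x \<longleftrightarrow>
     (\<forall>\<epsilon>>0. \<exists>\<delta>>0. \<forall>d S. d division_of S \<and> S \<subseteq> {a..b} \<and> (\<Sum>k\<in>d. Sup k - Inf k) < \<delta> \<longrightarrow>
        (\<Sum>k\<in>d. norm (x (Sup k) - x (Inf k))) < \<epsilon>)"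

definition loc_abs_cont :: "(real \<Rightarrow> 'e::euclidean_space) \<Rightarrow> bool" where
  "loc_abs_cont x \<longleftrightarrow> (\<forall>a b. 0 \<le> a \<and> a \<le> b \<longrightarrow> abs_cont_on a b x)"

definition L1_loc :: "(real \<Rightarrow> real) set" where
  "L1_loc = {l. (\<forall>t\<ge>0. 0 \<le> l t) \<and> (\<forall>K. compact K \<and> K \<subseteq> {0..} \<longrightarrow> set_integrable lebesgue K l)}"

definition graph :: "(real \<Rightarrow> 'u set) \<Rightarrow> (real \<times> 'u) set" where
  "graph U = {(t, p). 0 \<le> t \<and> p \<in> U t}"

definition selectors :: "(real \<Rightarrow> 'u::euclidean_space set) \<Rightarrow> (real \<Rightarrow> 'u) set" where
  "selectors U = {u. u \<in> borel_measurable (restrict_space borel {0..}) \<and> (\<forall>t\<ge>0. u t \<in> U t)}"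

definition caratheodory ::
  "(real \<Rightarrow> 'u::euclidean_space set) \<Rightarrow>
   (real \<Rightarrow> 'e::euclidean_space \<Rightarrow> 'u \<Rightarrow> 'f::euclidean_space) \<Rightarrow> bool" where
  "caratheodory U a \<longleftrightarrow>
     (\<forall>y. \<forall>p\<in>(\<Union>t\<in>{0..}. U t). (\<lambda>t. a t y p) \<in> borel_measurable (lebesgue_on {0..})) \<and>
     (\<forall>t\<ge>0. continuous_on (UNIV \<times> U t) (\<lambda>(y, p). a t y p))"

(* Not implied by caratheodory, because a fixed p may belong to U t for very few t.
   If U t = {t}, then for an arbitrary N :: real \<Rightarrow> real the function
   a t y p = (if p = t then N t else 0) is caratheodory, yet along the only selector it equals N. *)
definition superposition_measurable ::
  "(real \<Rightarrow> 'u::euclidean_space set) \<Rightarrow>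
   (real \<Rightarrow> 'e::euclidean_space \<Rightarrow> 'u \<Rightarrow> 'f::euclidean_space) \<Rightarrow> bool" where
  "superposition_measurable U a \<longleftrightarrow>
     (\<forall>u\<in>selectors U. \<forall>y. (\<lambda>t. a t y (u t)) \<in> borel_measurable (lebesgue_on {0..}))"

definition locally_lipschitz ::
  "(real \<Rightarrow> 'u::euclidean_space set) \<Rightarrow>
   (real \<Rightarrow> 'e::euclidean_space \<Rightarrow> 'u \<Rightarrow> 'f::euclidean_space) \<Rightarrow> bool" where
  "locally_lipschitz U a \<longleftrightarrow>
     (\<forall>K. compact K \<and> K \<subseteq> {0..} \<times> UNIV \<longrightarrow>
        (\<exists>L\<in>L1_loc. \<forall>t x x' p. (t, x) \<in> K \<and> (t, x') \<in> K \<and> p \<in> U t \<longrightarrow>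
           norm (a t x p - a t x' p) \<le> L t * norm (x - x')))"

definition integrally_bounded ::
  "(real \<Rightarrow> 'u::euclidean_space set) \<Rightarrow>
   (real \<Rightarrow> 'e::euclidean_space \<Rightarrow> 'u \<Rightarrow> 'f::euclidean_space) \<Rightarrow> bool" where
  "integrally_bounded U a \<longleftrightarrow>
     (\<forall>K. compact K \<and> K \<subseteq> {0..} \<times> UNIV \<longrightarrow>
        (\<exists>M\<in>L1_loc. \<forall>t x p. (t, x) \<in> K \<and> p \<in> U t \<longrightarrow> norm (a t x p) \<le> M t))"

definition continuability ::
  "(real \<Rightarrow> 'u::euclidean_space set) \<Rightarrow>
   (real \<Rightarrow> 'e::euclidean_space \<Rightarrow> 'u \<Rightarrow> 'f::euclidean_space) \<Rightarrow> bool" where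
  "continuability U a \<longleftrightarrow>
     (\<exists>L\<in>L1_loc. \<forall>K. compact K \<and> K \<subseteq> {0..} \<times> UNIV \<longrightarrow>
        (\<forall>t x x' p. (t, x) \<in> K \<and> (t, x') \<in> K \<and> p \<in> U t \<longrightarrow>
           norm (a t x p - a t x' p) \<le> L t * norm (x - x'))) \<and>
     integrally_bounded U a"

definition condition_u :: "(real \<Rightarrow> 'u::euclidean_space set) \<Rightarrow> bool" where
  "condition_u U \<longleftrightarrow>
     (\<forall>t\<ge>0. compact (U t)) \<and>
     (\<exists>M\<in>L1_loc. \<forall>t\<ge>0. \<forall>p\<in>U t. norm p \<le> M t) \<and>
     graph U \<in> sets borel"

definition condition_fg ::
  "(real \<Rightarrow> 'u::euclidean_space set) \<Rightarrow>
   (real \<Rightarrow> 'x::euclidean_space \<Rightarrow> 'u \<Rightarrow> 'x) \<Rightarrow>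
   (real \<Rightarrow> 'x \<Rightarrow> 'u \<Rightarrow> real) \<Rightarrow> bool" where
  "condition_fg U f g \<longleftrightarrow>
     caratheodory U f \<and> locally_lipschitz U f \<and> integrally_bounded U f \<and>
     caratheodory U g \<and> locally_lipschitz U g \<and> integrally_bounded U g \<and>
     continuability U f"

definition solves ::
  "(real \<Rightarrow> 'x::euclidean_space \<Rightarrow> 'u \<Rightarrow> 'x) \<Rightarrow> (real \<Rightarrow> 'u) \<Rightarrow> (real \<Rightarrow> 'x) \<Rightarrow> bool" where
  "solves f u x \<longleftrightarrow>
     loc_abs_cont x \<and> x 0 = 0 \<and>
     (AE t\<in>{0..} in lebesgue. (x has_vector_derivative f t (x t) (u t)) (at t within {0..}))"

(* The restriction to extensional functions fixes the irrelevant values at negative times, so that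
   uniqueness on {0..} becomes uniqueness as a function. *)
definition traj ::
  "(real \<Rightarrow> 'x::euclidean_space \<Rightarrow> 'u \<Rightarrow> 'x) \<Rightarrow> (real \<Rightarrow> 'u) \<Rightarrow> real \<Rightarrow> 'x" where
  "traj f u = (THE x. x \<in> extensional {0..} \<and> solves f u x)"

definition J ::
  "(real \<Rightarrow> 'x::euclidean_space \<Rightarrow> 'u \<Rightarrow> 'x) \<Rightarrow> (real \<Rightarrow> 'x \<Rightarrow> 'u \<Rightarrow> real) \<Rightarrow>
   real \<Rightarrow> (real \<Rightarrow> 'u) \<Rightarrow> real" where
  "J f g T u = (LINT t:{0..T}|lebesgue. g t (traj f u t) (u t))"

definition unif_overtaking_optimal ::
  "(real \<Rightarrow> 'u::euclidean_space set) \<Rightarrow>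
   (real \<Rightarrow> 'x::euclidean_space \<Rightarrow> 'u \<Rightarrow> 'x) \<Rightarrow> (real \<Rightarrow> 'x \<Rightarrow> 'u \<Rightarrow> real) \<Rightarrow>
   (real \<Rightarrow> 'u) \<Rightarrow> bool" where
  "unif_overtaking_optimal U f g u0 \<longleftrightarrow>
     u0 \<in> selectors U \<and>
     (\<forall>\<epsilon>>0. \<exists>T>0. \<forall>u\<in>selectors U. \<forall>t\<ge>T. J f g t u0 \<ge> J f g t u - \<epsilon>)"

definition unif_overtaking_optimal_pair ::
  "(real \<Rightarrow> 'u::euclidean_space set) \<Rightarrow>
   (real \<Rightarrow> 'x::euclidean_space \<Rightarrow> 'u \<Rightarrow> 'x) \<Rightarrow> (real \<Rightarrow> 'x \<Rightarrow> 'u \<Rightarrow> real) \<Rightarrow>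
   (real \<Rightarrow> 'x) \<Rightarrow> (real \<Rightarrow> 'u) \<Rightarrow> bool" where
  "unif_overtaking_optimal_pair U f g x0 u0 \<longleftrightarrow>
     unif_overtaking_optimal U f g u0 \<and> (\<forall>t\<ge>0. x0 t = traj f u0 t)"

(* Clarke's generalized directional derivative and gradient; covectors are identified with
   vectors through the inner product. *)
definition clarke_deriv :: "('x::euclidean_space \<Rightarrow> real) \<Rightarrow> 'x \<Rightarrow> 'x \<Rightarrow> ereal" where
  "clarke_deriv h x v =
     Limsup (nhds x \<times>\<^sub>F at_right 0) (\<lambda>(y, s). ereal ((h (y + s *\<^sub>R v) - h y) / s))"

definition clarke_gradient :: "('x::euclidean_space \<Rightarrow> real) \<Rightarrow> 'x \<Rightarrow> 'x set" where
  "clarke_gradient h x = {z. \<forall>v. ereal (z \<bullet> v) \<le> clarke_deriv h x v}"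

definition hamiltonian ::
  "(real \<Rightarrow> 'x::euclidean_space \<Rightarrow> 'u \<Rightarrow> 'x) \<Rightarrow> (real \<Rightarrow> 'x \<Rightarrow> 'u \<Rightarrow> real) \<Rightarrow>
   'x \<Rightarrow> real \<Rightarrow> 'u \<Rightarrow> real \<Rightarrow> 'x \<Rightarrow> real" where
  "hamiltonian f g x t p lam \<psi> = \<psi> \<bullet> f t x p + lam * g t x p"

definition extremals ::
  "(real \<Rightarrow> 'u::euclidean_space set) \<Rightarrow>
   (real \<Rightarrow> 'x::euclidean_space \<Rightarrow> 'u \<Rightarrow> 'x) \<Rightarrow> (real \<Rightarrow> 'x \<Rightarrow> 'u \<Rightarrow> real) \<Rightarrow>
   ((real \<Rightarrow> 'x) \<times> (real \<Rightarrow> 'u) \<times> real \<times> (real \<Rightarrow> 'x)) set" where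
  "extremals U f g = {(x, u, lam, \<psi>).
     loc_abs_cont x \<and> loc_abs_cont \<psi> \<and> u \<in> selectors U \<and> lam \<in> {0..1} \<and>
     x 0 = 0 \<and> norm (\<psi> 0) + lam = 1 \<and>
     (AE t\<in>{0..} in lebesgue.
        (x has_vector_derivative f t (x t) (u t)) (at t within {0..}) \<and>
        (\<exists>\<zeta>\<in>clarke_gradient (\<lambda>y. hamiltonian f g y t (u t) lam (\<psi> t)) (x t).
           (\<psi> has_vector_derivative - \<zeta>) (at t within {0..})) \<and>
        (SUP p\<in>U t. hamiltonian f g (x t) t p lam (\<psi> t)) =
          hamiltonian f g (x t) t (u t) lam (\<psi> t))}"

end

theory Submission
  imports Defs
begin

text \<open>
  A uniformly overtaking optimal control is optimal up to any prescribed \<open>\<epsilon>\<close> on all sufficiently long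
  bounded intervals, with a free right end. So a maximum principle with errors is proved for almost optimal
  controls on bounded intervals, and then the errors are sent to zero while the horizon recedes to infinity.
  Three things have to be taken care of: no estimate may deteriorate with the horizon, \<open>f\<close> and \<open>g\<close> are only
  Lipschitz continuous in the state, and the maximum over \<open>U t\<close> is taken for each time separately while
  variations of the control are measurable in time.

  \<^emph>\<open>Independence of the horizon.\<close> The Lipschitz constant of \<open>f\<close> depends on time only. Hence Gronwall's inequality
  bounds all trajectories at time \<open>t\<close> by one number \<open>radius m t\<close>, whatever the control
  (\<open>trajectory_bound\<close>), and all bounds on the data in this tube combine to one weight \<open>M\<close>; see the
  locale \<open>control_problem\<close>. The adjoint curves are normalised at time \<open>0\<close> and satisfy an equation whose
  coefficients are bounded by \<open>M\<close>, so at time \<open>t\<close> they too are bounded independently of the horizon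
  (\<open>adjoint_bound\<close>). The normalisation \<open>\<lambda> + \<parallel>\<psi> 0\<parallel> = 1\<close> survives the limit, where \<open>\<lambda>\<close> may vanish.

  \<^emph>\<open>Nonsmoothness.\<close> The data are mollified in the state. This changes the cost by little, uniformly in the
  control (\<open>cost_mollify_near\<close>), and provides a second order expansion (\<open>smooth_second_order\<close>). The gradient of a
  mollified function is an average of difference quotients of the original one at nearby points
  (\<open>smooth_grad_le\<close>), and those are what Clarke's derivative bounds. Therefore such gradients accumulate only
  in the Clarke gradient (\<open>smooth_grad_limit_clarke\<close>).

  \<^emph>\<open>Bounded intervals.\<close> Two controls are compared by the weighted measure of the set on which
  they differ, their \<open>deviation\<close>. Let \<open>w\<close> be nearly maximal for the mollified cost minus \<open>\<sigma>\<close> times the deviation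
  from \<open>u0\<close>. Then \<open>w\<close> differs from \<open>u0\<close> by at most \<open>3 * \<sigma>\<close>, and another control can be better than \<open>w\<close> by
  little more than \<open>\<sigma>\<close> times its deviation from \<open>w\<close>. On the other hand, the gain in passing from \<open>w\<close> to \<open>u\<close> is the
  integral of the difference of the Hamiltonians, up to an error quadratic in the deviation (\<open>cost_increment\<close>).
  So the set of times at which some other control \<open>v\<close> raises the Hamiltonian by more than \<open>3 * \<sigma> * M t\<close> is
  small (\<open>hamiltonian_gap\<close>). This is collected in \<open>finite_horizon\<close>.

  \<^emph>\<open>The limit.\<close> In \<open>infinite_horizon\<close> the errors are \<open>(1/2)^n\<close>, so that the Borel-Cantelli lemma shows that at almost every
  time \<open>t\<close> the \<open>n\<close>-th control has the value \<open>u0 t\<close> for all large \<open>n\<close>, and that a given competitor \<open>v\<close> satisfies the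
  maximum condition up to \<open>3 * (1/2)^n * M t\<close>. The trajectories converge to \<open>x0\<close>, and a subsequence of the adjoint
  curves converges at every time. Their derivatives converge only weakly, but by \<open>limit_of_primitives\<close> the
  derivative of the limit satisfies, almost everywhere, each linear inequality that all late derivatives satisfy,
  and membership in the Clarke gradient is a system of such inequalities.

  \<^emph>\<open>All values in \<open>U t\<close>.\<close> Each competitor \<open>v\<close> has its own exceptional null set, so only countably many
  can be admitted. Because the graph of \<open>U\<close> is a Borel set, there are countably many admissible controls whose values
  are dense in \<open>U t\<close> for almost every \<open>t\<close> (\<open>dense_selectors_exist\<close>); this rests on the measurability of
  projections of Borel sets (\<open>borel_projection_lebesgue_measurable\<close>). Continuity of \<open>f\<close> and \<open>g\<close> in the control then
  extends the maximum condition to all of \<open>U t\<close>.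
\<close>

section \<open>Lebesgue differentiation and the fundamental theorem for absolutely continuous curves\<close>

text \<open>By Henstock's lemma the errors \<open>F s - F t - (s - t) *\<^sub>R h t\<close> over disjoint short intervals have a small sum.
  A point at which the derivative fails is an end point of arbitrarily short intervals whose length is at most a fixed
  multiple of this error. Vitali's covering lemma extracts disjoint intervals from these, with enlargements that
  cover all such points, so the total length of the cover is small.\<close>

lemma negligible_not_indefinite_integral_derivative:
  fixes h :: "real \<Rightarrow> 'e::euclidean_space"
  assumes h: "h integrable_on {a..b}"
  shows "negligible {t\<in>{a..b}. \<not> ((\<lambda>t. integral {a..t} h) has_vector_derivative h t) (at t within {a..b})}"
proof -
  define F where "F t = integral {a..t} h" for t
  define bad where "bad k t s \<longleftrightarrow> t \<in> {a..b} \<and> s \<in> {a..b} \<and> t \<noteq> s \<and>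
     \<bar>s - t\<bar> < real (Suc k) * norm (F s - F t - (s - t) *\<^sub>R h t)" for k t s
  define E where "E k = {t. \<forall>d>0. \<exists>s. \<bar>s - t\<bar> < d \<and> bad k t s}" for k
  define I where "I t s = {min t s..max t s}" for t s :: real
  have FI: "norm (F s - F t - (s - t) *\<^sub>R h t) = norm (measure lborel (I t s) *\<^sub>R h t - integral (I t s) h)"
    if "t \<in> {a..b}" "s \<in> {a..b}" for s t
  proof (cases "t \<le> s")
    case True
    have "integral {a..t} h + integral {t..s} h = integral {a..s} h"
      using that True h by (intro Henstock_Kurzweil_Integration.integral_combine)
        (auto intro: integrable_on_subinterval)
    then have "F s - F t - (s - t) *\<^sub>R h t = - (measure lborel (I t s) *\<^sub>R h t - integral (I t s) h)"
      using True by (simp add: F_def I_def max_def min_def algebra_simps)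
    then show ?thesis by (metis norm_minus_cancel)
  next
    case False
    have "integral {a..s} h + integral {s..t} h = integral {a..t} h"
      using that False h by (intro Henstock_Kurzweil_Integration.integral_combine)
        (auto intro: integrable_on_subinterval)
    then have "F s - F t - (s - t) *\<^sub>R h t = measure lborel (I t s) *\<^sub>R h t - integral (I t s) h"
      using False by (simp add: F_def I_def max_def min_def algebra_simps)
    then show ?thesis by simp
  qed
  have "negligible (E k)" for k
    unfolding negligible_outer_le
  proof (intro allI impI)
    fix e :: real assume e: "0 < e"
    \<comment> \<open>5 for the enlargement in the covering lemma, \<open>Suc k\<close> for the ratio of length and error\<close>
    define \<eta> where "\<eta> = e / (5 * real (Suc k))"
    have \<eta>: "\<eta> > 0" using e by (simp add: \<eta>_def)
    obtain \<gamma> where \<gamma>: "gauge \<gamma>"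
      and hen: "\<And>p. \<lbrakk>p tagged_partial_division_of (cbox a b); \<gamma> fine p\<rbrakk> \<Longrightarrow>
             sum (\<lambda>(x,k). norm(measure lborel k *\<^sub>R h x - integral k h)) p < \<eta>"
      using Henstock_lemma[of h a b \<eta>] h \<eta> by auto
    \<comment> \<open>a pair \<open>(t, s)\<close> stands for the interval between \<open>t\<close> and \<open>s\<close>, tagged at its end point \<open>t\<close>\<close>
    define K where "K = {(t, s). bad k t s \<and> I t s \<subseteq> \<gamma> t}"
    define c where "c = (\<lambda>(t, s). (t + s) / 2 :: real)"
    define r where "r = (\<lambda>(t, s). \<bar>s - t\<bar> / 2 :: real)"
    have cb: "cball (c i) (r i) = I (fst i) (snd i)" for i
      by (cases i) (auto simp: c_def r_def I_def cball_eq_atLeastAtMost min_def max_def field_simps)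
    have K1: "0 < r i \<and> r i \<le> b - a" if "i \<in> K" for i
      using that by (auto simp: K_def r_def bad_def)
    obtain C where C: "countable C" "C \<subseteq> K"
     "pairwise (\<lambda>i j. disjnt (cball (c i) (r i)) (cball (c j) (r j))) C"
     "\<And>i. i \<in> K \<Longrightarrow> \<exists>j. j \<in> C \<and> \<not> disjnt (cball (c i) (r i)) (cball (c j) (r j)) \<and>
                        cball (c i) (r i) \<subseteq> ball (c j) (5 * r j)"
      by (rule Vitali_covering_lemma_cballs_balls[OF K1, where a=c]) (blast intro: that)+
    have fin: "(\<Sum>i\<in>D. 2 * r i) \<le> real (Suc k) * \<eta>" if D: "D \<subseteq> C" "finite D" for D
    proof -
      define p where "p = (\<lambda>(t, s). (t, I t s)) ` D"
      have inj: "inj_on (\<lambda>(t, s). (t, I t s)) D"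
      proof (rule inj_onI, clarsimp)
        fix t s s' assume *: "(t, s) \<in> D" "(t, s') \<in> D" "I t s = I t s'"
        then have "c (t,s) \<in> cball (c (t,s)) (r (t,s))" "c (t,s) \<in> cball (c (t,s')) (r (t,s'))"
          unfolding cb by (auto simp: I_def c_def)
        then have "\<not> disjnt (cball (c (t,s)) (r (t,s))) (cball (c (t,s')) (r (t,s')))"
          by (rule_tac notI, unfold disjnt_iff, elim allE[of _ "c (t,s)"]) simp
        moreover have "(t,s) \<in> C" "(t,s') \<in> C" using * D by auto
        ultimately have "(t,s) = (t,s')" using C(3) unfolding pairwise_def by blast
        then show "s = s'" by simp
      qed
      have "p tagged_partial_division_of (cbox a b)"
        unfolding tagged_partial_division_of_def
      proof (intro conjI allI impI)
        show "finite p" using D by (simp add: p_def)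
      next
        fix x L assume "(x, L) \<in> p"
        then obtain s where s: "(x, s) \<in> D" "L = I x s" by (auto simp: p_def)
        then have "bad k x s" using D C by (auto simp: K_def)
        then show "x \<in> L" "L \<subseteq> cbox a b" using s by (auto simp: I_def bad_def)
        show "\<exists>a b. L = cbox a b" using s by (auto simp: I_def)
      next
        fix x1 L1 x2 L2 assume *: "(x1, L1) \<in> p \<and> (x2, L2) \<in> p \<and> (x1, L1) \<noteq> (x2, L2)"
        then obtain s1 s2 where s: "(x1, s1) \<in> D" "L1 = I x1 s1" "(x2, s2) \<in> D" "L2 = I x2 s2"
          by (auto simp: p_def)
        then have "(x1,s1) \<noteq> (x2,s2)" using * by auto
        moreover have "(x1,s1) \<in> C" "(x2,s2) \<in> C" using s D by auto
        ultimately have "disjnt (cball (c (x1,s1)) (r (x1,s1))) (cball (c (x2,s2)) (r (x2,s2)))"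
          using C(3) unfolding pairwise_def by blast
        then have "disjnt L1 L2" using s by (simp add: cb)
        then show "interior L1 \<inter> interior L2 = {}"
          using interior_subset by (fastforce simp: disjnt_def)
      qed
      moreover have "\<gamma> fine p" using D C by (auto simp: fine_def p_def K_def)
      ultimately have "sum (\<lambda>(x,k). norm(measure lborel k *\<^sub>R h x - integral k h)) p < \<eta>" by (rule hen)
      also have "sum (\<lambda>(x,k). norm(measure lborel k *\<^sub>R h x - integral k h)) p =
          (\<Sum>(t,s)\<in>D. norm(measure lborel (I t s) *\<^sub>R h t - integral (I t s) h))"
        unfolding p_def by (subst sum.reindex[OF inj]) (auto intro!: sum.cong)
      finally have *: "(\<Sum>(t,s)\<in>D. norm(measure lborel (I t s) *\<^sub>R h t - integral (I t s) h)) < \<eta>" .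
      have "(\<Sum>i\<in>D. 2 * r i) \<le> (\<Sum>(t,s)\<in>D. real (Suc k) * norm(measure lborel (I t s) *\<^sub>R h t - integral (I t s) h))"
      proof (rule sum_mono, clarsimp)
        fix t s assume "(t, s) \<in> D"
        then have "bad k t s" using D C by (auto simp: K_def)
        then show "2 * r (t, s) \<le> (1 + real k) * norm (measure lborel (I t s) *\<^sub>R h t - integral (I t s) h)"
          using FI[of t s] by (auto simp: bad_def r_def)
      qed
      also have "\<dots> = real (Suc k) * (\<Sum>(t,s)\<in>D. norm(measure lborel (I t s) *\<^sub>R h t - integral (I t s) h))"
        by (simp add: sum_distrib_left split_def)
      also have "\<dots> \<le> real (Suc k) * \<eta>" using * by (intro mult_left_mono) auto
      finally show ?thesis .
    qed
    have bnd: "measure lebesgue (\<Union>i\<in>D. ball (c i) (5 * r i)) \<le> e" if D: "D \<subseteq> C" "finite D" for D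
    proof -
      have "measure lebesgue (\<Union>i\<in>D. ball (c i) (5 * r i)) \<le> (\<Sum>i\<in>D. measure lebesgue (ball (c i) (5 * r i)))"
        using D by (intro measure_UNION_le) auto
      also have "\<dots> = (\<Sum>i\<in>D. 5 * (2 * r i))"
      proof (rule sum.cong)
        fix i assume "i \<in> D"
        then have "i \<in> K" using D C by blast
        then have "r i > 0" using K1 by blast
        then show "measure lebesgue (ball (c i) (5 * r i)) = 5 * (2 * r i)"
          by (simp add: ball_eq_greaterThanLessThan)
      qed simp
      also have "\<dots> = 5 * (\<Sum>i\<in>D. 2 * r i)" by (simp add: sum_distrib_left)
      also have "\<dots> \<le> 5 * (real (Suc k) * \<eta>)" using fin[OF D] by simp
      also have "\<dots> = e" by (simp add: \<eta>_def del: of_nat_Suc)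
      finally show ?thesis .
    qed
    have "E k \<subseteq> (\<Union>i\<in>C. ball (c i) (5 * r i))"
    proof
      fix t assume t: "t \<in> E k"
      obtain d where d: "d > 0" "ball t d \<subseteq> \<gamma> t" using \<gamma> unfolding gauge_def by (meson open_contains_ball)
      obtain s where s: "\<bar>s - t\<bar> < d" "bad k t s" using t d by (auto simp: E_def)
      have "I t s \<subseteq> ball t d" using s by (auto simp: I_def dist_real_def)
      then have "(t, s) \<in> K" using s d by (auto simp: K_def)
      then obtain j where "j \<in> C" "cball (c (t,s)) (r (t,s)) \<subseteq> ball (c j) (5 * r j)" using C(4) by blast
      moreover have "t \<in> cball (c (t,s)) (r (t,s))" unfolding cb by (simp add: I_def)
      ultimately show "t \<in> (\<Union>i\<in>C. ball (c i) (5 * r i))" by blast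
    qed
    moreover have "(\<Union>i\<in>C. ball (c i) (5 * r i)) \<in> lmeasurable"
      using bnd by (intro fmeasurable_UN_bound[OF C(1)]) auto
    moreover have "measure lebesgue (\<Union>i\<in>C. ball (c i) (5 * r i)) \<le> e"
      using bnd by (intro measure_UN_bound[OF C(1)]) auto
    ultimately show "\<exists>T. E k \<subseteq> T \<and> T \<in> lmeasurable \<and> measure lebesgue T \<le> e" by blast
  qed
  then have "negligible (\<Union>k. E k)" by (intro negligible_countable_Union) auto
  moreover have "{t\<in>{a..b}. \<not> ((\<lambda>t. integral {a..t} h) has_vector_derivative h t) (at t within {a..b})} \<subseteq> (\<Union>k. E k)"
  proof (rule subsetI, rule ccontr)
    fix t assume "t \<in> {t\<in>{a..b}. \<not> ((\<lambda>t. integral {a..t} h) has_vector_derivative h t) (at t within {a..b})}"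
      and tE: "t \<notin> (\<Union>k. E k)"
    then have t: "t \<in> {a..b}" "\<not> ((\<lambda>t. integral {a..t} h) has_vector_derivative h t) (at t within {a..b})"
      by auto
    have "((\<lambda>t. F t) has_vector_derivative h t) (at t within {a..b})"
      unfolding has_vector_derivative_def has_derivative_within_alt
    proof (intro conjI allI impI)
      show "bounded_linear (\<lambda>x. x *\<^sub>R h t)" by (rule bounded_linear_scaleR_left)
      fix e :: real assume e: "0 < e"
      obtain k where k: "inverse (real (Suc k)) < e" using reals_Archimedean e by blast
      have "t \<notin> E k" using tE by auto
      then obtain d where d: "d > 0" "\<And>s. \<bar>s - t\<bar> < d \<Longrightarrow> \<not> bad k t s" by (auto simp: E_def)
      have "norm (F s - F t - (s - t) *\<^sub>R h t) \<le> e * norm (s - t)" if s: "s \<in> {a..b}" "norm (s - t) < d" for s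
      proof (cases "s = t")
        case False
        have "real (Suc k) * norm (F s - F t - (s - t) *\<^sub>R h t) \<le> \<bar>s - t\<bar>"
          using d(2)[of s] s t False by (auto simp: bad_def not_less)
        then have "norm (F s - F t - (s - t) *\<^sub>R h t) \<le> inverse (real (Suc k)) * \<bar>s - t\<bar>"
          by (simp add: field_simps)
        also have "\<dots> \<le> e * \<bar>s - t\<bar>" using k by (intro mult_right_mono) auto
        finally show ?thesis by simp
      qed simp
      then show "\<exists>d>0. \<forall>y\<in>{a..b}. norm (y - t) < d \<longrightarrow> norm (F y - F t - (y - t) *\<^sub>R h t) \<le> e * norm (y - t)"
        using d by blast
    qed
    then show False using t(2) unfolding F_def by simp
  qed
  ultimately show ?thesis using negligible_subset by blast
qed

text \<open>As for an everywhere differentiable function, except for the intervals tagged in the null set \<open>N\<close>.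
  The gauge confines them to an open set of small measure, so that their contribution to \<open>F b - F a\<close> is small
  by absolute continuity.\<close>

lemma fundamental_theorem_of_calculus_abs_cont:
  fixes F :: "real \<Rightarrow> 'e::euclidean_space"
  assumes ab: "a \<le> b" and ac: "abs_cont_on a b F" and N: "negligible N"
    and der: "\<And>t. t \<in> {a..b} - N \<Longrightarrow> (F has_vector_derivative F' t) (at t within {a..b})"
  shows "(F' has_integral F b - F a) {a..b}"
proof -
  define G where "G t = (if t \<in> N then 0 else F' t)" for t
  have "(G has_integral F b - F a) {a..b}"
    unfolding has_integral_real
  proof (intro allI impI)
    fix e :: real assume e: "0 < e"
    define e1 where "e1 = e / (2 * (b - a + 1))"
    have e1: "e1 > 0" using e ab by (simp add: e1_def)
    obtain \<delta> where \<delta>: "\<delta> > 0" and acd: "\<And>d S. d division_of S \<Longrightarrow> S \<subseteq> {a..b} \<Longrightarrow>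
        (\<Sum>k\<in>d. Sup k - Inf k) < \<delta> \<Longrightarrow> (\<Sum>k\<in>d. norm (F (Sup k) - F (Inf k))) < e / 2"
      using ac e unfolding abs_cont_on_def by (metis half_gt_zero)
    obtain T where T: "N \<subseteq> T" "T \<in> lmeasurable" "measure lebesgue T < \<delta> / 2"
      using N \<delta> unfolding negligible_outer by (meson half_gt_zero)
    obtain V where V: "open V" "T \<subseteq> V" "V \<in> lmeasurable" "measure lebesgue V < \<delta>"
    proof -
      obtain V where "open V" "T \<subseteq> V" "V - T \<in> lmeasurable" "emeasure lebesgue (V - T) < ennreal (\<delta>/2)"
        using sets_lebesgue_outer_open[of T "\<delta>/2"] T \<delta> by auto
      moreover have "V = T \<union> (V - T)" using calculation by auto
      then have "V \<in> lmeasurable" using T(2) calculation by (metis fmeasurable.Un)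
      moreover have "measure lebesgue V \<le> measure lebesgue T + measure lebesgue (V - T)"
        using T(2) calculation \<open>V = T \<union> (V - T)\<close> by (metis fmeasurableD measure_Un_le)
      moreover have "measure lebesgue (V - T) < \<delta>/2" using calculation \<delta>
        by (metis emeasure_eq_measure2 ennreal_less_iff measure_nonneg)
      ultimately show ?thesis using that T(3) by auto
    qed
    have "\<forall>x. \<exists>d>0. x \<in> {a..b} - N \<longrightarrow>
         (\<forall>y\<in>{a..b}. norm (y-x) < d \<longrightarrow> norm (F y - F x - (y-x) *\<^sub>R F' x) \<le> e1 * norm (y-x))"
      using der[unfolded has_vector_derivative_def has_derivative_within_alt] e1
      by (metis zero_less_one)
    then obtain d where d: "\<And>x. 0 < d x"
                 "\<And>x y. \<lbrakk>x \<in> {a..b} - N; y \<in> {a..b}; norm (y-x) < d x\<rbrakk>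
                        \<Longrightarrow> norm (F y - F x - (y-x) *\<^sub>R F' x) \<le> e1 * norm (y-x)"
      by metis
    define \<gamma> where "\<gamma> x = (if x \<in> N then V else ball x (d x))" for x
    have "gauge \<gamma>" using d(1) V T(1) by (auto simp: gauge_def \<gamma>_def)
    moreover have "norm ((\<Sum>(x,k)\<in>p. measure lborel k *\<^sub>R G x) - (F b - F a)) < e"
      if p: "p tagged_division_of {a..b}" "\<gamma> fine p" for p
    proof -
      have pp: "x \<in> K" "K \<subseteq> {a..b}" "\<exists>u v. u \<le> v \<and> K = {u..v}" "K \<subseteq> \<gamma> x" if xK: "(x, K) \<in> p" for x K
      proof -
        show "x \<in> K" "K \<subseteq> {a..b}" "K \<subseteq> \<gamma> x" using p that by (auto simp: tagged_division_of fine_def)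
        obtain u v where "K = cbox u v" using tagged_division_ofD(4)[OF p(1) xK] by blast
        then show "\<exists>u v. u \<le> v \<and> K = {u..v}" using \<open>x \<in> K\<close> by (metis box_real(2) atLeastatMost_empty_iff empty_iff)
      qed
      have finp: "finite p" using p by auto
      \<comment> \<open>degenerate intervals contribute nothing, and the others determine their tags because they do not overlap\<close>
      define p2 where "p2 = {(x, K)\<in>p. x \<in> N \<and> Inf K < Sup K}"
      have eq: "(\<Sum>(x,k)\<in>p. measure lborel k *\<^sub>R G x) - (F b - F a)
          = (\<Sum>(x,k)\<in>p. measure lborel k *\<^sub>R G x - (F (Sup k) - F (Inf k)))"
        using additive_tagged_division_1[OF ab p(1), of F] by (simp add: sum_subtractf split_def)
      have len: "(\<Sum>(x,K)\<in>p. Sup K - Inf K) = b - a"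
        using additive_tagged_division_1[OF ab p(1), of "\<lambda>x. x"] by simp
      have 1: "norm (measure lborel K *\<^sub>R G x - (F (Sup K) - F (Inf K))) \<le>
            e1 * (Sup K - Inf K) + (if (x,K) \<in> p2 then norm (F (Sup K) - F (Inf K)) else 0)"
        if xK: "(x, K) \<in> p" for x K
      proof -
        obtain u v where uv: "u \<le> v" "K = {u..v}" using pp(3)[OF xK] by auto
        consider "x \<notin> N" | "x \<in> N" "u < v" | "x \<in> N" "u = v" using uv by force
        then show ?thesis
        proof cases
          case 1
          have "u \<in> K" "v \<in> K" using uv by auto
          moreover have "K \<subseteq> ball x (d x)" using pp(4)[OF xK] 1 unfolding \<gamma>_def by simp
          ultimately have "u \<in> ball x (d x)" "v \<in> ball x (d x)" by blast+
          then have "x \<in> {u..v}" "u \<in> {a..b}" "v \<in> {a..b}" "x \<in> {a..b}" "u \<in> ball x (d x)" "v \<in> ball x (d x)"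
            using pp(1,2)[OF xK] uv by auto
          then have u: "norm (F u - F x - (u-x) *\<^sub>R F' x) \<le> e1 * (x - u)"
            and v: "norm (F v - F x - (v-x) *\<^sub>R F' x) \<le> e1 * (v - x)"
            using d(2)[of x u] d(2)[of x v] 1 by (auto simp: dist_real_def)
          have "(v - u) *\<^sub>R F' x - (F v - F u) =
              (F u - F x - (u-x) *\<^sub>R F' x) - (F v - F x - (v-x) *\<^sub>R F' x)" by (simp add: algebra_simps)
          then have "norm ((v - u) *\<^sub>R F' x - (F v - F u)) \<le> e1 * (x - u) + e1 * (v - x)"
            using u v by (smt (verit) norm_triangle_ineq4)
          then show ?thesis using uv 1 by (simp add: G_def p2_def algebra_simps)
        next
          case 2
          then show ?thesis using uv xK e1 by (simp add: G_def p2_def norm_minus_commute)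
        next
          case 3
          then show ?thesis using uv by (simp add: p2_def)
        qed
      qed
      have "norm ((\<Sum>(x,k)\<in>p. measure lborel k *\<^sub>R G x) - (F b - F a)) \<le>
          (\<Sum>(x,K)\<in>p. e1 * (Sup K - Inf K) + (if (x,K) \<in> p2 then norm (F (Sup K) - F (Inf K)) else 0))"
        unfolding eq by (rule sum_norm_le) (use 1 in auto)
      also have "\<dots> = e1 * (b - a) + (\<Sum>(x,K)\<in>p. (if (x,K) \<in> p2 then norm (F (Sup K) - F (Inf K)) else 0))"
        using len by (simp add: split_def sum.distrib sum_distrib_left[symmetric])
      also have "(\<Sum>(x,K)\<in>p. (if (x,K) \<in> p2 then norm (F (Sup K) - F (Inf K)) else 0)) =
          (\<Sum>(x,K)\<in>p2. norm (F (Sup K) - F (Inf K)))"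
        by (rule sum.mono_neutral_cong_right) (use finp in \<open>auto simp: p2_def split: if_splits\<close>)
      also have "\<dots> = (\<Sum>K\<in>snd ` p2. norm (F (Sup K) - F (Inf K)))"
      proof -
        have "inj_on snd p2"
        proof (rule inj_onI)
          fix i j assume ij: "i \<in> p2" "j \<in> p2" "snd i = snd j"
          obtain x y K where xy: "i = (x, K)" "j = (y, K)" using ij by (metis prod.collapse)
          obtain u v where uv: "u \<le> v" "K = {u..v}" using pp(3)[of x K] ij xy by (auto simp: p2_def)
          then have "u < v" using ij xy by (auto simp: p2_def)
          then have "interior K \<noteq> {}" using uv by simp
          then show "i = j" using p(1) ij xy unfolding tagged_division_of
            by (metis (no_types, lifting) Int_absorb case_prodD mem_Collect_eq p2_def)
        qed
        then show ?thesis by (simp add: sum.reindex split_def)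
      qed
      also have "\<dots> < e / 2"
      proof (rule acd)
        show div: "snd ` p2 division_of \<Union>(snd ` p2)"
        proof (rule division_ofI)
          show "finite (snd ` p2)" using finp by (auto simp: p2_def intro: finite_subset)
        next
          fix K assume "K \<in> snd ` p2"
          then obtain x where x: "(x, K) \<in> p" by (auto simp: p2_def)
          show "K \<subseteq> \<Union>(snd ` p2)" using \<open>K \<in> snd ` p2\<close> by auto
          show "K \<noteq> {}" using pp(1)[OF x] by auto
          show "\<exists>a b. K = cbox a b" using pp(3)[OF x] by auto
        next
          fix K1 K2 assume K: "K1 \<in> snd ` p2" "K2 \<in> snd ` p2" "K1 \<noteq> K2"
          obtain x1 where "(x1, K1) \<in> p" using K(1) by (auto simp: p2_def)
          moreover obtain x2 where "(x2, K2) \<in> p" using K(2) by (auto simp: p2_def)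
          ultimately show "interior K1 \<inter> interior K2 = {}" using p(1) \<open>K1 \<noteq> K2\<close> unfolding tagged_division_of by blast
        qed simp
        show "\<Union>(snd ` p2) \<subseteq> {a..b}" using pp by (fastforce simp: p2_def)
        have "(\<Sum>k\<in>snd ` p2. Sup k - Inf k) = (\<Sum>k\<in>snd ` p2. measure lebesgue k)"
        proof (rule sum.cong)
          fix K assume "K \<in> snd ` p2"
          then obtain x where x: "(x, K) \<in> p" by (auto simp: p2_def)
          then show "Sup K - Inf K = measure lebesgue K" using pp(3)[OF x] by auto
        qed simp
        also have "\<dots> = measure lebesgue (\<Union>(snd ` p2))"
          using content_division[OF div] by simp
        also have "\<dots> \<le> measure lebesgue V"
        proof (rule measure_mono_fmeasurable)
          show "\<Union>(snd ` p2) \<subseteq> V" using pp(4) by (fastforce simp: p2_def \<gamma>_def)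
          show "\<Union>(snd ` p2) \<in> sets lebesgue" using lmeasurable_division[OF div] by (rule fmeasurableD)
        qed (rule V)
        also have "\<dots> < \<delta>" by (rule V)
        finally show "(\<Sum>k\<in>snd ` p2. Sup k - Inf k) < \<delta>" .
      qed
      also have "e1 * (b - a) \<le> e / 2" using e ab by (simp add: e1_def field_simps)
      finally show ?thesis by simp
    qed
    ultimately show "\<exists>\<gamma>. gauge \<gamma> \<and> (\<forall>\<D>. \<D> tagged_division_of {a..b} \<and> \<gamma> fine \<D> \<longrightarrow>
        norm ((\<Sum>(x,k)\<in>\<D>. measure lborel k *\<^sub>R G x) - (F b - F a)) < e)"
      by (intro exI[of _ \<gamma>] conjI allI impI) (assumption | elim conjE)+
  qed
  moreover have "F' x = G x" if "x \<in> {a..b} - N" for x using that by (simp add: G_def)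
  ultimately show ?thesis using has_integral_spike[OF N] by blast
qed

section \<open>Indefinite integrals\<close>

text \<open>The counterpart of \<^const>\<open>L1_loc\<close> for functions of arbitrary sign, or with values in a vector space.\<close>

definition loc_int :: "(real \<Rightarrow> 'e::euclidean_space) \<Rightarrow> bool" where
  "loc_int h \<longleftrightarrow> (\<forall>T. h absolutely_integrable_on {0..T})"

lemma loc_intD: "loc_int h \<Longrightarrow> h absolutely_integrable_on {a..b}" if "0 \<le> a"
proof -
  assume "loc_int h"
  then have "h absolutely_integrable_on {0..b}" by (simp add: loc_int_def)
  then show ?thesis
    by (rule absolutely_integrable_on_subinterval) (use that in auto)
qed

lemma loc_int_integrable: "loc_int h \<Longrightarrow> 0 \<le> a \<Longrightarrow> h integrable_on {a..b}"
  using loc_intD set_lebesgue_integral_eq_integral(1) by blast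

lemma loc_int_add: "loc_int h \<Longrightarrow> loc_int k \<Longrightarrow> loc_int (\<lambda>t. h t + k t)"
  by (auto simp: loc_int_def intro: set_integral_add)

lemma loc_int_diff: "loc_int h \<Longrightarrow> loc_int k \<Longrightarrow> loc_int (\<lambda>t. h t - k t)"
  by (auto simp: loc_int_def intro: set_integral_diff)

lemma loc_int_uminus: "loc_int h \<Longrightarrow> loc_int (\<lambda>t. - h t)"
  unfolding loc_int_def using absolutely_integrable_scaleR_left[where f=h and c="-1"] by simp

lemma loc_int_mult: "loc_int h \<Longrightarrow> loc_int (\<lambda>t. c * h t :: real)"
  by (auto simp: loc_int_def)

lemma loc_int_norm: "loc_int h \<Longrightarrow> loc_int (\<lambda>t. norm (h t))"
  by (auto simp: loc_int_def intro: absolutely_integrable_norm[unfolded comp_def])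

lemma loc_int_const: "loc_int (\<lambda>t. c)"
  by (auto simp: loc_int_def intro: absolutely_integrable_on_const)

lemma loc_int_measurable:
  assumes "loc_int h"
  shows "h \<in> borel_measurable (lebesgue_on {0..})"
proof -
  have "h \<in> borel_measurable (lebesgue_on {0..real n})" for n :: nat
    using assms by (simp add: loc_int_def absolutely_integrable_measurable)
  then have "(\<lambda>t. if t \<in> {0..real n} then h t else 0) \<in> borel_measurable lebesgue" for n :: nat
    by (subst borel_measurable_if) auto
  then have "(\<lambda>t. if t \<in> {0..} then h t else 0) \<in> borel_measurable lebesgue"
  proof (rule borel_measurable_LIMSEQ_metric)
    fix t :: real
    obtain N :: nat where "t \<le> real N" using real_arch_simple by blast
    then have "\<forall>n\<ge>N. (if t \<in> {0..real n} then h t else 0) = (if t \<in> {0..} then h t else 0)" by auto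
    then show "(\<lambda>n. if t \<in> {0..real n} then h t else 0) \<longlonglongrightarrow> (if t \<in> {0..} then h t else 0)"
      by (intro tendsto_eventually) (unfold eventually_sequentially, blast)
  qed
  then show ?thesis by (subst (asm) borel_measurable_if) auto
qed

lemma measurable_lebesgue_on_subset:
  assumes "h \<in> borel_measurable (lebesgue_on {0..})" "0 \<le> a"
  shows "h \<in> borel_measurable (lebesgue_on {a..b::real})"
  using assms(1) by (rule measurable_restrict_mono) (use assms(2) in auto)

lemma loc_int_dominated:
  assumes "h \<in> borel_measurable (lebesgue_on {0..})" "loc_int m"
    and "\<And>t. 0 \<le> t \<Longrightarrow> norm (h t) \<le> m t"
  shows "loc_int h"
  unfolding loc_int_def
proof
  fix T :: real
  show "h absolutely_integrable_on {0..T}"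
    by (rule measurable_bounded_by_integrable_imp_absolutely_integrable[where g=m])
       (use assms loc_int_integrable in \<open>auto intro: measurable_lebesgue_on_subset\<close>)
qed

lemma integral_split:
  assumes "loc_int h" "0 \<le> a" "a \<le> b" "b \<le> c"
  shows "integral {a..c} h = integral {a..b} h + integral {b..c} h"
  using Henstock_Kurzweil_Integration.integral_combine[OF assms(3,4)] loc_int_integrable[OF assms(1,2)] by metis

lemma integral_diff_indefinite:
  assumes "loc_int h" "0 \<le> a" "a \<le> b"
  shows "integral {0..b} h - integral {0..a} h = integral {a..b} h"
  using integral_split[OF assms(1) order_refl assms(2,3)] by simp

lemma norm_integral_le_dominated:
  assumes "loc_int h" "loc_int m" "0 \<le> a" "\<And>t. a \<le> t \<Longrightarrow> t \<le> b \<Longrightarrow> norm (h t) \<le> m t"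
  shows "norm (integral {a..b} h) \<le> integral {a..b} m"
  by (rule integral_norm_bound_integral) (use assms in \<open>auto intro: loc_int_integrable\<close>)

lemma integral_mono_upper:
  fixes m :: "real \<Rightarrow> real"
  assumes "loc_int m" "\<And>t. 0 \<le> t \<Longrightarrow> 0 \<le> m t" "0 \<le> a" "a \<le> b"
  shows "integral {0..a} m \<le> integral {0..b} m"
proof -
  have "0 \<le> integral {a..b} m" 
    by (rule Henstock_Kurzweil_Integration.integral_nonneg) (use assms in \<open>auto intro: loc_int_integrable\<close>)
  then show ?thesis using integral_diff_indefinite[OF assms(1,3,4)] by simp
qed

lemma continuous_indefinite_integral:
  assumes "loc_int h"
  shows "continuous_on {0..} (\<lambda>t. integral {0..t} h)"
proof (rule continuous_on_eq_continuous_within[THEN iffD2], rule ballI)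
  fix t :: real assume "t \<in> {0..}"
  have "continuous_on {0..t+1} (\<lambda>t. integral {0..t} h)"
    by (rule indefinite_integral_continuous_1) (use assms in \<open>auto intro: loc_int_integrable\<close>)
  then have "continuous (at t within {0..t+1}) (\<lambda>t. integral {0..t} h)"
    using \<open>t \<in> {0..}\<close> by (auto simp: continuous_on_eq_continuous_within)
  moreover have "at t within {0..t+1} = at t within {0..}"
    using \<open>t \<in> {0..}\<close> by (intro at_within_nhd[of _ "{..<t+1}"]) auto
  ultimately show "continuous (at t within {0..}) (\<lambda>t. integral {0..t} h)" by simp
qed

lemma AE_has_derivative_indefinite_integral:
  assumes h: "loc_int h"
  shows "AE t\<in>{0..} in lebesgue. ((\<lambda>t. integral {0..t} h) has_vector_derivative h t) (at t within {0..})"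
proof -
  define B where "B n = {t\<in>{0..real n}. \<not> ((\<lambda>t. integral {0..t} h) has_vector_derivative h t) (at t within {0..real n})}" for n :: nat
  have "negligible (\<Union>n. B n)"
  proof (rule negligible_countable_Union)
    show "negligible S" if "S \<in> range B" for S
      using that negligible_not_indefinite_integral_derivative[OF loc_int_integrable[OF h order_refl]]
      unfolding B_def by blast
  qed simp
  moreover have "((\<lambda>t. integral {0..t} h) has_vector_derivative h t) (at t within {0..})"
    if t: "t \<ge> 0" "t \<notin> (\<Union>n. B n)" for t
  proof -
    obtain n :: nat where n: "t < real n" using reals_Archimedean2 by blast
    have "((\<lambda>t. integral {0..t} h) has_vector_derivative h t) (at t within {0..real n})"
      using t n by (auto simp: B_def)
    moreover have "at t within {0..real n} = at t within {0..}"
      using t n by (intro at_within_nhd[of _ "{..<real n}"]) auto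
    ultimately show ?thesis by simp
  qed
  ultimately show ?thesis
    by (intro AE_I'[of "\<Union>n. B n"]) (auto simp: negligible_iff_null_sets)
qed

text \<open>The integral of \<open>m\<close> is absolutely continuous because \<open>m\<close> differs from a bounded function by
  a function of small integral.\<close>

lemma dominated_imp_abs_cont_on:
  fixes F :: "real \<Rightarrow> 'e::euclidean_space"
  assumes m: "m absolutely_integrable_on {a..b}" "\<And>t. t \<in> {a..b} \<Longrightarrow> 0 \<le> m t"
    and dom: "\<And>r s. a \<le> r \<Longrightarrow> r \<le> s \<Longrightarrow> s \<le> b \<Longrightarrow> norm (F s - F r) \<le> integral {r..s} m"
  shows "abs_cont_on a b F"
  unfolding abs_cont_on_def
proof (intro allI impI)
  fix e :: real assume e: "0 < e"
  have mm: "(\<lambda>t. min (m t) (real n)) absolutely_integrable_on {a..b}" for n :: nat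
    using m(1) by (intro absolutely_integrable_min_1) auto
  have "(\<lambda>n. integral {a..b} (\<lambda>t. min (m t) (real n))) \<longlonglongrightarrow> integral {a..b} m"
  proof (rule dominated_convergence(2)[where h=m])
    show "(\<lambda>t. min (m t) (real n)) integrable_on {a..b}" for n using mm set_lebesgue_integral_eq_integral(1) by blast
    show "m integrable_on {a..b}" using m(1) set_lebesgue_integral_eq_integral(1) by blast
    show "norm (min (m t) (real n)) \<le> m t" if "t \<in> {a..b}" for n t using m(2)[OF that] by auto
    show "(\<lambda>n. min (m t) (real n)) \<longlonglongrightarrow> m t" if "t \<in> {a..b}" for t
    proof -
      obtain N :: nat where "m t \<le> real N" using real_arch_simple by blast
      then show ?thesis by (intro tendsto_eventually) (auto simp: eventually_sequentially intro!: exI[of _ N])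
    qed
  qed
  then obtain n :: nat where "norm (integral {a..b} (\<lambda>t. min (m t) (real n)) - integral {a..b} m) < e/2"
    using LIMSEQ_D[of _ "integral {a..b} m" "e/2"] e by (metis half_gt_zero order_refl)
  then have n: "integral {a..b} m - integral {a..b} (\<lambda>t. min (m t) (real n)) < e/2"
    unfolding real_norm_def by arith
  define k where "k t = m t - min (m t) (real n)" for t
  have k0: "0 \<le> k t" for t by (simp add: k_def)
  have kint: "k integrable_on {a..b}" unfolding k_def
    using m(1) mm[of n] by (intro integrable_diff) (auto intro: set_lebesgue_integral_eq_integral(1))
  have k: "integral {a..b} k < e/2" unfolding k_def
    using n m(1) mm[of n] by (subst Henstock_Kurzweil_Integration.integral_diff) (auto intro: set_lebesgue_integral_eq_integral(1))
  have "(\<Sum>K\<in>d. norm (F (Sup K) - F (Inf K))) < e"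
    if d: "d division_of S" "S \<subseteq> {a..b}" "(\<Sum>K\<in>d. Sup K - Inf K) < e / (2 * real (Suc n))" for d S
  proof -
    have K: "\<exists>u v. a \<le> u \<and> u \<le> v \<and> v \<le> b \<and> K = {u..v}" if Kd: "K \<in> d" for K
    proof -
      obtain u v where "K = cbox u v" "K \<noteq> {}" "K \<subseteq> S" using division_ofD(2-4)[OF d(1) Kd] by blast
      then show ?thesis using d(2) by (intro exI[of _ u] exI[of _ v]) (auto simp: subset_iff)
    qed
    have kS: "k integrable_on S"
      by (rule integrable_on_subdivision[OF d(1)]) (use kint d K in \<open>auto intro: integrable_on_subinterval\<close>)
    have "(\<Sum>K\<in>d. norm (F (Sup K) - F (Inf K))) \<le> (\<Sum>K\<in>d. integral K k + real n * (Sup K - Inf K))"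
    proof (rule sum_mono)
      fix K assume "K \<in> d"
      then obtain u v where uv: "a \<le> u" "u \<le> v" "v \<le> b" "K = {u..v}" using K by blast
      have ki: "k integrable_on {u..v}" using kint uv by (auto intro: integrable_on_subinterval)
      have mi: "m integrable_on {u..v}" using m(1) uv
        by (auto intro: set_lebesgue_integral_eq_integral(1) integrable_on_subinterval)
      have "norm (F v - F u) \<le> integral {u..v} m" using dom uv by auto
      also have "\<dots> \<le> integral {u..v} (\<lambda>t. k t + real n)"
        by (rule integral_le[OF mi integrable_add[OF ki integrable_const_ivl]]) (simp add: k_def)
      also have "\<dots> = integral {u..v} k + real n * (v - u)"
        using ki uv by (subst Henstock_Kurzweil_Integration.integral_add) auto
      finally show "norm (F (Sup K) - F (Inf K)) \<le> integral K k + real n * (Sup K - Inf K)" using uv by simp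
    qed
    also have "\<dots> = integral S k + real n * (\<Sum>K\<in>d. Sup K - Inf K)"
      using integral_combine_division_topdown[OF kS d(1)] by (simp add: sum.distrib sum_distrib_left)
    also have "integral S k \<le> integral {a..b} k"
      by (rule integral_subset_le) (use d kS kint k0 in auto)
    also have "real n * (\<Sum>K\<in>d. Sup K - Inf K) \<le> real (Suc n) * (e / (2 * real (Suc n)))"
    proof (rule mult_mono)
      show "0 \<le> (\<Sum>K\<in>d. Sup K - Inf K)" by (rule sum_nonneg) (use K in fastforce)
    qed (use d in auto)
    also have "\<dots> = e / 2" by (simp del: of_nat_Suc)
    finally show ?thesis using k by simp
  qed
  then show "\<exists>\<delta>>0. \<forall>d S. d division_of S \<and> S \<subseteq> {a..b} \<and> (\<Sum>k\<in>d. Sup k - Inf k) < \<delta> \<longrightarrow>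
        (\<Sum>k\<in>d. norm (F (Sup k) - F (Inf k))) < e"
    using e by (intro exI[of _ "e / (2 * real (Suc n))"]) auto
qed

lemma fundamental_theorem_of_calculus_dominated:
  fixes F :: "real \<Rightarrow> 'e::euclidean_space"
  assumes T: "0 \<le> T" and m: "m absolutely_integrable_on {0..T}" "\<And>t. t \<in> {0..T} \<Longrightarrow> 0 \<le> m t"
    and dom: "\<And>r s. 0 \<le> r \<Longrightarrow> r \<le> s \<Longrightarrow> s \<le> T \<Longrightarrow> norm (F s - F r) \<le> integral {r..s} m"
    and der: "AE t\<in>{0..} in lebesgue. (F has_vector_derivative F' t) (at t within {0..})"
  shows "(F' has_integral F T - F 0) {0..T}"
proof -
  obtain N where N: "N \<in> null_sets lebesgue" 
      "{t\<in>space lebesgue. \<not> (t \<in> {0..} \<longrightarrow> (F has_vector_derivative F' t) (at t within {0..}))} \<subseteq> N"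
    using der unfolding eventually_ae_filter by blast
  show ?thesis
  proof (rule fundamental_theorem_of_calculus_abs_cont[OF T])
    show "abs_cont_on 0 T F" using dominated_imp_abs_cont_on[OF m dom] .
    show "negligible N" using N by (simp add: negligible_iff_null_sets)
    fix t assume "t \<in> {0..T} - N"
    then have "(F has_vector_derivative F' t) (at t within {0..})" using N(2) by auto
    then show "(F has_vector_derivative F' t) (at t within {0..T})"
      by (rule has_vector_derivative_within_subset) auto
  qed
qed

lemma continuous_bounded_on_interval:
  fixes F :: "real \<Rightarrow> 'e::real_normed_vector"
  assumes "continuous_on {0..} F"
  shows "\<exists>C>0. \<forall>t\<in>{0..T}. norm (F t) \<le> C"
proof -
  have "compact (F ` {0..T})" using assms by (intro compact_continuous_image) (auto intro: continuous_on_subset)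
  then have "bounded (F ` {0..T})" by (rule compact_imp_bounded)
  then obtain C where "C > 0" "\<forall>y\<in>F ` {0..T}. norm y \<le> C" using bounded_pos by metis
  then show ?thesis by auto
qed

lemma continuous_measurable:
  "continuous_on {0..} x \<Longrightarrow> x \<in> borel_measurable (lebesgue_on {0::real..})"
  for x :: "real \<Rightarrow> 'e::euclidean_space"
  by (intro continuous_imp_measurable_on_sets_lebesgue) auto

lemma loc_int_scaleR_continuous:
  fixes F :: "real \<Rightarrow> 'e::euclidean_space"
  assumes "loc_int m" "continuous_on {0..} F"
  shows "loc_int (\<lambda>t. m t *\<^sub>R F t)"
  unfolding loc_int_def
proof
  fix T :: real
  obtain C where C: "C > 0" "\<forall>t\<in>{0..T}. norm (F t) \<le> C" using continuous_bounded_on_interval[OF assms(2)] by blast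
  have meas: "(\<lambda>t. m t *\<^sub>R F t) \<in> borel_measurable (lebesgue_on {0..T})"
    using loc_int_measurable[OF assms(1)] continuous_measurable[OF assms(2)]
    by (intro borel_measurable_scaleR) (auto intro: measurable_lebesgue_on_subset)
  show "(\<lambda>t. m t *\<^sub>R F t) absolutely_integrable_on {0..T}"
  proof (rule measurable_bounded_by_integrable_imp_absolutely_integrable[OF meas])
    show "(\<lambda>t. C * norm (m t)) integrable_on {0..T}"
      using loc_int_integrable[OF loc_int_mult[OF loc_int_norm[OF assms(1)]] order_refl] .
    show "norm (m t *\<^sub>R F t) \<le> C * norm (m t)" if "t \<in> {0..T}" for t
      using mult_left_mono[of "norm (F t)" C "\<bar>m t\<bar>"] C that by (simp add: mult.commute)
  qed auto
qed

lemma loc_int_mult_continuous: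
  "loc_int m \<Longrightarrow> continuous_on {0..} F \<Longrightarrow> loc_int (\<lambda>t. m t * F t :: real)"
  using loc_int_scaleR_continuous[of m F] by simp

lemma loc_int_inner_continuous:
  fixes F :: "real \<Rightarrow> 'e::euclidean_space"
  assumes "loc_int m" "continuous_on {0..} F"
  shows "loc_int (\<lambda>t. m t \<bullet> F t)"
  unfolding loc_int_def
proof
  fix T :: real
  obtain C where C: "C > 0" "\<forall>t\<in>{0..T}. norm (F t) \<le> C" using continuous_bounded_on_interval[OF assms(2)] by blast
  have meas: "(\<lambda>t. m t \<bullet> F t) \<in> borel_measurable (lebesgue_on {0..T})"
    using loc_int_measurable[OF assms(1)] continuous_measurable[OF assms(2)]
    by (intro borel_measurable_inner) (auto intro: measurable_lebesgue_on_subset)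
  show "(\<lambda>t. m t \<bullet> F t) absolutely_integrable_on {0..T}"
  proof (rule measurable_bounded_by_integrable_imp_absolutely_integrable[OF meas])
    show "(\<lambda>t. C * norm (m t)) integrable_on {0..T}"
      using loc_int_integrable[OF loc_int_mult[OF loc_int_norm[OF assms(1)]] order_refl] .
    show "norm (m t \<bullet> F t) \<le> C * norm (m t)" if "t \<in> {0..T}" for t
    proof -
      have "norm (m t \<bullet> F t) \<le> norm (m t) * norm (F t)" by (simp add: Cauchy_Schwarz_ineq2)
      also have "\<dots> \<le> norm (m t) * C" using C that by (intro mult_left_mono) auto
      finally show ?thesis by (simp add: mult.commute)
    qed
  qed auto
qed

text \<open>The product of two primitives is again the primitive of an integrable function, and the boundary terms
  vanish because \<open>p T = 0\<close> and the primitive of \<open>\<delta>\<close> starts at zero.\<close>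

lemma integral_by_parts_inner:
  fixes \<zeta> \<delta> :: "real \<Rightarrow> 'e::euclidean_space"
  assumes \<zeta>: "loc_int \<zeta>" and \<delta>: "loc_int \<delta>" and T: "0 \<le> T"
    and p: "continuous_on {0..} p" and p': "\<And>t. 0 \<le> t \<Longrightarrow> t \<le> T \<Longrightarrow> p t = p 0 + integral {0..t} \<zeta>" and pT: "p T = 0"
  shows "integral {0..T} (\<lambda>t. p t \<bullet> \<delta> t) = - integral {0..T} (\<lambda>t. \<zeta> t \<bullet> integral {0..t} \<delta>)"
proof -
  \<comment> \<open>\<open>p\<close> is a primitive of \<open>\<zeta>\<close> up to time \<open>T\<close>, and \<open>q\<close> continues it as such to the half-line\<close>
  define q where "q t = p 0 + integral {0..t} \<zeta>" for t
  define y where "y t = integral {0..t} \<delta>" for t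
  have qc: "continuous_on {0..} q" unfolding q_def
    by (intro continuous_intros continuous_indefinite_integral \<zeta>)
  have yc: "continuous_on {0..} y" unfolding y_def by (intro continuous_indefinite_integral \<delta>)
  obtain C where C: "C > 0" "\<forall>t\<in>{0..T}. norm (q t) \<le> C" using continuous_bounded_on_interval[OF qc] by blast
  obtain D where D: "D > 0" "\<forall>t\<in>{0..T}. norm (y t) \<le> D" using continuous_bounded_on_interval[OF yc] by blast
  define m where "m t = C * norm (\<delta> t) + D * norm (\<zeta> t)" for t
  have m: "loc_int m" unfolding m_def
    by (intro loc_int_add loc_int_mult loc_int_norm \<zeta> \<delta>)
  have "((\<lambda>t. q t \<bullet> \<delta> t + \<zeta> t \<bullet> y t) has_integral q T \<bullet> y T - q 0 \<bullet> y 0) {0..T}"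
  proof (rule fundamental_theorem_of_calculus_dominated[OF T, where m=m])
    show "m absolutely_integrable_on {0..T}" using m by (simp add: loc_int_def)
    show "0 \<le> m t" for t using C D by (simp add: m_def)
    show "norm (q s \<bullet> y s - q r \<bullet> y r) \<le> integral {r..s} m" if rs: "0 \<le> r" "r \<le> s" "s \<le> T" for r s
    proof -
      have y: "y s - y r = integral {r..s} \<delta>" unfolding y_def using rs \<delta> by (simp add: integral_diff_indefinite)
      have q: "q s - q r = integral {r..s} \<zeta>" unfolding q_def using rs \<zeta> by (simp add: integral_diff_indefinite)
      have y': "norm (y s - y r) \<le> integral {r..s} (\<lambda>t. norm (\<delta> t))" unfolding y 
        by (rule norm_integral_le_dominated[OF \<delta> loc_int_norm[OF \<delta>] rs(1)]) simp
      have q': "norm (q s - q r) \<le> integral {r..s} (\<lambda>t. norm (\<zeta> t))" unfolding q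
        by (rule norm_integral_le_dominated[OF \<zeta> loc_int_norm[OF \<zeta>] rs(1)]) simp
      have "q s \<bullet> y s - q r \<bullet> y r = q s \<bullet> (y s - y r) + (q s - q r) \<bullet> y r" by (simp add: inner_diff)
      then have "norm (q s \<bullet> y s - q r \<bullet> y r) \<le> norm (q s \<bullet> (y s - y r)) + norm ((q s - q r) \<bullet> y r)" 
        by (simp add: norm_triangle_ineq)
      also have "\<dots> \<le> norm (q s) * norm (y s - y r) + norm (q s - q r) * norm (y r)"
        by (intro add_mono) (simp_all add: Cauchy_Schwarz_ineq2)
      also have "\<dots> \<le> C * integral {r..s} (\<lambda>t. norm (\<delta> t)) + integral {r..s} (\<lambda>t. norm (\<zeta> t)) * D"
        using C D rs y' q' by (intro add_mono mult_mono) (auto intro: order_trans[OF norm_ge_zero])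
      also have "\<dots> = integral {r..s} m" unfolding m_def
        using loc_int_integrable[OF loc_int_mult[OF loc_int_norm[OF \<delta>]] rs(1)]
          loc_int_integrable[OF loc_int_mult[OF loc_int_norm[OF \<zeta>]] rs(1)]
        by (subst Henstock_Kurzweil_Integration.integral_add) auto
      finally show ?thesis .
    qed
    show "AE t\<in>{0..} in lebesgue. ((\<lambda>t. q t \<bullet> y t) has_vector_derivative q t \<bullet> \<delta> t + \<zeta> t \<bullet> y t) (at t within {0..})"
      using AE_has_derivative_indefinite_integral[OF \<zeta>] AE_has_derivative_indefinite_integral[OF \<delta>]
    proof eventually_elim
      case (elim t)
      show ?case
      proof
        assume t: "t \<in> {0..}"
        have "(y has_vector_derivative \<delta> t) (at t within {0..})" using elim t unfolding y_def by auto
        moreover have "(q has_vector_derivative \<zeta> t) (at t within {0..})" 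
          using elim t unfolding q_def by (auto intro!: derivative_eq_intros)
        ultimately show "((\<lambda>t. q t \<bullet> y t) has_vector_derivative q t \<bullet> \<delta> t + \<zeta> t \<bullet> y t) (at t within {0..})"
          by (intro bounded_bilinear.has_vector_derivative[OF bounded_bilinear_inner])
      qed
    qed
  qed
  moreover have "q T = 0" using pT p'[of T] T by (simp add: q_def)
  moreover have "y 0 = 0" by (simp add: y_def)
  ultimately have "((\<lambda>t. q t \<bullet> \<delta> t + \<zeta> t \<bullet> y t) has_integral 0) {0..T}" by simp
  then have "integral {0..T} (\<lambda>t. q t \<bullet> \<delta> t + \<zeta> t \<bullet> y t) = 0" by (rule integral_unique)
  moreover have "integral {0..T} (\<lambda>t. q t \<bullet> \<delta> t + \<zeta> t \<bullet> y t) = integral {0..T} (\<lambda>t. q t \<bullet> \<delta> t) + integral {0..T} (\<lambda>t. \<zeta> t \<bullet> y t)"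
    using loc_int_integrable[OF loc_int_inner_continuous[OF \<delta> qc] order_refl]
      loc_int_integrable[OF loc_int_inner_continuous[OF \<zeta> yc] order_refl]
    by (intro Henstock_Kurzweil_Integration.integral_add) (auto simp: inner_commute)
  moreover have "integral {0..T} (\<lambda>t. q t \<bullet> \<delta> t) = integral {0..T} (\<lambda>t. p t \<bullet> \<delta> t)"
    by (rule Henstock_Kurzweil_Integration.integral_cong) (simp add: q_def p'[symmetric])
  ultimately show ?thesis by (simp add: y_def)
qed

section \<open>Growth estimates\<close>

text \<open>With the factor 2 the integral of \<open>m t * growth m t\<close> is less than one half of \<open>growth m\<close>. In the norm
  weighted by \<open>growth m\<close>, an integral operator with Lipschitz constant \<open>m t\<close> is therefore a contraction by 1/2.\<close>

definition growth :: "(real \<Rightarrow> real) \<Rightarrow> real \<Rightarrow> real" where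
  "growth m t = exp (2 * integral {0..t} m)"

lemma growth_pos [simp]: "0 < growth m t" and growth_nonzero [simp]: "growth m t \<noteq> 0" and growth_0 [simp]: "growth m 0 = 1"
  by (simp_all add: growth_def)

lemma growth_mono:
  assumes "loc_int m" "\<And>t. 0 \<le> t \<Longrightarrow> 0 \<le> m t" "0 \<le> s" "s \<le> t"
  shows "growth m s \<le> growth m t"
  using integral_mono_upper[OF assms] by (simp add: growth_def)

lemma growth_ge_1:
  assumes "loc_int m" "\<And>t. 0 \<le> t \<Longrightarrow> 0 \<le> m t" "0 \<le> t"
  shows "1 \<le> growth m t"
  using growth_mono[OF assms(1,2) order_refl assms(3)] by simp

lemma continuous_growth: "loc_int m \<Longrightarrow> continuous_on {0..} (growth m)"
  unfolding growth_def by (intro continuous_intros continuous_indefinite_integral)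

lemma integral_mult_growth:
  assumes m: "loc_int m" "\<And>t. 0 \<le> t \<Longrightarrow> 0 \<le> m t" and T: "0 \<le> T"
  shows "integral {0..T} (\<lambda>t. m t * growth m t) = (growth m T - 1) / 2"
proof -
  have "((\<lambda>t. 2 * m t * growth m t) has_integral growth m T - growth m 0) {0..T}"
  proof (rule fundamental_theorem_of_calculus_dominated[OF T, where m="\<lambda>t. 2 * growth m T * m t"])
    show "(\<lambda>t. 2 * growth m T * m t) absolutely_integrable_on {0..T}" 
      using loc_int_mult[OF m(1)] by (auto simp: loc_int_def)
    show "0 \<le> 2 * growth m T * m t" if "t \<in> {0..T}" for t using m that by (simp add: less_imp_le)
    show "norm (growth m s - growth m r) \<le> integral {r..s} (\<lambda>t. 2 * growth m T * m t)" if rs: "0 \<le> r" "r \<le> s" "s \<le> T" for r s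
    proof -
      have "growth m s - growth m r \<le> growth m s * (2 * integral {r..s} m)"
      proof -
        have e: "growth m r = growth m s * exp (- (2 * integral {r..s} m))"
          unfolding growth_def exp_add[symmetric] using integral_diff_indefinite[OF m(1) rs(1,2)] by (simp add: algebra_simps)
        have "1 + - (2 * integral {r..s} m) \<le> exp (- (2 * integral {r..s} m))" by (rule exp_ge_add_one_self)
        then have "growth m s * (1 + - (2 * integral {r..s} m)) \<le> growth m s * exp (- (2 * integral {r..s} m))"
          by (intro mult_left_mono) (auto simp: less_imp_le)
        then show ?thesis using e by (simp add: algebra_simps)
      qed
      also have "\<dots> \<le> growth m T * (2 * integral {r..s} m)"
        using rs m growth_mono[OF m, of s T] integral_nonneg[OF loc_int_integrable[OF m(1) rs(1)]]
        by (intro mult_right_mono) auto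
      finally show ?thesis using growth_mono[OF m rs(1,2)] by simp
    qed
    show "AE t\<in>{0..} in lebesgue. (growth m has_vector_derivative 2 * m t * growth m t) (at t within {0..})"
      using AE_has_derivative_indefinite_integral[OF m(1)]
    proof eventually_elim
      case (elim t)
      show ?case
      proof
        assume "t \<in> {0..}"
        with elim have "((\<lambda>t. integral {0..t} m) has_real_derivative m t) (at t within {0..})"
          by (simp add: has_real_derivative_iff_has_vector_derivative)
        then have "((\<lambda>t. exp (2 * integral {0..t} m)) has_real_derivative exp (2 * integral {0..t} m) * (2 * m t)) (at t within {0..})"
          by (rule DERIV_chain2[OF DERIV_exp DERIV_cmult])
        then show "(growth m has_vector_derivative 2 * m t * growth m t) (at t within {0..})"
          unfolding growth_def has_real_derivative_iff_has_vector_derivative by (simp add: mult_ac)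
      qed
    qed
  qed
  then have "integral {0..T} (\<lambda>t. 2 * (m t * growth m t)) = growth m T - 1" 
    unfolding mult.assoc[symmetric] by (simp add: integral_unique)
  then show ?thesis by simp
qed

text \<open>At the point where \<open>a t / growth m t\<close> is largest the integral absorbs at most one half of this maximum.\<close>

lemma gronwall:
  assumes m: "loc_int m" "\<And>t. 0 \<le> t \<Longrightarrow> 0 \<le> m t" and T: "0 \<le> T"
    and a: "continuous_on {0..} a" "\<And>t. 0 \<le> t \<Longrightarrow> 0 \<le> a t" and c: "0 \<le> c"
    and le: "\<And>t. 0 \<le> t \<Longrightarrow> t \<le> T \<Longrightarrow> a t \<le> c + integral {0..t} (\<lambda>s. m s * a s)"
  shows "a T \<le> 2 * c * growth m T"
proof -
  have "continuous_on {0..T} (\<lambda>t. a t / growth m t)"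
    by (intro continuous_on_divide continuous_on_subset[OF a(1)] continuous_on_subset[OF continuous_growth[OF m(1)]])
       (auto simp: less_imp_neq[symmetric])
  then obtain t where t: "t \<in> {0..T}" "\<And>s. s \<in> {0..T} \<Longrightarrow> a s / growth m s \<le> a t / growth m t"
    using continuous_attains_sup[of "{0..T}" "\<lambda>t. a t / growth m t"] T by auto
  define S where "S = a t / growth m t"
  have S0: "0 \<le> S" using a(2) t by (simp add: S_def less_imp_le)
  have aS: "a s \<le> S * growth m s" if "s \<in> {0..T}" for s
    using t(2)[OF that] by (simp add: S_def[symmetric] divide_le_eq)
  have "a t \<le> c + integral {0..t} (\<lambda>s. m s * a s)" using le t by auto
  also have "integral {0..t} (\<lambda>s. m s * a s) \<le> integral {0..t} (\<lambda>s. S * (m s * growth m s))"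
  proof (rule integral_le)
    show "(\<lambda>s. m s * a s) integrable_on {0..t}"
      using loc_int_mult_continuous[OF m(1) a(1)] by (auto intro: loc_int_integrable)
    show "(\<lambda>s. S * (m s * growth m s)) integrable_on {0..t}"
      using loc_int_mult[OF loc_int_mult_continuous[OF m(1) continuous_growth[OF m(1)]]] by (auto intro: loc_int_integrable)
    show "m s * a s \<le> S * (m s * growth m s)" if "s \<in> {0..t}" for s
      using mult_left_mono[OF aS, of s "m s"] that t m(2) by (simp add: mult_ac)
  qed
  also have "\<dots> = S * ((growth m t - 1) / 2)" using integral_mult_growth[OF m] t by simp
  finally have "a t \<le> c + S * ((growth m t - 1) / 2)" by simp
  moreover have "a t = S * growth m t" by (simp add: S_def)
  moreover have "c \<le> c * growth m t" using c growth_ge_1[OF m, of t] t by (simp add: mult_le_cancel_left1)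
  moreover have "S * ((growth m t - 1) / 2) = S * growth m t / 2 - S / 2" by (simp add: field_simps)
  ultimately have "S * growth m t \<le> 2 * (c * growth m t)" using S0 by linarith
  then have "S \<le> 2 * c" using mult_le_cancel_right_pos[OF growth_pos, of S m t "2 * c"] by simp
  then have "S * growth m T \<le> 2 * c * growth m T" by (intro mult_right_mono) (simp_all add: less_imp_le)
  moreover have "a T \<le> S * growth m T" using aS T by simp
  ultimately show ?thesis by linarith
qed

text \<open>The stability estimate for all that follows: the curves may belong to different fields or to different controls,
  and the comparison with the zero curve is the a priori bound for trajectories.\<close>

lemma integral_curve_compare:
  fixes x y p q :: "real \<Rightarrow> 'e::euclidean_space"
  assumes m: "loc_int m" "\<And>t. 0 \<le> t \<Longrightarrow> 0 \<le> m t" and T: "0 \<le> T"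
    and x: "continuous_on {0..} x" and y: "continuous_on {0..} y" and p: "loc_int p" and q: "loc_int q" and e: "loc_int e"
    and xeq: "\<And>t. 0 \<le> t \<Longrightarrow> t \<le> T \<Longrightarrow> x t = x 0 + integral {0..t} p"
    and yeq: "\<And>t. 0 \<le> t \<Longrightarrow> t \<le> T \<Longrightarrow> y t = y 0 + integral {0..t} q"
    and le: "\<And>s. 0 \<le> s \<Longrightarrow> s \<le> T \<Longrightarrow> norm (p s - q s) \<le> m s * norm (x s - y s) + e s"
    and e0: "\<And>s. 0 \<le> s \<Longrightarrow> 0 \<le> e s"
  shows "norm (x T - y T) \<le> 2 * (norm (x 0 - y 0) + integral {0..T} e) * growth m T"
proof (rule gronwall[OF m T])
  show "continuous_on {0..} (\<lambda>t. norm (x t - y t))" by (intro continuous_intros x y)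
  have e': "0 \<le> integral {0..T} e" by (rule integral_nonneg) (use e e0 in \<open>auto intro: loc_int_integrable\<close>)
  then show "0 \<le> norm (x 0 - y 0) + integral {0..T} e" by simp
  fix t assume t: "0 \<le> t" "t \<le> T"
  have ma: "loc_int (\<lambda>s. m s * norm (x s - y s))"
    by (intro loc_int_mult_continuous m continuous_intros x y)
  have "x t - y t = (x 0 - y 0) + integral {0..t} (\<lambda>s. p s - q s)"
    using xeq[OF t] yeq[OF t] loc_int_integrable[OF p order_refl] loc_int_integrable[OF q order_refl]
    by (simp add: Henstock_Kurzweil_Integration.integral_diff)
  then have "norm (x t - y t) \<le> norm (x 0 - y 0) + norm (integral {0..t} (\<lambda>s. p s - q s))" 
    by (simp add: norm_triangle_ineq)
  also have "norm (integral {0..t} (\<lambda>s. p s - q s)) \<le> integral {0..t} (\<lambda>s. m s * norm (x s - y s) + e s)"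
    by (rule norm_integral_le_dominated) (use le t p q e ma in \<open>auto intro: loc_int_diff loc_int_add\<close>)
  also have "\<dots> = integral {0..t} (\<lambda>s. m s * norm (x s - y s)) + integral {0..t} e"
    using loc_int_integrable[OF ma order_refl] loc_int_integrable[OF e order_refl]
    by (rule Henstock_Kurzweil_Integration.integral_add)
  also have "integral {0..t} e \<le> integral {0..T} e" using integral_mono_upper[OF e e0] t by simp
  finally show "norm (x t - y t) \<le> norm (x 0 - y 0) + integral {0..T} e + integral {0..t} (\<lambda>s. m s * norm (x s - y s))"
    by simp
qed simp_all

section \<open>Caratheodory differential equations\<close>

definition caratheodory_field :: "(real \<Rightarrow> 'e::euclidean_space \<Rightarrow> 'f::euclidean_space) \<Rightarrow> bool" where
  "caratheodory_field \<Phi> \<longleftrightarrow>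
     (\<forall>x. (\<lambda>t. \<Phi> t x) \<in> borel_measurable (lebesgue_on {0..})) \<and> (\<forall>t\<ge>0. continuous_on UNIV (\<Phi> t))"

text \<open>The state is a limit of simple functions of itself; along these only countably many fixed states occur.\<close>

lemma caratheodory_field_jointly_measurable:
  assumes "caratheodory_field \<Phi>"
  shows "(\<lambda>(t, x). \<Phi> t x) \<in> borel_measurable (lebesgue_on {0..} \<Otimes>\<^sub>M borel)"
proof -
  obtain F :: "nat \<Rightarrow> 'a \<Rightarrow> 'a" where F: "\<And>i. simple_function borel (F i)" "\<And>x. (\<lambda>i. F i x) \<longlonglongrightarrow> x"
    using borel_measurable_implies_sequence_metric[of "\<lambda>x::'a. x" borel 0] by auto
  have "(\<lambda>p. \<Phi> (fst p) (F i (snd p))) \<in> borel_measurable (lebesgue_on {0..} \<Otimes>\<^sub>M borel)" for i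
  proof (rule measurable_compose_countable'[where I="range (F i)"])
    show "(\<lambda>p. \<Phi> (fst p) x) \<in> borel_measurable (lebesgue_on {0..} \<Otimes>\<^sub>M borel)" for x
      using assms unfolding caratheodory_field_def by (intro measurable_compose[OF measurable_fst]) auto
    show "(\<lambda>p. F i (snd p)) \<in> lebesgue_on {0..} \<Otimes>\<^sub>M borel \<rightarrow>\<^sub>M count_space (range (F i))"
      using F(1)[of i] by (intro measurable_compose[OF measurable_snd]) (auto simp: measurable_simple_function simple_function_def intro!: measurable_count_space_eq2[THEN iffD2])
    show "countable (range (F i))" using F(1)[of i] by (simp add: simple_function_def countable_finite)
  qed
  moreover have "(\<lambda>i. \<Phi> (fst p) (F i (snd p))) \<longlonglongrightarrow> (\<lambda>(t, x). \<Phi> t x) p"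
    if "p \<in> space (lebesgue_on {0..} \<Otimes>\<^sub>M borel)" for p
  proof -
    have "isCont (\<Phi> (fst p)) (snd p)"
      using that assms by (auto simp: caratheodory_field_def space_pair_measure continuous_on_eq_continuous_at)
    then show ?thesis using F(2)[of "snd p"] by (auto simp: split_def intro: isCont_tendsto_compose)
  qed
  ultimately show ?thesis by (rule borel_measurable_LIMSEQ_metric)
qed

lemma caratheodory_field_compose:
  assumes "caratheodory_field \<Phi>" "x \<in> borel_measurable (lebesgue_on {0..})"
  shows "(\<lambda>t. \<Phi> t (x t)) \<in> borel_measurable (lebesgue_on {0..})"
proof -
  have "(\<lambda>t. (t, x t)) \<in> lebesgue_on {0..} \<rightarrow>\<^sub>M lebesgue_on {0..} \<Otimes>\<^sub>M borel"
    using assms(2) by (intro measurable_Pair) auto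
  from measurable_compose[OF this caratheodory_field_jointly_measurable[OF assms(1)]] show ?thesis by simp
qed

lemma loc_int_field_along_curve:
  assumes \<Phi>: "caratheodory_field \<Phi>" and x: "continuous_on {0..} x" and m: "loc_int m"
    and lip: "\<And>t x y. 0 \<le> t \<Longrightarrow> norm (\<Phi> t x - \<Phi> t y) \<le> m t * norm (x - y)"
    and zero: "loc_int (\<lambda>t. \<Phi> t 0)"
  shows "loc_int (\<lambda>t. \<Phi> t (x t))"
proof (rule loc_int_dominated)
  show "(\<lambda>t. \<Phi> t (x t)) \<in> borel_measurable (lebesgue_on {0..})"
    using \<Phi> continuous_measurable[OF x] by (rule caratheodory_field_compose)
  show "loc_int (\<lambda>t. m t * norm (x t) + norm (\<Phi> t 0))"
    by (intro loc_int_add loc_int_mult_continuous loc_int_norm m zero continuous_intros x)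
  show "norm (\<Phi> t (x t)) \<le> m t * norm (x t) + norm (\<Phi> t 0)" if "0 \<le> t" for t
    using lip[OF that, of "x t" 0] norm_triangle_sub[of "\<Phi> t (x t)" "\<Phi> t 0"] by simp
qed

text \<open>In the norm weighted by \<open>growth\<close> the Picard operator is a contraction on the whole half-line.\<close>

lemma caratheodory_ode_exists:
  fixes \<Phi> :: "real \<Rightarrow> 'e::euclidean_space \<Rightarrow> 'e"
  assumes \<Phi>: "caratheodory_field \<Phi>" and m: "loc_int m" "\<And>t. 0 \<le> t \<Longrightarrow> 0 \<le> m t"
    and lip: "\<And>t x y. 0 \<le> t \<Longrightarrow> norm (\<Phi> t x - \<Phi> t y) \<le> m t * norm (x - y)"
    and zero: "loc_int (\<lambda>t. \<Phi> t 0)"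
  shows "\<exists>x. continuous_on {0..} x \<and> (\<forall>t\<ge>0. x t = x0 + integral {0..t} (\<lambda>s. \<Phi> s (x s)))"
proof -
  \<comment> \<open>the inhomogeneity is part of the weight, so that the Picard operator preserves boundedness in the weighted norm\<close>
  define n where "n t = m t + norm (\<Phi> t 0)" for t
  have n: "loc_int n" "\<And>t. 0 \<le> t \<Longrightarrow> 0 \<le> n t"
    unfolding n_def using loc_int_add[OF m(1) loc_int_norm[OF zero]] m(2) by simp_all
  define W where "W = growth n"
  have W0: "0 < W t" for t by (simp add: W_def)
  have W1: "1 \<le> W t" if "0 \<le> t" for t using growth_ge_1[OF n that] by (simp add: W_def)
  \<comment> \<open>the fixed point is sought among bounded continuous functions on the whole line, hence the clamping of times\<close>
  define cl where "cl t = max 0 t" for t :: real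
  have cl: "0 \<le> cl t" "0 \<le> t \<Longrightarrow> cl t = t" for t by (auto simp: cl_def)
  have clc: "continuous_on UNIV cl" unfolding cl_def by (intro continuous_intros)
  have Wc: "continuous_on {0..} W" unfolding W_def by (rule continuous_growth[OF n(1)])
  have li: "loc_int (\<lambda>s. \<Phi> s (W s *\<^sub>R z s))" if "continuous_on {0..} z" for z
    by (rule loc_int_field_along_curve[OF \<Phi> continuous_on_scaleR[OF Wc that] m(1) lip zero])
  define P where "P z t = (x0 + integral {0..cl t} (\<lambda>s. \<Phi> s (W s *\<^sub>R z s))) /\<^sub>R W (cl t)" for z :: "real \<Rightarrow> 'e" and t
  have bound: "norm (integral {0..t} h) / W t \<le> C / 2"
    if "loc_int h" "\<And>s. 0 \<le> s \<Longrightarrow> norm (h s) \<le> C * (n s * W s)" "0 \<le> t" "0 \<le> C" for h :: "real \<Rightarrow> 'e" and C t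
  proof -
    have "norm (integral {0..t} h) \<le> integral {0..t} (\<lambda>s. C * (n s * W s))"
      by (rule norm_integral_le_dominated[OF that(1) loc_int_mult[OF loc_int_mult_continuous[OF n(1) Wc]] order_refl that(2)])
    also have "\<dots> = C * ((W t - 1) / 2)" using integral_mult_growth[OF n that(3)] by (simp add: W_def)
    also have "\<dots> \<le> C / 2 * W t" using that by (simp add: algebra_simps)
    finally show ?thesis using W0[of t] by (simp add: divide_le_eq)
  qed
  have PB: "P (apply_bcontfun z) \<in> bcontfun" for z :: "real \<Rightarrow>\<^sub>C 'e"
  proof (rule bcontfun_normI)
    have zc: "continuous_on {0..} (apply_bcontfun z)" by simp
    have c1: "continuous_on UNIV (\<lambda>t. integral {0..cl t} (\<lambda>s. \<Phi> s (W s *\<^sub>R z s)))"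
      by (rule continuous_on_compose2[OF continuous_indefinite_integral[OF li[OF zc]] clc]) (auto simp: cl)
    have c2: "continuous_on UNIV (\<lambda>t. W (cl t))"
      by (rule continuous_on_compose2[OF Wc clc]) (auto simp: cl)
    show "continuous_on UNIV (P (apply_bcontfun z))"
      unfolding P_def using W0 by (intro continuous_intros c1 c2) (auto simp: less_imp_neq[symmetric])
    fix t
    have "norm (integral {0..cl t} (\<lambda>s. \<Phi> s (W s *\<^sub>R z s))) / W (cl t) \<le> (1 + norm z) / 2"
    proof (rule bound[OF li[OF zc] _ cl(1)])
      fix s :: real assume s: "0 \<le> s"
      have "norm (\<Phi> s (W s *\<^sub>R z s)) \<le> norm (\<Phi> s 0) + m s * norm (W s *\<^sub>R z s)"
        using lip[OF s, of "W s *\<^sub>R z s" 0] norm_triangle_sub[of "\<Phi> s (W s *\<^sub>R z s)" "\<Phi> s 0"] by simp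
      also have "\<dots> \<le> norm (\<Phi> s 0) * W s + m s * (W s * norm z)"
        using W1[OF s] m(2)[OF s] norm_bounded[of z s] W0[of s]
        by (intro add_mono mult_left_mono) (auto simp: mult_le_cancel_left1 less_imp_le)
      also have "\<dots> \<le> (1 + norm z) * (n s * W s)"
        using m(2)[OF s] W0[of s] by (simp add: n_def algebra_simps less_imp_le)
      finally show "norm (\<Phi> s (W s *\<^sub>R z s)) \<le> (1 + norm z) * (n s * W s)" .
    qed simp
    moreover have "norm x0 / W (cl t) \<le> norm x0"
      using W1[OF cl(1), of t] by (simp add: divide_le_eq mult_le_cancel_left1)
    moreover have "norm (P (apply_bcontfun z) t) \<le> norm x0 / W (cl t) + norm (integral {0..cl t} (\<lambda>s. \<Phi> s (W s *\<^sub>R z s))) / W (cl t)"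
    proof -
      have "norm (P (apply_bcontfun z) t) = norm (x0 + integral {0..cl t} (\<lambda>s. \<Phi> s (W s *\<^sub>R z s))) / W (cl t)"
        unfolding P_def using W0[of "cl t"] by (simp add: divide_inverse_commute)
      also have "\<dots> \<le> (norm x0 + norm (integral {0..cl t} (\<lambda>s. \<Phi> s (W s *\<^sub>R z s)))) / W (cl t)"
        using W0[of "cl t"] by (intro divide_right_mono norm_triangle_ineq) (simp add: less_imp_le)
      finally show ?thesis by (simp add: add_divide_distrib)
    qed
    ultimately show "norm (P (apply_bcontfun z) t) \<le> norm x0 + (1 + norm z) / 2" by linarith
  qed
  define Q where "Q z = Bcontfun (P (apply_bcontfun z))" for z
  have Q: "apply_bcontfun (Q z) = P (apply_bcontfun z)" for z
    unfolding Q_def by (rule Bcontfun_inverse[OF PB])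
  have "\<exists>!z. Q z = z"
  proof (rule banach_fix_type[of "1/2"])
    show "\<forall>z y. dist (Q z) (Q y) \<le> 1/2 * dist z y"
    proof (intro allI dist_bound)
      fix z y :: "real \<Rightarrow>\<^sub>C 'e" and t
      have zc: "continuous_on {0..} (apply_bcontfun z)" "continuous_on {0..} (apply_bcontfun y)" by simp_all
      let ?h = "\<lambda>s. \<Phi> s (W s *\<^sub>R z s) - \<Phi> s (W s *\<^sub>R y s)"
      have "integral {0..cl t} (\<lambda>s. \<Phi> s (W s *\<^sub>R z s)) - integral {0..cl t} (\<lambda>s. \<Phi> s (W s *\<^sub>R y s)) = integral {0..cl t} ?h"
        using loc_int_integrable[OF li[OF zc(1)] order_refl] loc_int_integrable[OF li[OF zc(2)] order_refl]
        by (simp add: Henstock_Kurzweil_Integration.integral_diff)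
      then have "P z t - P y t = integral {0..cl t} ?h /\<^sub>R W (cl t)"
        unfolding P_def by (simp add: scaleR_diff_right[symmetric])
      then have "dist (P z t) (P y t) = norm (integral {0..cl t} ?h) / W (cl t)"
        using W0[of "cl t"] by (simp add: dist_norm divide_inverse_commute)
      also have "\<dots> \<le> dist z y / 2"
      proof (rule bound[OF loc_int_diff[OF li[OF zc(1)] li[OF zc(2)]] _ cl(1)])
        fix s :: real assume s: "0 \<le> s"
        have "norm (?h s) \<le> m s * norm (W s *\<^sub>R z s - W s *\<^sub>R y s)" by (rule lip[OF s])
        also have "\<dots> = m s * (W s * dist (z s) (y s))"
          using W0[of s] by (simp add: scaleR_diff_right[symmetric] dist_norm)
        also have "\<dots> \<le> n s * (W s * dist z y)"
          using m(2)[OF s] W0[of s] dist_bounded[of z s y] by (intro mult_mono) (auto simp: n_def less_imp_le)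
        finally show "norm (?h s) \<le> dist z y * (n s * W s)" by (simp add: mult_ac)
      qed simp
      finally show "dist (apply_bcontfun (Q z) t) (apply_bcontfun (Q y) t) \<le> 1/2 * dist z y" by (simp add: Q)
    qed
  qed auto
  then obtain z where z: "Q z = z" by blast
  define x where "x t = W t *\<^sub>R z t" for t
  have "x t = x0 + integral {0..t} (\<lambda>s. \<Phi> s (x s))" if "0 \<le> t" for t
  proof -
    have "z t = P z t" using Q[of z] z by simp
    then show ?thesis using W0[of t] that by (simp add: x_def P_def cl)
  qed
  moreover have "continuous_on {0..} x" unfolding x_def by (intro continuous_intros Wc) simp
  ultimately show ?thesis by blast
qed

lemma measurable_reflect:
  fixes h :: "real \<Rightarrow> 'e::euclidean_space"
  assumes "h \<in> borel_measurable (lebesgue_on {0..})"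
  shows "(\<lambda>s. if s \<le> T then h (T - s) else 0) \<in> borel_measurable (lebesgue_on {0..})"
proof -
  have 1: "(\<lambda>t. if t \<in> {0..} then h t else 0) \<in> borel_measurable lebesgue"
    using assms by (subst borel_measurable_if) auto
  have "(\<lambda>s. T + -1 * s) \<in> lebesgue \<rightarrow>\<^sub>M lebesgue"
    using lebesgue_affine_measurable[of "\<lambda>_. -1 :: real" T] by simp
  from measurable_compose[OF this 1]
  have "(\<lambda>s. if T + -1 * s \<in> {0..} then h (T + -1 * s) else 0) \<in> borel_measurable lebesgue" .
  moreover have "(\<lambda>s. if T + -1 * s \<in> {0..} then h (T + -1 * s) else 0) = (\<lambda>s. if s \<le> T then h (T - s) else 0)"
    by (auto simp: fun_eq_iff)
  ultimately show ?thesis by (simp add: measurable_restrict_space1)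
qed

text \<open>Reversal of time turns the terminal condition into an initial one; the reversed field is continued by zero
  beyond the time \<open>T\<close>.\<close>

lemma caratheodory_ode_exists_backward:
  fixes \<Phi> :: "real \<Rightarrow> 'e::euclidean_space \<Rightarrow> 'e"
  assumes \<Phi>: "caratheodory_field \<Phi>" and m: "loc_int m" "\<And>t. 0 \<le> t \<Longrightarrow> 0 \<le> m t"
    and lip: "\<And>t x y. 0 \<le> t \<Longrightarrow> norm (\<Phi> t x - \<Phi> t y) \<le> m t * norm (x - y)"
    and zero: "loc_int (\<lambda>t. \<Phi> t 0)" and T: "0 \<le> T"
  shows "\<exists>x. continuous_on {0..} x \<and> x T = 0 \<and> (\<forall>t\<in>{0..T}. x t = x 0 + integral {0..t} (\<lambda>s. \<Phi> s (x s)))"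
proof -
  have reflect: "(\<lambda>s. h (T - s)) integrable_on {0..T}" if h: "h integrable_on {0..T}" for h :: "real \<Rightarrow> 'c::euclidean_space"
  proof -
    have "((\<lambda>s. h (- 1 *\<^sub>R s + T)) has_integral (1 / (\<bar>- 1\<bar> ^ DIM(real))) *\<^sub>R integral {0..T} h) ((\<lambda>x. (1 / - 1) *\<^sub>R x + - ((1 / - 1) *\<^sub>R T)) ` cbox 0 T)"
      using h by (intro has_integral_affinity) auto
    moreover have "(\<lambda>x. (1 / - 1) *\<^sub>R x + - ((1 / - 1) *\<^sub>R T)) ` cbox 0 T = {0..T}"
      by (auto simp: image_iff intro!: bexI[of _ "T - _"])
    ultimately show ?thesis by (auto simp: integrable_on_def algebra_simps)
  qed
  have Rint: "loc_int (\<lambda>s. if s \<le> T then h (T - s) else 0)" if h: "loc_int h" for h :: "real \<Rightarrow> 'c::euclidean_space"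
    unfolding loc_int_def
  proof
    fix S :: real
    have "(\<lambda>s. norm (h (T - s))) integrable_on {0..T}"
      using reflect[OF loc_int_integrable[OF loc_int_norm[OF h] order_refl]] .
    then have *: "(\<lambda>s. if s \<in> {0..T} then norm (h (T - s)) else 0) integrable_on {0..max S T}"
      by (subst integrable_restrict_Int) (use T in \<open>auto simp: Int_absorb2 min_def\<close>)
    have "(\<lambda>s. if s \<in> {0..T} then norm (h (T - s)) else 0) integrable_on {0..S}"
      by (rule integrable_on_subinterval[OF *]) auto
    then show "(\<lambda>s. if s \<le> T then h (T - s) else 0) absolutely_integrable_on {0..S}"
      by (rule measurable_bounded_by_integrable_imp_absolutely_integrable
            [OF measurable_lebesgue_on_subset[OF measurable_reflect[OF loc_int_measurable[OF h]] order_refl], rotated]) auto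
  qed
  define \<Phi>' where "\<Phi>' s x = (if s \<le> T then - \<Phi> (T - s) x else 0)" for s x
  define m' where "m' s = (if s \<le> T then m (T - s) else 0)" for s
  have car': "caratheodory_field \<Phi>'"
    unfolding caratheodory_field_def
  proof (intro conjI allI impI)
    fix x
    have "(\<lambda>t. - \<Phi> t x) \<in> borel_measurable (lebesgue_on {0..})"
      using \<Phi> by (auto simp: caratheodory_field_def)
    then show "(\<lambda>t. \<Phi>' t x) \<in> borel_measurable (lebesgue_on {0..})"
      unfolding \<Phi>'_def by (rule measurable_reflect)
  next
    fix t :: real
    have "continuous_on UNIV (\<Phi> (T - t))" if "t \<le> T" using \<Phi> that by (auto simp: caratheodory_field_def)
    then show "continuous_on UNIV (\<Phi>' t)" unfolding \<Phi>'_def by (cases "t \<le> T") (auto intro: continuous_intros)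
  qed
  have lip': "norm (\<Phi>' t x - \<Phi>' t y) \<le> m' t * norm (x - y)" for t x y
    using lip[of "T - t" x y] by (auto simp: \<Phi>'_def m'_def norm_minus_commute)
  have m': "loc_int m'" "\<And>t. 0 \<le> t \<Longrightarrow> 0 \<le> m' t"
    unfolding m'_def using Rint[OF m(1)] m(2) by auto
  have zero': "loc_int (\<lambda>t. \<Phi>' t 0)" 
    using Rint[OF loc_int_uminus[OF zero]] by (simp add: \<Phi>'_def)
  obtain X where X: "continuous_on {0..} X" "\<forall>t\<ge>0. X t = 0 + integral {0..t} (\<lambda>s. \<Phi>' s (X s))"
    using caratheodory_ode_exists[OF car' m' lip' zero'] by blast
  define x where "x t = X (max 0 (T - t))" for t
  have XI: "loc_int (\<lambda>s. \<Phi>' s (X s))" by (rule loc_int_field_along_curve[OF car' X(1) m'(1) lip' zero'])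
  have "x t = x 0 + integral {0..t} (\<lambda>s. \<Phi> s (x s))" if t: "t \<in> {0..T}" for t
  proof -
    have "X (T - t) - X T = - integral {T - t..T} (\<lambda>s. \<Phi>' s (X s))"
      using X(2) t T integral_diff_indefinite[OF XI, of "T - t" T] by (simp add: algebra_simps)
    also have "\<dots> = integral {T - t..T} (\<lambda>s. - \<Phi>' s (X s))" by simp
    also have "\<dots> = integral {0..t} (\<lambda>s. \<Phi> s (x s))"
    proof (rule integral_unique[symmetric])
      have "((\<lambda>s. - \<Phi>' s (X s)) has_integral integral {T - t..T} (\<lambda>s. - \<Phi>' s (X s))) (cbox (T - t) T)"
        using loc_int_integrable[OF XI, of "T - t" T] t unfolding box_real by (intro integrable_integral integrable_neg) auto
      from has_integral_affinity[OF this, of "-1" T]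
      have "((\<lambda>s. - \<Phi>' (- 1 *\<^sub>R s + T) (X (- 1 *\<^sub>R s + T))) has_integral integral {T - t..T} (\<lambda>s. - \<Phi>' s (X s))) 
          ((\<lambda>x. (1 / - 1) *\<^sub>R x + - ((1 / - 1) *\<^sub>R T)) ` cbox (T - t) T)" by simp
      moreover have "(\<lambda>x. (1 / - 1) *\<^sub>R x + - ((1 / - 1) *\<^sub>R T)) ` cbox (T - t) T = {0..t}"
        by (auto simp: image_iff intro!: bexI[of _ "T - _"])
      ultimately have "((\<lambda>s. - \<Phi>' (T - s) (X (T - s))) has_integral integral {T - t..T} (\<lambda>s. - \<Phi>' s (X s))) {0..t}"
        by (simp add: algebra_simps)
      then show "((\<lambda>s. \<Phi> s (x s)) has_integral integral {T - t..T} (\<lambda>s. - \<Phi>' s (X s))) {0..t}"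
        by (rule has_integral_eq[rotated]) (use t in \<open>auto simp: \<Phi>'_def x_def\<close>)
    qed
    finally show ?thesis using t T by (simp add: x_def algebra_simps)
  qed
  moreover have "continuous_on {0..} x" unfolding x_def
    by (rule continuous_on_compose2[OF X(1)]) (auto intro!: continuous_intros)
  moreover have "x T = 0" using X(2) by (simp add: x_def)
  ultimately show ?thesis by blast
qed

section \<open>Measurable projection and measurable selection\<close>

lemma compact_pointwise:
  fixes K :: "'i \<Rightarrow> 'a::topological_space set"
  assumes "\<And>i. compact (K i)"
  shows "compact {f. \<forall>i. f i \<in> K i}"
proof -
  have "compactin (product_topology (\<lambda>i. euclidean) UNIV) (PiE UNIV K)"
    using assms by (subst compactin_PiE) auto
  then have "compact (PiE UNIV K)" by (simp add: euclidean_product_topology)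
  then show ?thesis by (simp add: PiE_UNIV_domain Pi_def)
qed

text \<open>Tychonoff's theorem for countably many factors, where the product topology is first countable.\<close>

lemma pointwise_convergent_subsequence:
  fixes x :: "nat \<Rightarrow> nat \<Rightarrow> 'a::first_countable_topology"
  assumes "\<And>i. compact (K i)" "\<And>n i. x n i \<in> K i"
  obtains r l where "strict_mono r" "\<And>i. l i \<in> K i" "\<And>i. (\<lambda>n. x (r n) i) \<longlonglongrightarrow> l i"
proof -
  have "seq_compact {f. \<forall>i. f i \<in> K i}" using compact_imp_seq_compact[OF compact_pointwise[OF assms(1)]] .
  moreover have "\<forall>n. x n \<in> {f. \<forall>i. f i \<in> K i}" using assms(2) by simp
  ultimately obtain l r where lr: "l \<in> {f. \<forall>i. f i \<in> K i}" "strict_mono r" "(x \<circ> r) \<longlonglongrightarrow> l"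
    unfolding seq_compact_def by blast
  have "(\<lambda>n. x (r n) i) \<longlonglongrightarrow> l i" for i
    using continuous_on_tendsto_compose[OF continuous_on_product_coordinates[of i] lr(3)] by (simp add: comp_def)
  then show ?thesis using that lr by blast
qed

text \<open>Analytic sets, as projections of closed sets along Baire space. In this form they are closed under countable unions and
  intersections, which leads to all Borel sets, and compactness can be argued coordinate by coordinate.\<close>

definition analytic :: "'e::topological_space set \<Rightarrow> bool" where
  "analytic A \<longleftrightarrow> (\<exists>C::('e \<times> (nat \<Rightarrow> nat)) set. closed C \<and> A = fst ` C)"

lemma analytic_closed: "closed A \<Longrightarrow> analytic A"
  unfolding analytic_def by (intro exI[of _ "A \<times> UNIV"]) (auto intro: closed_Times)

text \<open>The first entry of a sequence chooses one of the sets, the remaining entries are a witness for it.\<close>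

lemma analytic_UN:
  fixes A :: "nat \<Rightarrow> 'e::topological_space set"
  assumes "\<And>i. analytic (A i)"
  shows "analytic (\<Union>i. A i)"
proof -
  obtain C :: "nat \<Rightarrow> ('e \<times> (nat \<Rightarrow> nat)) set" where C: "\<And>i. closed (C i)" "\<And>i. A i = fst ` C i"
    using assms unfolding analytic_def by metis
  define h where "h = (\<lambda>(e::'e, \<sigma>::nat \<Rightarrow> nat). (e, \<lambda>n. \<sigma> (Suc n)))"
  have coord: "continuous_on UNIV (\<lambda>p::'e \<times> (nat \<Rightarrow> nat). snd p n)" for n
    by (rule continuous_on_compose2[OF continuous_on_product_coordinates[of n] continuous_on_snd[OF continuous_on_id]]) simp
  have hc: "continuous_on UNIV h" unfolding h_def split_def
    by (rule continuous_on_Pair[OF continuous_on_fst[OF continuous_on_id] continuous_on_coordinatewise_then_product]) (rule coord)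
  have "closed (\<Inter>i. (\<lambda>p. snd p 0) -` (- {i}) \<union> h -` C i)"
    by (intro closed_INT ballI closed_Un closed_vimage C hc coord) (auto simp: closed_def open_discrete)
  moreover have "(\<Union>i. A i) = fst ` (\<Inter>i. (\<lambda>p. snd p 0) -` (- {i}) \<union> h -` C i)"
  proof (intro equalityI subsetI)
    fix e assume "e \<in> (\<Union>i. A i)"
    then obtain i \<sigma> where "(e, \<sigma>) \<in> C i" using C(2) by auto
    then have "(e, case_nat i \<sigma>) \<in> (\<Inter>i. (\<lambda>p. snd p 0) -` (- {i}) \<union> h -` C i)" by (auto simp: h_def)
    then show "e \<in> fst ` (\<Inter>i. (\<lambda>p. snd p 0) -` (- {i}) \<union> h -` C i)" by (rule image_eqI[rotated]) simp
  next
    fix e assume "e \<in> fst ` (\<Inter>i. (\<lambda>p. snd p 0) -` (- {i}) \<union> h -` C i)"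
    then obtain \<sigma> where "(e, \<sigma>) \<in> (\<Inter>i. (\<lambda>p. snd p 0) -` (- {i}) \<union> h -` C i)"
      by (metis (no_types, lifting) imageE prod.collapse)
    then have "(e, \<sigma>) \<in> (\<lambda>p. snd p 0) -` (- {\<sigma> 0}) \<union> h -` C (\<sigma> 0)" by blast
    then show "e \<in> (\<Union>i. A i)" using C(2) by (force simp: h_def)
  qed
  ultimately show ?thesis unfolding analytic_def by blast
qed

text \<open>A single sequence carries witnesses for all the sets, interleaved by the pairing function.\<close>

lemma analytic_INT:
  fixes A :: "nat \<Rightarrow> 'e::topological_space set"
  assumes "\<And>i. analytic (A i)"
  shows "analytic (\<Inter>i. A i)"
proof -
  obtain C :: "nat \<Rightarrow> ('e \<times> (nat \<Rightarrow> nat)) set" where C: "\<And>i. closed (C i)" "\<And>i. A i = fst ` C i"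
    using assms unfolding analytic_def by metis
  define h where "h i = (\<lambda>(e::'e, \<sigma>::nat \<Rightarrow> nat). (e, \<lambda>n. \<sigma> (prod_encode (i, n))))" for i
  have coord: "continuous_on UNIV (\<lambda>p::'e \<times> (nat \<Rightarrow> nat). snd p n)" for n
    by (rule continuous_on_compose2[OF continuous_on_product_coordinates[of n] continuous_on_snd[OF continuous_on_id]]) simp
  have hc: "continuous_on UNIV (h i)" for i unfolding h_def split_def
    by (rule continuous_on_Pair[OF continuous_on_fst[OF continuous_on_id] continuous_on_coordinatewise_then_product]) (rule coord)
  have "closed (\<Inter>i. h i -` C i)"
    by (intro closed_INT ballI closed_vimage C hc)
  moreover have "(\<Inter>i. A i) = fst ` (\<Inter>i. h i -` C i)"
  proof (intro equalityI subsetI)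
    fix e assume "e \<in> (\<Inter>i. A i)"
    then have "\<forall>i. \<exists>\<sigma>. (e, \<sigma>) \<in> C i" using C(2) by force
    then obtain s where s: "\<And>i. (e, s i) \<in> C i" by metis
    define \<sigma> where "\<sigma> k = (case prod_decode k of (i, n) \<Rightarrow> s i n)" for k
    have "(e, \<sigma>) \<in> (\<Inter>i. h i -` C i)" using s by (auto simp: h_def \<sigma>_def)
    then show "e \<in> fst ` (\<Inter>i. h i -` C i)" by force
  next
    fix e assume "e \<in> fst ` (\<Inter>i. h i -` C i)"
    then obtain \<sigma> where "(e, \<sigma>) \<in> (\<Inter>i. h i -` C i)"
      by (metis (no_types, lifting) imageE prod.collapse)
    then have "h i (e, \<sigma>) \<in> C i" for i by blast
    then show "e \<in> (\<Inter>i. A i)" using C(2) by (force simp: h_def)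
  qed
  ultimately show ?thesis unfolding analytic_def by blast
qed

lemma analytic_open:
  fixes A :: "'e::euclidean_space set"
  assumes "open A"
  shows "analytic A"
proof (cases "A = {}")
  case True
  then show ?thesis by (simp add: analytic_closed)
next
  case False
  obtain D where D: "countable D" "\<And>X. X \<in> D \<Longrightarrow> \<exists>a b. X = cbox a b" "\<Union>D = A"
    using open_countable_Union_open_cbox[OF assms] by metis
  then have "D \<noteq> {}" using False by auto
  have "\<Union>(range (from_nat_into D)) = A" using D \<open>D \<noteq> {}\<close> by (simp add: range_from_nat_into)
  moreover have "analytic (from_nat_into D i)" for i
    using D(2) from_nat_into[OF \<open>D \<noteq> {}\<close>] by (metis analytic_closed closed_cbox)
  ultimately show ?thesis using analytic_UN[of "from_nat_into D"] by simp
qed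

text \<open>The complements have to be carried through the induction, since analytic sets are not closed under complements.\<close>

lemma analytic_borel:
  fixes A :: "'e::euclidean_space set"
  assumes "A \<in> sets borel"
  shows "analytic A"
proof -
  have "A \<in> sigma_sets UNIV {S. open S}" using assms by (simp add: borel_def)
  then have "analytic A \<and> analytic (- A)"
  proof induction
    case (Basic a)
    then show ?case by (auto intro: analytic_open analytic_closed)
  next
    case Empty
    then show ?case by (simp add: analytic_closed)
  next
    case (Compl a)
    then show ?case by (simp add: Compl_eq_Diff_UNIV[symmetric])
  next
    case (Union a)
    then show ?case using analytic_UN[of a] analytic_INT[of "\<lambda>i. - a i"] by auto
  qed
  then show ?thesis by simp
qed

text \<open>Choquet's capacitability argument: the outer measure is continuous along increasing unions, so the
  coordinates along Baire space can be bounded one after the other at an arbitrarily small loss. Once they are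
  all bounded, what remains is compact.\<close>

lemma projection_inner_compact:
  fixes C :: "((real \<times> 'u::euclidean_space) \<times> (nat \<Rightarrow> nat)) set"
  assumes C: "closed C" and r: "r < outer_measure_of lebesgue (fst ` fst ` C \<inter> {-N..N})"
  obtains Q where "Q \<subseteq> fst ` fst ` C \<inter> {-N..N}" "compact Q" "r \<le> emeasure lebesgue Q"
proof -
  \<comment> \<open>the norm of the finite dimensional component is counted as a zeroth coordinate\<close>
  define c where "c i p = (case i of 0 \<Rightarrow> norm (fst p) | Suc n \<Rightarrow> real (snd p n))" 
    for i and p :: "(real \<times> 'u) \<times> (nat \<Rightarrow> nat)"
  define X where "X n b = {p\<in>C. \<bar>fst (fst p)\<bar> \<le> N \<and> (\<forall>i<n. c i p \<le> real (b i))}" for n and b :: "nat \<Rightarrow> nat"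
  let ?\<mu> = "\<lambda>S. outer_measure_of lebesgue (fst ` fst ` S)"
  have "\<exists>f. \<forall>n. r < ?\<mu> (X n (f n)) \<and> (\<forall>i<n. f (Suc n) i = f n i)"
  proof (rule dependent_nat_choice)
    have "fst ` fst ` X 0 (\<lambda>_. 0) = fst ` fst ` C \<inter> {-N..N}"
      by (force simp: X_def image_iff abs_le_iff)
    then show "\<exists>b. r < ?\<mu> (X 0 b)" using r by metis
  next
    fix b n assume b: "r < ?\<mu> (X n b)"
    define Y where "Y k = fst ` fst ` X (Suc n) (b(n := k))" for k
    have "incseq Y" unfolding incseq_def Y_def by (intro allI impI image_mono) (auto simp: X_def intro: order_trans)
    moreover have "(\<Union>k. Y k) = fst ` fst ` X n b"
    proof (intro equalityI subsetI)
      fix t assume "t \<in> (\<Union>k. Y k)"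
      then obtain k p where "p \<in> X (Suc n) (b(n := k))" "t = fst (fst p)" by (auto simp: Y_def)
      moreover have "c i p \<le> real (b i)" if "i < n" for i
      proof -
        have "c i p \<le> real ((b(n := k)) i)" using \<open>p \<in> X (Suc n) (b(n := k))\<close> that by (auto simp: X_def dest!: spec[of _ i])
        then show ?thesis using that by simp
      qed
      ultimately have "p \<in> X n b" by (simp add: X_def)
      then show "t \<in> fst ` fst ` X n b" using \<open>t = fst (fst p)\<close> by blast
    next
      fix t assume "t \<in> fst ` fst ` X n b"
      then obtain p where p: "p \<in> X n b" "t = fst (fst p)" by auto
      obtain k :: nat where "c n p \<le> real k" using real_arch_simple by blast
      then have "p \<in> X (Suc n) (b(n := k))" using p by (auto simp: X_def less_Suc_eq)
      then show "t \<in> (\<Union>k. Y k)" using p by (auto simp: Y_def)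
    qed
    ultimately have "(SUP k. outer_measure_of lebesgue (Y k)) = ?\<mu> (X n b)"
      using SUP_outer_measure_of_incseq[of Y lebesgue] by auto
    then obtain k where "r < outer_measure_of lebesgue (Y k)" using b by (metis less_SUP_iff)
    then show "\<exists>b'. r < ?\<mu> (X (Suc n) b') \<and> (\<forall>i<n. b' i = b i)"
      by (intro exI[of _ "b(n := k)"]) (auto simp: Y_def)
  qed
  then obtain f where f: "\<And>n. r < ?\<mu> (X n (f n))" "\<And>n i. i < n \<Longrightarrow> f (Suc n) i = f n i" by blast
  define b where "b i = f (Suc i) i" for i
  have fb: "f n i = b i" if "i < n" for n i
    using that
  proof (induction n)
    case (Suc n)
    then show ?case using f(2)[of i n] by (cases "i = n") (auto simp: b_def)
  qed simp
  have Xb: "r < ?\<mu> (X n b)" for n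
  proof -
    have "X n (f n) = X n b" by (auto simp: X_def fb)
    then show ?thesis using f(1)[of n] by simp
  qed
  define K where "K = {p\<in>C. \<bar>fst (fst p)\<bar> \<le> N \<and> (\<forall>i. c i p \<le> real (b i))}"
  \<comment> \<open>this is used twice: \<open>K\<close> has a compact projection, and a neighbourhood of it contains the projection of some \<open>X (Suc n) b\<close>\<close>
  have lim: "\<exists>s q. strict_mono s \<and> q \<in> K \<and> (\<lambda>n. fst (fst (p (s n)))) \<longlonglongrightarrow> fst (fst q)"
    if p: "\<And>n. p (n::nat) \<in> X (Suc n) b" for p
  proof -
    \<comment> \<open>the truncation affects each coordinate for finitely many \<open>n\<close> only and leads into a compact product\<close>
    define y where "y n = (\<lambda>i. min (snd (p n) i) (b (Suc i)))" for n
    have "compact {..b (Suc i)}" for i :: nat by (simp add: finite_imp_compact)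
    then obtain r1 \<sigma> where r1: "strict_mono r1" "\<And>i. \<sigma> i \<in> {..b (Suc i)}" "\<And>i. (\<lambda>n. y (r1 n) i) \<longlonglongrightarrow> \<sigma> i"
      using pointwise_convergent_subsequence[of "\<lambda>i. {..b (Suc i)}" y] by (auto simp: y_def)
    have "norm (fst (p n)) \<le> real (b 0)" for n using p[of n] by (auto simp: X_def c_def split: nat.splits)
    then have "\<forall>n. fst (p (r1 n)) \<in> cball 0 (real (b 0))" by simp
    then obtain e r2 where r2: "strict_mono r2" "((\<lambda>n. fst (p (r1 n))) \<circ> r2) \<longlonglongrightarrow> e"
      using compact_cball unfolding compact_def by metis
    define s where "s = r1 \<circ> r2"
    have s: "strict_mono s" using r1(1) r2(1) by (simp add: s_def strict_mono_o)
    have e: "(\<lambda>n. fst (p (s n))) \<longlonglongrightarrow> e" using r2(2) by (simp add: s_def comp_def)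
    have \<sigma>: "(\<lambda>n. snd (p (s n)) i) \<longlonglongrightarrow> \<sigma> i" for i
    proof -
      have "(\<lambda>n. y (s n) i) \<longlonglongrightarrow> \<sigma> i"
        using LIMSEQ_subseq_LIMSEQ[OF r1(3) r2(1)] by (simp add: s_def comp_def)
      moreover have "y (s n) i = snd (p (s n)) i" if "n \<ge> Suc i" for n
      proof -
        have "Suc i < Suc (s n)" using that seq_suble[OF s, of n] by simp
        then have "c (Suc i) (p (s n)) \<le> real (b (Suc i))" using p[of "s n"] by (auto simp: X_def)
        then show ?thesis by (simp add: y_def c_def)
      qed
      ultimately show ?thesis
        by (elim Lim_transform_eventually) (auto simp: eventually_sequentially)
    qed
    have "(\<lambda>n. snd (p (s n))) \<longlonglongrightarrow> \<sigma>"
    proof -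
      have "limitin (product_topology (\<lambda>i. euclidean) UNIV) (\<lambda>n. snd (p (s n))) \<sigma> sequentially"
        using \<sigma> by (simp add: limitin_componentwise)
      then show ?thesis by (simp add: euclidean_product_topology)
    qed
    then have "(\<lambda>n. (fst (p (s n)), snd (p (s n)))) \<longlonglongrightarrow> (e, \<sigma>)" by (intro tendsto_Pair e)
    then have pl: "(\<lambda>n. p (s n)) \<longlonglongrightarrow> (e, \<sigma>)" by simp
    have "(e, \<sigma>) \<in> C"
      by (rule closed_sequentially[OF C _ pl]) (use p in \<open>simp add: X_def\<close>)
    moreover have "norm e \<le> real (b 0)"
      by (rule tendsto_upperbound[OF tendsto_norm[OF e]]) (use \<open>\<And>n. norm (fst (p n)) \<le> real (b 0)\<close> in auto)
    moreover have "\<bar>fst e\<bar> \<le> N"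
      by (rule tendsto_upperbound[OF tendsto_rabs[OF tendsto_fst[OF e]]]) (use p in \<open>auto simp: X_def\<close>)
    ultimately have "(e, \<sigma>) \<in> K" using r1(2) by (auto simp: K_def c_def split: nat.splits)
    moreover have "(\<lambda>n. fst (fst (p (s n)))) \<longlonglongrightarrow> fst (fst (e, \<sigma>))" using tendsto_fst[OF e] by simp
    ultimately show ?thesis using s by blast
  qed
  define Q where "Q = fst ` fst ` K"
  have KX: "K \<subseteq> X n b" for n by (auto simp: K_def X_def)
  have Q1: "Q \<subseteq> fst ` fst ` C \<inter> {-N..N}" by (force simp: Q_def K_def abs_le_iff)
  have Q2: "compact Q"
    unfolding compact_def
  proof (intro allI impI)
    fix g :: "nat \<Rightarrow> real" assume "\<forall>n. g n \<in> Q"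
    then have "\<forall>n. \<exists>p. p \<in> K \<and> g n = fst (fst p)" unfolding Q_def by blast
    then obtain p where p: "\<And>n. p n \<in> K" "\<And>n. g n = fst (fst (p n))" by metis
    from lim[of p] p(1) KX obtain s q where "strict_mono s" "q \<in> K" "(\<lambda>n. fst (fst (p (s n)))) \<longlonglongrightarrow> fst (fst q)" by blast
    then show "\<exists>l\<in>Q. \<exists>r. strict_mono r \<and> (g \<circ> r) \<longlonglongrightarrow> l"
      by (intro bexI[of _ "fst (fst q)"] exI[of _ s]) (auto simp: Q_def p comp_def)
  qed
  have "r \<le> emeasure lebesgue Q"
  proof -
    have "r \<le> emeasure lebesgue V" if V: "open V" "Q \<subseteq> V" for V
    proof -
      have "\<exists>n. fst ` fst ` X (Suc n) b \<subseteq> V"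
      proof (rule ccontr)
        assume "\<nexists>n. fst ` fst ` X (Suc n) b \<subseteq> V"
        then have "\<forall>n. \<exists>p. p \<in> X (Suc n) b \<and> fst (fst p) \<notin> V" by blast
        then obtain p where p: "\<And>n. p n \<in> X (Suc n) b" "\<And>n. fst (fst (p n)) \<notin> V" by metis
        from lim[OF p(1)] obtain s q where sq: "q \<in> K" "(\<lambda>n. fst (fst (p (s n)))) \<longlonglongrightarrow> fst (fst q)" by blast
        have "fst (fst q) \<in> V" using sq(1) V(2) by (auto simp: Q_def)
        then have "\<forall>\<^sub>F n in sequentially. fst (fst (p (s n))) \<in> V" by (rule topological_tendstoD[OF sq(2) V(1)])
        then show False using p(2) by simp
      qed
      then obtain n where "fst ` fst ` X (Suc n) b \<subseteq> V" by blast
      then have "?\<mu> (X (Suc n) b) \<le> emeasure lebesgue V"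
        using outer_measure_of_mono[of _ V lebesgue] V(1) by simp
      then show ?thesis using Xb[of "Suc n"] by simp
    qed
    moreover have "\<exists>V. open V \<and> Q \<subseteq> V \<and> emeasure lebesgue V \<le> emeasure lebesgue Q + ennreal e" if e: "e > 0" for e
    proof -
      obtain V where V: "open V" "Q \<subseteq> V" "V - Q \<in> lmeasurable" "emeasure lebesgue (V - Q) < ennreal e"
        by (rule sets_lebesgue_outer_open[OF _ e, of Q]) (use Q2 in \<open>auto simp: borel_compact\<close>)
      have "emeasure lebesgue V = emeasure lebesgue (Q \<union> (V - Q))" using V by (simp add: Un_absorb1)
      also have "\<dots> \<le> emeasure lebesgue Q + emeasure lebesgue (V - Q)"
        using V Q2 by (intro emeasure_subadditive) (auto simp: borel_compact)
      finally show ?thesis using V by (meson add_left_mono less_imp_le order_trans)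
    qed
    ultimately show ?thesis by (meson ennreal_le_epsilon order_trans)
  qed
  then show ?thesis using that Q1 Q2 by blast
qed

text \<open>On bounded parts the outer measure is exhausted by compact subsets, so that a measurable subset and a measurable
  superset differ by a null set.\<close>

theorem borel_projection_lebesgue_measurable:
  fixes A :: "(real \<times> 'u::euclidean_space) set"
  assumes "A \<in> sets borel"
  shows "fst ` A \<in> sets lebesgue"
proof -
  obtain C :: "((real \<times> 'u) \<times> (nat \<Rightarrow> nat)) set" where C: "closed C" "A = fst ` C"
    using analytic_borel[OF assms] unfolding analytic_def by blast
  have "fst ` A \<inter> {- real N..real N} \<in> sets lebesgue" for N :: nat
  proof -
    define P where "P = fst ` A \<inter> {- real N..real N}"
    define \<Q> where "\<Q> = {Q. Q \<subseteq> P \<and> compact Q}"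
    have \<Q>: "\<Q> \<noteq> {}" by (auto simp: \<Q>_def)
    have sup: "outer_measure_of lebesgue P \<le> (SUP Q\<in>\<Q>. emeasure lebesgue Q)"
    proof (rule dense_le)
      fix r assume "r < outer_measure_of lebesgue P"
      then obtain Q where "Q \<in> \<Q>" "r \<le> emeasure lebesgue Q"
        using projection_inner_compact[OF C(1), of r "real N"] unfolding \<Q>_def P_def C(2)
        by (metis (mono_tags, lifting) mem_Collect_eq)
      then show "r \<le> (SUP Q\<in>\<Q>. emeasure lebesgue Q)" by (rule SUP_upper2)
    qed
    obtain g :: "nat \<Rightarrow> ennreal" where g: "range g \<subseteq> emeasure lebesgue ` \<Q>" "(SUP Q\<in>\<Q>. emeasure lebesgue Q) = (SUP i. g i)"
      using ennreal_SUP_countable_SUP[OF \<Q>] by metis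
    have "\<forall>i. \<exists>Q\<in>\<Q>. g i = emeasure lebesgue Q" using g(1) by blast
    then obtain Q where Q: "\<And>i. Q i \<in> \<Q>" "\<And>i. g i = emeasure lebesgue (Q i)" by metis
    define D where "D = (\<Union>i. Q i)"
    have D: "D \<in> sets lebesgue" "D \<subseteq> P" using Q(1) by (auto simp: D_def \<Q>_def borel_compact)
    have "g i \<le> emeasure lebesgue D" for i
      unfolding Q(2) by (rule emeasure_mono[OF _ D(1)]) (auto simp: D_def)
    then have PD: "outer_measure_of lebesgue P \<le> emeasure lebesgue D"
    proof -
      have "(SUP i. g i) \<le> emeasure lebesgue D" by (rule SUP_least) (rule \<open>g _ \<le> emeasure lebesgue D\<close>)
      then show ?thesis using sup unfolding g(2) by (rule order_trans[rotated])
    qed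
    obtain G where G: "G \<in> sets lebesgue" "P \<subseteq> G" "outer_measure_of lebesgue P = emeasure lebesgue G"
      using outer_measure_of_attain[of P lebesgue] by auto
    have "emeasure lebesgue G \<le> emeasure lebesgue {- real N..real N}"
      unfolding G(3)[symmetric] using outer_measure_of_mono[of P "{- real N..real N}" lebesgue] by (simp add: P_def)
    then have fin: "emeasure lebesgue D \<noteq> \<infinity>"
      using emeasure_mono[of D G lebesgue] D G(1,2) by (auto simp: top_unique)
    have "emeasure lebesgue (G - D) = emeasure lebesgue G - emeasure lebesgue D"
      using D G fin by (intro emeasure_Diff) auto
    also have "\<dots> = 0" using PD G(3) fin by (simp add: diff_eq_0_iff_ennreal less_top)
    finally have "G - D \<in> null_sets lebesgue" using D G by (intro null_setsI) auto
    then have "P - D \<in> null_sets lebesgue"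
      by (rule null_sets_completion_subset[rotated]) (use G in auto)
    then have "D \<union> (P - D) \<in> sets lebesgue" using D(1) null_setsD2 sets.Un by blast
    then show ?thesis using D(2) by (simp add: P_def Un_absorb1)
  qed
  then have "(\<Union>N::nat. fst ` A \<inter> {- real N..real N}) \<in> sets lebesgue" by blast
  moreover have "(\<Union>N::nat. fst ` A \<inter> {- real N..real N}) = fst ` A"
  proof -
    have "\<exists>N::nat. t \<in> {- real N..real N}" for t :: real
      using real_arch_simple[of "\<bar>t\<bar>"] by (auto simp: abs_le_iff) (metis minus_le_iff)
    then show ?thesis by blast
  qed
  ultimately show ?thesis by simp
qed

text \<open>Kuratowski and Ryll-Nardzewski: approximate selections with values in a countable dense set are chosen by least
  index, so that each of them is measurable.\<close>

lemma measurable_selection: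
  fixes F :: "real \<Rightarrow> 'u::euclidean_space set"
  assumes F: "\<And>t. closed (F t)" "\<And>t. F t \<noteq> {}" and meas: "\<And>V. open V \<Longrightarrow> {t. F t \<inter> V \<noteq> {}} \<in> sets lebesgue"
  obtains s where "s \<in> borel_measurable lebesgue" "\<And>t. s t \<in> F t"
proof -
  obtain D :: "'u set" where D: "countable D" "\<And>X. open X \<Longrightarrow> X \<noteq> {} \<Longrightarrow> \<exists>d\<in>D. d \<in> X"
    by (erule countable_dense_setE)
  then have "D \<noteq> {}" by blast
  define q where "q = from_nat_into D"
  have q: "\<exists>i. q i \<in> ball x e" if "e > 0" for x e
    using D(2)[of "ball x e"] D(1) that unfolding q_def by (metis \<open>D \<noteq> {}\<close> ball_eq_empty from_nat_into_surj not_le open_ball)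
  \<comment> \<open>within \<open>(1/2)^n\<close> of a value of \<open>F\<close>, and near the previous point, so that the points converge geometrically\<close>
  define V where "V n j i = (if n = 0 then ball (q i) 1 else ball (q i) ((1/2)^n) \<inter> ball (q j) ((1/2)^(n-1)))" for n j i
  define I where "I = rec_nat (\<lambda>t. LEAST i. F t \<inter> V 0 0 i \<noteq> {}) (\<lambda>n In t. LEAST i. F t \<inter> V (Suc n) (In t) i \<noteq> {})"
  have I0: "I 0 t = (LEAST i. F t \<inter> V 0 0 i \<noteq> {})" and
    IS: "I (Suc n) t = (LEAST i. F t \<inter> V (Suc n) (I n t) i \<noteq> {})" for n t by (simp_all add: I_def)
  have oV: "open (V n j i)" for n j i by (simp add: V_def open_Int)
  have P: "(\<lambda>t. F t \<inter> V n j i \<noteq> {}) \<in> measurable lebesgue (count_space UNIV)" for n j i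
    using meas[OF oV] by (simp add: pred_def)
  have Imeas: "I n \<in> measurable lebesgue (count_space UNIV)" for n
  proof (induction n)
    case 0
    have "(\<lambda>t. LEAST i. F t \<inter> V 0 0 i \<noteq> {}) \<in> measurable lebesgue (count_space UNIV)"
      by (rule measurable_Least[OF P])
    then show ?case by (simp add: I0[abs_def])
  next
    case (Suc n)
    have "(\<lambda>t. LEAST i. F t \<inter> V (Suc n) (I n t) i \<noteq> {}) \<in> measurable lebesgue (count_space UNIV)"
      by (rule measurable_compose_countable'[OF measurable_Least[OF P] Suc]) auto
    then show ?case by (simp add: IS[abs_def])
  qed
  have near: "F t \<inter> ball (q (I n t)) ((1/2)^n) \<noteq> {} \<and> (n > 0 \<longrightarrow> dist (q (I n t)) (q (I (n-1) t)) < 2 * (1/2)^(n-1))" for n t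
  proof (induction n)
    case 0
    obtain x where x: "x \<in> F t" using F(2) by blast
    obtain i where "q i \<in> ball x 1" using q[of 1 x] by auto
    then have "F t \<inter> V 0 0 i \<noteq> {}" using x by (auto simp: V_def dist_commute)
    then have "F t \<inter> V 0 0 (I 0 t) \<noteq> {}" unfolding I0 by (rule LeastI)
    then show ?case by (simp add: V_def)
  next
    case (Suc n)
    then obtain x where x: "x \<in> F t" "x \<in> ball (q (I n t)) ((1/2)^n)" by blast
    obtain i where "q i \<in> ball x ((1/2)^Suc n)" using q[of "(1/2)^Suc n" x] by auto
    then have "F t \<inter> V (Suc n) (I n t) i \<noteq> {}" using x by (auto simp: V_def dist_commute)
    then have *: "F t \<inter> V (Suc n) (I n t) (I (Suc n) t) \<noteq> {}" unfolding IS by (rule LeastI)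
    then obtain y where y: "y \<in> ball (q (I (Suc n) t)) ((1/2)^Suc n)" "y \<in> ball (q (I n t)) ((1/2)^n)"
      by (auto simp: V_def)
    have "dist (q (I (Suc n) t)) (q (I n t)) \<le> dist (q (I (Suc n) t)) y + dist (q (I n t)) y" by (rule dist_triangle2)
    also have "\<dots> < (1/2)^Suc n + (1/2)^n" using y by auto
    also have "\<dots> \<le> 2 * (1/2)^n" by simp
    finally show ?case using * by (auto simp: V_def)
  qed
  define s where "s t = lim (\<lambda>n. q (I n t))" for t
  have conv: "(\<lambda>n. q (I n t)) \<longlonglongrightarrow> s t" for t
  proof -
    have "Cauchy (\<lambda>n. q (I n t))"
    proof -
      have "summable (\<lambda>n. 2 * (1/2::real)^n)" by (intro summable_mult summable_geometric) simp
      moreover have "norm (q (I (Suc n) t) - q (I n t)) \<le> 2 * (1/2)^n" for n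
        using near[of t "Suc n"] by (simp add: dist_norm less_imp_le)
      ultimately have "summable (\<lambda>n. q (I (Suc n) t) - q (I n t))" by (rule summable_comparison_test'[where N=0])
      from summable_LIMSEQ[OF this] 
      have "(\<lambda>n. q (I n t) - q (I 0 t)) \<longlonglongrightarrow> (\<Sum>n. q (I (Suc n) t) - q (I n t))"
        unfolding sum_lessThan_telescope[of "\<lambda>i. q (I i t)"] .
      from tendsto_add[OF this tendsto_const[of "q (I 0 t)"]]
      have "convergent (\<lambda>n. q (I n t))" by (auto simp: convergent_def)
      then show ?thesis by (rule convergent_Cauchy)
    qed
    then show ?thesis unfolding s_def by (simp add: Cauchy_convergent_iff convergent_LIMSEQ_iff)
  qed
  have "s \<in> borel_measurable lebesgue"
  proof (rule borel_measurable_LIMSEQ_metric[where f="\<lambda>n t. q (I n t)"])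
    show "(\<lambda>t. q (I n t)) \<in> borel_measurable lebesgue" for n
      by (rule measurable_compose[OF Imeas]) simp
  qed (rule conv)
  moreover have "s t \<in> F t" for t
  proof -
    have "\<forall>n. \<exists>x. x \<in> F t \<and> dist x (q (I n t)) < (1/2)^n" 
    proof
      fix n
      obtain x where "x \<in> F t" "x \<in> ball (q (I n t)) ((1/2)^n)" using near[of t n] by blast
      then show "\<exists>x. x \<in> F t \<and> dist x (q (I n t)) < (1/2)^n" by (auto simp: dist_commute)
    qed
    then obtain x where x: "\<And>n. x n \<in> F t" "\<And>n. dist (x n) (q (I n t)) < (1/2)^n" by metis
    have "(\<lambda>n. dist (x n) (q (I n t))) \<longlonglongrightarrow> 0"
    proof (rule tendsto_sandwich[OF _ _ tendsto_const])
      show "(\<lambda>n. (1/2::real)^n) \<longlonglongrightarrow> 0" by (rule LIMSEQ_power_zero) simp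
    qed (use x(2) in \<open>auto simp: less_imp_le\<close>)
    then have "(\<lambda>n. x n - q (I n t)) \<longlonglongrightarrow> 0" unfolding dist_norm by (rule tendsto_norm_zero_cancel)
    then have "x \<longlonglongrightarrow> s t" by (rule Lim_transform[OF conv[of t]])
    then show ?thesis using F(1) x(1) by (metis closed_sequentially)
  qed
  ultimately show ?thesis by (rule that)
qed

text \<open>The preimages of a countable basis are Borel sets up to null sets, and outside the union \<open>N\<close> of these the function
  is Borel measurable. On \<open>N\<close> the values may be replaced by those of any given Borel function, so that admissible
  controls can be kept admissible.\<close>

lemma borel_modification:
  fixes s :: "real \<Rightarrow> 'u::second_countable_topology"
  assumes s: "s \<in> borel_measurable lebesgue"
  obtains N where "N \<in> null_sets lborel"
    "\<And>c. c \<in> borel_measurable (restrict_space borel {0..}) \<Longrightarrow>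
        (\<lambda>t. if t \<in> N then c t else s t) \<in> borel_measurable (restrict_space borel {0..})"
proof -
  obtain B :: "'u set set" where B: "countable B" "topological_basis B" using ex_countable_basis by blast
  have "\<exists>A N. A \<in> sets borel \<and> N \<in> null_sets lborel \<and> s -` b - N = A - N" if "b \<in> B" for b
  proof -
    have "s -` b \<in> sets lebesgue" using measurable_sets[OF s, of b] topological_basis_open[OF B(2) that] by simp
    then obtain S N N' where "s -` b = S \<union> N" "N \<subseteq> N'" "N' \<in> null_sets lborel" "S \<in> sets lborel"
      by (auto elim: sets_completionE)
    then show ?thesis by (intro exI[of _ S] exI[of _ N']) auto
  qed
  then obtain A N where AN: "\<And>b. b \<in> B \<Longrightarrow> A b \<in> sets borel" "\<And>b. b \<in> B \<Longrightarrow> N b \<in> null_sets lborel"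
    "\<And>b. b \<in> B \<Longrightarrow> s -` b - N b = A b - N b" by metis
  define M where "M = (\<Union>b\<in>B. N b)"
  have M: "M \<in> null_sets lborel" unfolding M_def using AN(2) B(1) by (intro null_sets_UN') auto
  have sM: "s \<in> borel_measurable (restrict_space borel (- M))"
  proof (rule borel_measurableI)
    fix W :: "'u set" assume "open W"
    then obtain B' where B': "B' \<subseteq> B" "\<Union>B' = W" using B(2) by (auto simp: topological_basis_def)
    have "s -` W \<inter> (- M) = (\<Union>b\<in>B'. A b) \<inter> (- M)"
    proof -
      have "s -` b \<inter> - M = A b \<inter> - M" if "b \<in> B'" for b
        using AN(3)[of b] that B'(1) unfolding M_def by blast
      then show ?thesis using B'(2) by blast
    qed
    moreover have "(\<Union>b\<in>B'. A b) \<in> sets borel"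
      using AN(1) B' B(1) by (intro sets.countable_UN') (auto intro: countable_subset)
    ultimately show "s -` W \<inter> space (restrict_space borel (- M)) \<in> sets (restrict_space borel (- M))"
      by (auto simp: sets_restrict_space space_restrict_space)
  qed
  show ?thesis
  proof (rule that[OF M])
    fix c :: "real \<Rightarrow> 'u" assume c: "c \<in> borel_measurable (restrict_space borel {0..})"
    have Mb: "M \<in> sets borel" using M by auto
    show "(\<lambda>t. if t \<in> M then c t else s t) \<in> borel_measurable (restrict_space borel {0..})"
    proof (subst measurable_If_restrict_space_iff)
      show "{x \<in> space (restrict_space borel {0..}). x \<in> M} \<in> sets (restrict_space borel {0..})"
        using Mb by (auto simp: sets_restrict_space space_restrict_space)
      have "restrict_space (restrict_space borel {0..}) {x. x \<notin> M} = restrict_space borel ({0..} \<inter> - M)"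
        by (subst restrict_restrict_space) (use Mb in \<open>auto simp: Compl_eq\<close>)
      moreover have "s \<in> borel_measurable (restrict_space borel ({0..} \<inter> - M))"
        by (rule measurable_restrict_mono[OF sM]) auto
      ultimately show "c \<in> borel_measurable (restrict_space (restrict_space borel {0..}) {x. x \<in> M}) \<and>
          s \<in> borel_measurable (restrict_space (restrict_space borel {0..}) {x. x \<notin> M})"
        using c by (auto intro: measurable_restrict_space1)
    qed
  qed
qed

lemma selectors_measurable_lebesgue:
  fixes u :: "real \<Rightarrow> 'u::topological_space"
  assumes "u \<in> borel_measurable (restrict_space borel {0..})"
  shows "u \<in> borel_measurable (lebesgue_on {0..})"
proof -
  have "(\<lambda>t. t) \<in> lebesgue_on {0::real..} \<rightarrow>\<^sub>M restrict_space borel {0..}"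
    by (rule measurable_restrict_space3) (auto simp: measurable_completion)
  from measurable_compose[OF this assms] show ?thesis .
qed

text \<open>For each set \<open>b k\<close> of a countable basis, a value near it is selected whenever \<open>U t\<close> meets it. The set of these times
  is a projection of a Borel set, which is what makes the selection measurable. Only almost every time is covered,
  because the selections are first measurable in the sense of Lebesgue and are then altered on a null set.\<close>

lemma dense_selectors_exist:
  fixes U :: "real \<Rightarrow> 'u::euclidean_space set"
  assumes graph: "graph U \<in> sets borel" and cl: "\<And>t. 0 \<le> t \<Longrightarrow> closed (U t)" and u0: "u0 \<in> selectors U"
  obtains v :: "nat \<Rightarrow> real \<Rightarrow> 'u" where "\<And>k. v k \<in> selectors U"
    "AE t in lebesgue. 0 \<le> t \<longrightarrow> U t \<subseteq> closure (range (\<lambda>k. v k t))"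
proof -
  obtain B :: "'u set set" where B: "countable B" "topological_basis B" using ex_countable_basis by blast
  have "B \<noteq> {}" using B(2) by (auto simp: topological_basis_def)
  define b where "b = from_nat_into B"
  have bo: "open (b k)" for k unfolding b_def using from_nat_into[OF \<open>B \<noteq> {}\<close>] topological_basis_open[OF B(2)] by blast
  have u0m: "u0 \<in> borel_measurable (restrict_space borel {0..})" "\<And>t. 0 \<le> t \<Longrightarrow> u0 t \<in> U t"
    using u0 by (auto simp: selectors_def)
  have hit: "{t. 0 \<le> t \<and> U t \<inter> V \<noteq> {}} \<in> sets lebesgue" if "open V" for V
  proof -
    have "graph U \<inter> (UNIV \<times> V) \<in> sets borel" 
      by (rule sets.Int[OF graph borel_open[OF open_Times[OF open_UNIV that]]])
    from borel_projection_lebesgue_measurable[OF this] 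
    have "fst ` (graph U \<inter> (UNIV \<times> V)) \<in> sets lebesgue" .
    moreover have "fst ` (graph U \<inter> (UNIV \<times> V)) = {t. 0 \<le> t \<and> U t \<inter> V \<noteq> {}}"
      by (force simp: graph_def image_iff)
    ultimately show ?thesis by simp
  qed
  define H where "H k = {t. 0 \<le> t \<and> U t \<inter> b k \<noteq> {}}" for k
  \<comment> \<open>\<open>u0\<close> serves where \<open>U t\<close> misses \<open>b k\<close>, and the value at negative times is a dummy\<close>
  define F where "F k t = (if t \<in> H k then closure (U t \<inter> b k) else if 0 \<le> t then {u0 t} else {0})" for k t
  have "\<exists>s. s \<in> borel_measurable lebesgue \<and> (\<forall>t. s t \<in> F k t)" for k
  proof -
    have "{t. F k t \<inter> V \<noteq> {}} \<in> sets lebesgue" if V: "open V" for V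
    proof -
      have "(\<lambda>t. if t \<in> {0..} then u0 t else 0) \<in> borel_measurable lebesgue"
        using selectors_measurable_lebesgue[OF u0m(1)] by (subst borel_measurable_if) auto
      from measurable_sets[OF this borel_open[OF V]]
      have 1: "{t. (if t \<in> {0..} then u0 t else 0) \<in> V} \<in> sets lebesgue"
        by (simp only: vimage_def space_completion space_lborel space_borel Int_UNIV_right)
      have 2: "{t. 0 \<le> t \<and> U t \<inter> (b k \<inter> V) \<noteq> {}} \<in> sets lebesgue" using hit[of "b k \<inter> V"] V bo by auto
      have 3: "H k \<in> sets lebesgue" unfolding H_def using hit[OF bo] by simp
      have "{t. F k t \<inter> V \<noteq> {}} = {t. 0 \<le> t \<and> U t \<inter> (b k \<inter> V) \<noteq> {}} \<union> ({t. (if t \<in> {0..} then u0 t else 0) \<in> V} - H k)"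
      proof -
        have "closure (U t \<inter> b k) \<inter> V \<noteq> {} \<longleftrightarrow> U t \<inter> (b k \<inter> V) \<noteq> {}" for t
          using open_Int_closure_eq_empty[OF V, of "U t \<inter> b k"] by (simp add: Int_commute Int_left_commute)
        then have "F k t \<inter> V \<noteq> {} \<longleftrightarrow>
            t \<in> {t. 0 \<le> t \<and> U t \<inter> (b k \<inter> V) \<noteq> {}} \<union> ({t. (if t \<in> {0..} then u0 t else 0) \<in> V} - H k)" for t
          by (cases "t \<in> H k"; cases "0 \<le> t") (simp_all add: F_def, auto simp: H_def)
        then show ?thesis by blast
      qed
      then show ?thesis using 1 2 3 by auto
    qed
    moreover have "closed (F k t)" "F k t \<noteq> {}" for t by (auto simp: F_def H_def)
    ultimately show ?thesis using measurable_selection[of "F k"] by metis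
  qed
  then obtain s where s: "\<And>k. s k \<in> borel_measurable lebesgue" "\<And>k t. s k t \<in> F k t" by metis
  have sU: "s k t \<in> U t" if "0 \<le> t" for k t
    using s(2)[of k t] that cl[OF that] u0m(2)[OF that] closure_minimal[of "U t \<inter> b k" "U t"]
    by (auto simp: F_def split: if_splits)
  have "\<exists>N. N \<in> null_sets lborel \<and> (\<lambda>t. if t \<in> N then u0 t else s k t) \<in> borel_measurable (restrict_space borel {0..})" for k
    using borel_modification[OF s(1)[of k]] u0m(1) by metis
  then obtain N where N: "\<And>k. N k \<in> null_sets lborel"
    "\<And>k. (\<lambda>t. if t \<in> N k then u0 t else s k t) \<in> borel_measurable (restrict_space borel {0..})" by metis
  define v where "v k t = (if t \<in> N k then u0 t else s k t)" for k t
  have "v k \<in> selectors U" for k using N(2)[of k] sU u0m(2) by (simp add: selectors_def v_def[abs_def])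
  moreover have "AE t in lebesgue. 0 \<le> t \<longrightarrow> U t \<subseteq> closure (range (\<lambda>k. v k t))"
  proof -
    have "AE t in lebesgue. \<forall>k. t \<notin> N k"
      unfolding AE_all_countable using N(1) by (intro allI AE_not_in) (auto intro: null_sets_completionI)
    then show ?thesis
    proof eventually_elim
      case (elim t)
      show ?case
      proof (intro impI subsetI)
        fix x assume t: "0 \<le> t" and x: "x \<in> U t"
        show "x \<in> closure (range (\<lambda>k. v k t))"
          unfolding closure_approachable
        proof (intro allI impI)
          fix e :: real assume "0 < e"
          then obtain W where W: "W \<in> B" "x \<in> W" "W \<subseteq> ball x (e/2)"
            using B(2) topological_basisE[of B "ball x (e/2)" x] by (metis centre_in_ball half_gt_zero open_ball)
          obtain k where k: "b k = W" unfolding b_def using from_nat_into_surj[OF B(1) W(1)] by metis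
          have "t \<in> H k" using x t W k by (auto simp: H_def)
          then have "s k t \<in> closure (U t \<inter> W)" using s(2)[of k t] k by (simp add: F_def)
          moreover have "closure (U t \<inter> W) \<subseteq> cball x (e/2)" using W(3) by (intro closure_minimal) auto
          ultimately have "dist (v k t) x < e" using elim \<open>0 < e\<close> by (auto simp: v_def dist_commute)
          then show "\<exists>y\<in>range (\<lambda>k. v k t). dist y x < e" by blast
        qed
      qed
    qed
  qed
  ultimately show ?thesis using that by blast
qed

section \<open>Mollification\<close>

text \<open>A kernel \<open>k\<close> supported in the ball of radius \<open>e\<close>, with gradient \<open>q\<close>. Differentiability is expressed by
  a Taylor estimate, which can be integrated against any bounded function.\<close>

definition mollifier :: "real \<Rightarrow> ('x::euclidean_space \<Rightarrow> real) \<Rightarrow> ('x \<Rightarrow> 'x) \<Rightarrow> bool" where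
  "mollifier e k q \<longleftrightarrow> (\<forall>z. 0 \<le> k z) \<and> (\<forall>z. e \<le> norm z \<longrightarrow> k z = 0 \<and> q z = 0) \<and>
     continuous_on UNIV k \<and> continuous_on UNIV q \<and> (\<integral>z. k z \<partial>lborel) = 1 \<and>
     (\<forall>\<rho>. \<exists>C\<ge>0. \<forall>a w. norm a \<le> \<rho> \<longrightarrow> norm w \<le> \<rho> \<longrightarrow> \<bar>k (a + w) - k a - q a \<bullet> w\<bar> \<le> C * (norm w)\<^sup>2)"

lemma integrable_compact_support:
  fixes \<phi> :: "'x::euclidean_space \<Rightarrow> 'b::euclidean_space"
  assumes "continuous_on UNIV \<phi>" "\<And>z. e \<le> norm z \<Longrightarrow> \<phi> z = 0"
  shows "integrable lborel \<phi>"
proof -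
  have "integrable lborel (\<lambda>z. indicator (cball 0 e) z *\<^sub>R \<phi> z)"
    by (rule borel_integrable_compact) (use assms(1) in \<open>auto intro: continuous_on_subset\<close>)
  moreover have "(\<lambda>z. indicator (cball 0 e) z *\<^sub>R \<phi> z) = \<phi>"
    using assms(2) by (fastforce simp: fun_eq_iff indicator_def)
  ultimately show ?thesis by simp
qed

text \<open>A multiple of \<open>(max 0 (1 - \<parallel>z / e\<parallel>\<^sup>2))\<^sup>2\<close>, whose gradient is Lipschitz continuous.\<close>

lemma mollifier_exists:
  assumes e: "e > 0"
  obtains k :: "'x::euclidean_space \<Rightarrow> real" and q where "mollifier e k q"
proof -
  define b where "b z = (max 0 (1 - z \<bullet> z))\<^sup>2" for z :: 'x
  define d where "d z = (- 4 * max 0 (1 - z \<bullet> z)) *\<^sub>R z" for z :: 'x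
  have bc: "continuous_on UNIV b" unfolding b_def by (intro continuous_intros)
  have dc: "continuous_on UNIV d" unfolding d_def by (intro continuous_intros)
  have supp: "b z = 0" "d z = 0" if "1 \<le> norm z" for z
    using that power_mono[of 1 "norm z" 2] by (simp_all add: b_def d_def power2_norm_eq_inner[symmetric])
  have second: "\<bar>b (a + w) - b a - d a \<bullet> w\<bar> \<le> (9 * \<rho>\<^sup>2 + 2) * (norm w)\<^sup>2" if "norm a \<le> \<rho>" "norm w \<le> \<rho>" for a w \<rho>
  proof -
    define s where "s = a \<bullet> a"
    define t where "t = 2 * (a \<bullet> w) + w \<bullet> w"
    have "(a + w) \<bullet> (a + w) = s + t" by (simp add: s_def t_def inner_add inner_commute)
    then have eq: "b (a + w) - b a - d a \<bullet> w = ((max 0 (1 - (s + t)))\<^sup>2 - (max 0 (1 - s))\<^sup>2 + 2 * max 0 (1 - s) * t) - 2 * max 0 (1 - s) * (w \<bullet> w)"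
      by (simp add: b_def d_def s_def t_def algebra_simps)
    \<comment> \<open>the square of the positive part of \<open>r\<close> has derivative \<open>2 * max 0 r\<close>, with an error of at most the squared increment\<close>
    have 1: "\<bar>(max 0 (1 - (s + t)))\<^sup>2 - (max 0 (1 - s))\<^sup>2 + 2 * max 0 (1 - s) * t\<bar> \<le> t\<^sup>2"
    proof (cases "1 - s \<ge> 0")
      case True
      show ?thesis
      proof (cases "1 - (s + t) \<ge> 0")
        case True
        then show ?thesis using \<open>1 - s \<ge> 0\<close> by (simp add: max_def power2_eq_square algebra_simps)
      next
        case False
        then have "0 \<le> (1 - s)" "1 - s \<le> t" using \<open>1 - s \<ge> 0\<close> by auto
        then have "0 \<le> (1 - s) * (2 * t - (1 - s))" "(t - (1 - s))\<^sup>2 \<ge> 0" by auto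
        then show ?thesis using False \<open>1 - s \<ge> 0\<close> by (simp add: max_def power2_eq_square algebra_simps)
      qed
    next
      case False
      then have s: "max 0 (1 - s) = 0" by simp
      have "(max 0 (1 - (s + t)))\<^sup>2 \<le> \<bar>t\<bar>\<^sup>2" by (rule power_mono) (use False in auto)
      then show ?thesis unfolding s by simp
    qed
    have "w \<bullet> w = norm w * norm w" by (simp add: power2_norm_eq_inner[symmetric] power2_eq_square)
    moreover have "\<bar>t\<bar> \<le> 2 * \<bar>a \<bullet> w\<bar> + w \<bullet> w" unfolding t_def using inner_ge_zero[of w] by arith
    ultimately have "\<bar>t\<bar> \<le> 2 * (norm a * norm w) + norm w * norm w"
      using Cauchy_Schwarz_ineq2[of a w] by linarith
    also have "\<dots> \<le> 2 * (\<rho> * norm w) + \<rho> * norm w"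
      using that by (intro add_mono mult_left_mono mult_right_mono) auto
    finally have "\<bar>t\<bar> \<le> 3 * \<rho> * norm w" by simp
    then have "\<bar>t\<bar>\<^sup>2 \<le> (3 * \<rho> * norm w)\<^sup>2" by (rule power_mono) simp
    then have 2: "t\<^sup>2 \<le> 9 * \<rho>\<^sup>2 * (norm w)\<^sup>2" by (simp add: power_mult_distrib)
    have 3: "\<bar>2 * max 0 (1 - s) * (w \<bullet> w)\<bar> \<le> 2 * (norm w)\<^sup>2"
      unfolding power2_norm_eq_inner abs_mult by (intro mult_mono) (auto simp: s_def)
    have "\<bar>b (a + w) - b a - d a \<bullet> w\<bar> \<le> 9 * \<rho>\<^sup>2 * (norm w)\<^sup>2 + 2 * (norm w)\<^sup>2"
      unfolding eq by (rule order_trans[OF abs_triangle_ineq4 add_mono[OF order_trans[OF 1 2] 3]])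
    then show ?thesis by (simp add: algebra_simps)
  qed
  \<comment> \<open>the normalising constant; it is positive because the bump is at least 1/4 on the ball of radius \<open>e / 2\<close>\<close>
  define c where "c = (\<integral>z. b (z /\<^sub>R e) \<partial>lborel)"
  have bsc: "continuous_on UNIV (\<lambda>z. b (z /\<^sub>R e))" by (rule continuous_on_compose2[OF bc]) (auto intro!: continuous_intros)
  have dsc: "continuous_on UNIV (\<lambda>z. d (z /\<^sub>R e))" by (rule continuous_on_compose2[OF dc]) (auto intro!: continuous_intros)
  have far: "1 \<le> norm (z /\<^sub>R e)" if "e \<le> norm z" for z :: 'x using that e by (simp add: field_simps)
  have bint: "integrable lborel (\<lambda>z. b (z /\<^sub>R e))"
    by (rule integrable_compact_support[OF bsc, of e]) (use supp far in auto)
  have c: "c > 0"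
  proof -
    have ball: "integrable lborel (\<lambda>z. 1/4 * indicator (ball (0::'x) (e/2)) z :: real)"
      by (intro integrable_mult_right integrable_real_indicator) (use emeasure_bounded_finite[OF bounded_ball[of "0::'x" "e/2"]] in auto)
    have "0 < 1/4 * measure lborel (ball (0::'x) (e/2))" using content_ball_pos[of "e/2" "0::'x"] e by simp
    also have "\<dots> = (\<integral>z. 1/4 * indicator (ball (0::'x) (e/2)) z \<partial>lborel)" by simp
    also have "\<dots> \<le> c" unfolding c_def
    proof (rule integral_mono[OF ball bint])
      fix z :: 'x
      show "1/4 * indicator (ball 0 (e/2)) z \<le> b (z /\<^sub>R e)"
      proof (cases "z \<in> ball 0 (e/2)")
        case True
        then have "norm (z /\<^sub>R e) \<le> 1/2" using e by (simp add: field_simps)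
        then have "(norm (z /\<^sub>R e))\<^sup>2 \<le> (1/2)\<^sup>2" by (rule power_mono) simp
        then have "(z /\<^sub>R e) \<bullet> (z /\<^sub>R e) \<le> 1/4" unfolding power2_norm_eq_inner by (simp add: power2_eq_square)
        moreover have "1/2 \<le> max 0 (1 - c)" if "c \<le> 1/4" for c :: real using that by simp
        ultimately have "1/2 \<le> max 0 (1 - (z /\<^sub>R e) \<bullet> (z /\<^sub>R e))" by blast
        then have "(1/2)\<^sup>2 \<le> b (z /\<^sub>R e)" unfolding b_def by (rule power_mono) simp
        then show ?thesis using True by (simp add: power2_eq_square)
      qed (simp add: b_def)
    qed
    finally show ?thesis .
  qed
  define k where "k z = b (z /\<^sub>R e) / c" for z
  define q where "q z = d (z /\<^sub>R e) /\<^sub>R (e * c)" for z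
  have "mollifier e k q" unfolding mollifier_def
  proof (intro conjI allI impI)
    show "0 \<le> k z" for z using c by (simp add: k_def b_def)
    show "k z = 0" "q z = 0" if "e \<le> norm z" for z using supp[OF far[OF that]] by (simp_all add: k_def q_def)
    show "continuous_on UNIV k" unfolding k_def using c by (intro continuous_intros bsc) auto
    show "continuous_on UNIV q" unfolding q_def by (intro continuous_intros dsc)
    show "(\<integral>z. k z \<partial>lborel) = 1" unfolding k_def using c by (simp add: c_def[symmetric])
    fix \<rho> :: real
    define C where "C = (9 * (\<rho> / e)\<^sup>2 + 2) / (e\<^sup>2 * c)"
    have "\<bar>k (a + w) - k a - q a \<bullet> w\<bar> \<le> C * (norm w)\<^sup>2" if aw: "norm a \<le> \<rho>" "norm w \<le> \<rho>" for a w
    proof -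
      have "k (a + w) - k a - q a \<bullet> w = (b (a /\<^sub>R e + w /\<^sub>R e) - b (a /\<^sub>R e) - d (a /\<^sub>R e) \<bullet> (w /\<^sub>R e)) / c"
        using e c by (simp add: k_def q_def scaleR_add_right field_simps)
      also have "\<bar>\<dots>\<bar> = \<bar>b (a /\<^sub>R e + w /\<^sub>R e) - b (a /\<^sub>R e) - d (a /\<^sub>R e) \<bullet> (w /\<^sub>R e)\<bar> / c" using c by simp
      also have "\<dots> \<le> ((9 * (\<rho> / e)\<^sup>2 + 2) * (norm (w /\<^sub>R e))\<^sup>2) / c"
        by (intro divide_right_mono second) (use aw e c in \<open>auto simp: field_simps\<close>)
      also have "\<dots> = C * (norm w)\<^sup>2" using e c by (simp add: C_def field_simps power2_eq_square)
      finally show ?thesis .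
    qed
    moreover have "C \<ge> 0" using e c by (simp add: C_def)
    ultimately show "\<exists>C\<ge>0. \<forall>a w. norm a \<le> \<rho> \<longrightarrow> norm w \<le> \<rho> \<longrightarrow> \<bar>k (a + w) - k a - q a \<bullet> w\<bar> \<le> C * (norm w)\<^sup>2" by blast
  qed
  then show ?thesis by (rule that)
qed

definition smooth :: "('x::euclidean_space \<Rightarrow> real) \<Rightarrow> ('x \<Rightarrow> 'b::euclidean_space) \<Rightarrow> 'x \<Rightarrow> 'b" where
  "smooth k h x = (\<integral>z. k z *\<^sub>R h (x + z) \<partial>lborel)"

text \<open>The gradient of \<open>smooth k h\<close>: in \<open>\<integral> k (z - x) * h z\<close> the derivative falls on the kernel, which accounts for the sign.\<close>

definition smooth_grad :: "('x::euclidean_space \<Rightarrow> 'x) \<Rightarrow> ('x \<Rightarrow> real) \<Rightarrow> 'x \<Rightarrow> 'x" where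
  "smooth_grad q h x = - (\<integral>z. h (x + z) *\<^sub>R q z \<partial>lborel)"

context
  fixes e :: real and k :: "'x::euclidean_space \<Rightarrow> real" and q
  assumes kq: "mollifier e k q"
begin

lemma kernel_nonneg: "0 \<le> k z" and kernel_support: "e \<le> norm z \<Longrightarrow> k z = 0" "e \<le> norm z \<Longrightarrow> q z = 0"
  and kernel_continuous: "continuous_on UNIV k" "continuous_on UNIV q" and kernel_integral: "(\<integral>z. k z \<partial>lborel) = 1"
  using kq by (auto simp: mollifier_def)

lemma kernel_integrable: "integrable lborel k"
  by (rule integrable_compact_support[OF kernel_continuous(1) kernel_support(1)])

lemma continuous_shift: "continuous_on UNIV (h :: 'x \<Rightarrow> 'b::topological_space) \<Longrightarrow> continuous_on UNIV (\<lambda>z. h (x + z))"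
  by (rule continuous_on_compose2[of UNIV h]) (auto intro!: continuous_intros)

lemma smooth_integrable:
  fixes h :: "'x \<Rightarrow> 'b::euclidean_space"
  assumes "continuous_on UNIV h"
  shows "integrable lborel (\<lambda>z. k z *\<^sub>R h (x + z))"
  by (rule integrable_compact_support[where e=e])
     (auto intro!: continuous_intros kernel_continuous continuous_shift assms simp: kernel_support)

lemma smooth_grad_integrable:
  assumes "continuous_on UNIV h"
  shows "integrable lborel (\<lambda>z. h (x + z) *\<^sub>R q z)"
  by (rule integrable_compact_support[where e=e])
     (auto intro!: continuous_intros kernel_continuous continuous_shift assms simp: kernel_support)

lemma smooth_const: "smooth k (\<lambda>_. c) x = c"
  using kernel_integrable by (simp add: smooth_def kernel_integral)

lemma smooth_le:
  assumes h: "continuous_on UNIV h1" "continuous_on UNIV h2"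
    and le: "\<And>z. norm z \<le> e \<Longrightarrow> h1 (x + z) \<le> h2 (y + z) + (d::real)"
  shows "smooth k h1 x \<le> smooth k h2 y + d"
proof -
  have "smooth k h1 x \<le> (\<integral>z. k z *\<^sub>R h2 (y + z) + k z *\<^sub>R d \<partial>lborel)"
    unfolding smooth_def
  proof (rule integral_mono)
    show "integrable lborel (\<lambda>z. k z *\<^sub>R h1 (x + z))" by (rule smooth_integrable[OF h(1)])
    show "integrable lborel (\<lambda>z. k z *\<^sub>R h2 (y + z) + k z *\<^sub>R d)"
      by (intro Bochner_Integration.integrable_add smooth_integrable[OF h(2)] integrable_scaleR_left kernel_integrable)
    show "k z *\<^sub>R h1 (x + z) \<le> k z *\<^sub>R h2 (y + z) + k z *\<^sub>R d" for z
    proof (cases "norm z \<le> e")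
      case True
      show ?thesis using mult_left_mono[OF le[OF True] kernel_nonneg[of z]] by (simp add: algebra_simps)
    qed (simp add: kernel_support)
  qed
  also have "\<dots> = smooth k h2 y + d"
    unfolding smooth_def using smooth_integrable[OF h(2)] kernel_integrable
    by (subst Bochner_Integration.integral_add) (auto simp: kernel_integral)
  finally show ?thesis .
qed

lemma smooth_dist_le:
  fixes h1 h2 :: "'x \<Rightarrow> 'b::euclidean_space"
  assumes h: "continuous_on UNIV h1" "continuous_on UNIV h2"
    and le: "\<And>z. norm z \<le> e \<Longrightarrow> norm (h1 (x + z) - h2 (y + z)) \<le> d"
  shows "norm (smooth k h1 x - smooth k h2 y) \<le> d"
proof -
  have "smooth k h1 x - smooth k h2 y = (\<integral>z. k z *\<^sub>R h1 (x + z) - k z *\<^sub>R h2 (y + z) \<partial>lborel)"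
    unfolding smooth_def by (rule Bochner_Integration.integral_diff[symmetric]) (intro smooth_integrable h)+
  also have "norm \<dots> \<le> (\<integral>z. k z * d \<partial>lborel)"
  proof (rule Bochner_Integration.integral_norm_bound_integral)
    show "integrable lborel (\<lambda>z. k z *\<^sub>R h1 (x + z) - k z *\<^sub>R h2 (y + z))"
      by (intro Bochner_Integration.integrable_diff smooth_integrable h)
    show "integrable lborel (\<lambda>z. k z * d)" using kernel_integrable by simp
    show "norm (k z *\<^sub>R h1 (x + z) - k z *\<^sub>R h2 (y + z)) \<le> k z * d" for z
    proof (cases "norm z \<le> e")
      case True
      show ?thesis using mult_left_mono[OF le[OF True] kernel_nonneg[of z]] kernel_nonneg[of z]
        by (simp add: scaleR_diff_right[symmetric])
    qed (simp add: kernel_support)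
  qed
  also have "\<dots> = d" using kernel_integrable by (simp add: kernel_integral)
  finally show ?thesis .
qed

lemma smooth_norm_le:
  fixes h :: "'x \<Rightarrow> 'b::euclidean_space"
  assumes "continuous_on UNIV h" "\<And>z. norm z \<le> e \<Longrightarrow> norm (h (x + z)) \<le> d"
  shows "norm (smooth k h x) \<le> d"
  using smooth_dist_le[OF assms(1), of "\<lambda>_. 0" x x d] assms(2) by (simp add: smooth_const)

lemma smooth_near:
  fixes h :: "'x \<Rightarrow> 'b::euclidean_space"
  assumes "continuous_on UNIV h" "\<And>z. norm z \<le> e \<Longrightarrow> norm (h (x + z) - h x) \<le> d"
  shows "norm (smooth k h x - h x) \<le> d"
  using smooth_dist_le[OF assms(1), of "\<lambda>_. h x" x x d] assms(2) by (simp add: smooth_const)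

lemma smooth_translate:
  assumes "continuous_on UNIV (h :: 'x \<Rightarrow> real)"
  shows "smooth k h x = (\<integral>z. k (z - x) * h z \<partial>lborel)" "integrable lborel (\<lambda>z. k (z - x) * h z)"
proof -
  have 1: "lborel = distr lborel borel ((+) x)" by (simp add: lborel_distr_plus)
  have m: "(\<lambda>z. k (z - x) * h z) \<in> borel_measurable borel"
    using kernel_continuous(1) assms
    by (intro borel_measurable_continuous_onI continuous_on_mult)
       (auto intro!: continuous_on_compose2[of UNIV k UNIV "\<lambda>z. z - x"] continuous_intros)
  show "smooth k h x = (\<integral>z. k (z - x) * h z \<partial>lborel)" unfolding smooth_def
    by (subst (2) 1, subst integral_distr) (use m in auto)
  show "integrable lborel (\<lambda>z. k (z - x) * h z)"
    by (subst 1, subst integrable_distr_eq) (use m smooth_integrable[OF assms, of x] in auto)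
qed

lemma smooth_grad_translate:
  assumes "continuous_on UNIV (h :: 'x \<Rightarrow> real)"
  shows "smooth_grad q h x \<bullet> w = - (\<integral>z. (q (z - x) \<bullet> w) * h z \<partial>lborel)" "integrable lborel (\<lambda>z. (q (z - x) \<bullet> w) * h z)"
proof -
  have 1: "lborel = distr lborel borel ((+) x)" by (simp add: lborel_distr_plus)
  have m: "(\<lambda>z. (q (z - x) \<bullet> w) * h z) \<in> borel_measurable borel"
    using kernel_continuous(2) assms
    by (intro borel_measurable_continuous_onI continuous_on_mult continuous_on_inner)
       (auto intro!: continuous_on_compose2[of UNIV q UNIV "\<lambda>z. z - x"] continuous_intros)
  have i: "integrable lborel (\<lambda>z. (h (x + z) *\<^sub>R q z) \<bullet> w)"
    by (intro integrable_inner_left smooth_grad_integrable[OF assms])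
  have "smooth_grad q h x \<bullet> w = - (\<integral>z. (h (x + z) *\<^sub>R q z) \<bullet> w \<partial>lborel)"
    unfolding smooth_grad_def inner_minus_left
    by (subst integral_inner_left) (rule smooth_grad_integrable[OF assms], rule refl)
  also have "(\<integral>z. (h (x + z) *\<^sub>R q z) \<bullet> w \<partial>lborel) = (\<integral>z. (q (z - x) \<bullet> w) * h z \<partial>lborel)"
    by (subst (2) 1, subst integral_distr) (use m in \<open>auto simp: mult.commute\<close>)
  finally show "smooth_grad q h x \<bullet> w = - (\<integral>z. (q (z - x) \<bullet> w) * h z \<partial>lborel)" .
  show "integrable lborel (\<lambda>z. (q (z - x) \<bullet> w) * h z)"
    by (subst 1, subst integrable_distr_eq) (use m i in \<open>auto simp: mult.commute\<close>)
qed

text \<open>The expansion of the kernel is integrated against \<open>h\<close>. So the constant is uniform over all continuous functions with a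
  common bound and does not depend on their modulus of continuity.\<close>

lemma smooth_second_order:
  obtains C where "C \<ge> 0" "\<And>h B r (x::'x) y. \<lbrakk>continuous_on UNIV (h :: 'x \<Rightarrow> real); r \<le> \<rho>; norm x \<le> r; norm y \<le> r;
      \<And>z. norm z \<le> r + e \<Longrightarrow> \<bar>h z\<bar> \<le> B\<rbrakk> \<Longrightarrow>
      \<bar>smooth k h y - smooth k h x - smooth_grad q h x \<bullet> (y - x)\<bar> \<le> C * B * (norm (y - x))\<^sup>2"
proof -
  obtain C where C: "C \<ge> 0" "\<And>a w. norm a \<le> 2 * \<rho> + \<bar>e\<bar> \<Longrightarrow> norm w \<le> 2 * \<rho> + \<bar>e\<bar> \<Longrightarrow> \<bar>k (a + w) - k a - q a \<bullet> w\<bar> \<le> C * (norm w)\<^sup>2"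
    using kq unfolding mollifier_def by metis
  define v where "v = measure lborel (cball (0::'x) (\<rho> + \<bar>e\<bar>))"
  show ?thesis
  proof (rule that[of "C * v"])
    show "0 \<le> C * v" using C by (simp add: v_def)
    fix h :: "'x \<Rightarrow> real" and B r and x y :: 'x
    assume h: "continuous_on UNIV h" and r: "r \<le> \<rho>" "norm x \<le> r" "norm y \<le> r" and B: "\<And>z. norm z \<le> r + e \<Longrightarrow> \<bar>h z\<bar> \<le> B"
    \<comment> \<open>for negative \<open>e\<close> the kernel would vanish and could not have integral 1\<close>
    have e0: "0 \<le> e"
    proof (rule ccontr)
      assume "\<not> 0 \<le> e"
      then have "k z = 0" for z using kernel_support(1)[of z] norm_ge_zero[of z] by linarith
      then show False using kernel_integral by simp
    qed
    have B0: "0 \<le> B" using B[of x] r e0 abs_ge_zero[of "h x"] by linarith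
    define \<phi> where "\<phi> z = (k (z - y) - k (z - x) + q (z - x) \<bullet> (y - x)) * h z" for z
    have \<phi>i: "integrable lborel \<phi>" and \<phi>: "(\<integral>z. \<phi> z \<partial>lborel) = smooth k h y - smooth k h x - smooth_grad q h x \<bullet> (y - x)"
    proof -
      note i = smooth_translate(2)[OF h, of y] smooth_translate(2)[OF h, of x] smooth_grad_translate(2)[OF h, of x "y - x"]
      have eq: "\<phi> = (\<lambda>z. k (z - y) * h z - k (z - x) * h z + (q (z - x) \<bullet> (y - x)) * h z)"
        by (simp add: \<phi>_def fun_eq_iff algebra_simps)
      show "integrable lborel \<phi>" unfolding eq using i by (intro Bochner_Integration.integrable_add Bochner_Integration.integrable_diff)
      show "(\<integral>z. \<phi> z \<partial>lborel) = smooth k h y - smooth k h x - smooth_grad q h x \<bullet> (y - x)"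
        unfolding eq smooth_translate(1)[OF h] smooth_grad_translate(1)[OF h] using i
        by (subst Bochner_Integration.integral_add, simp, simp, subst Bochner_Integration.integral_diff) auto
    qed
    have "norm (\<integral>z. \<phi> z \<partial>lborel) \<le> (\<integral>z. C * (norm (y - x))\<^sup>2 * B * indicator (cball (0::'x) (\<rho> + \<bar>e\<bar>)) z \<partial>lborel)"
    proof (rule Bochner_Integration.integral_norm_bound_integral[OF \<phi>i])
      show "integrable lborel (\<lambda>z. C * (norm (y - x))\<^sup>2 * B * indicator (cball (0::'x) (\<rho> + \<bar>e\<bar>)) z)"
        by (intro integrable_mult_right integrable_real_indicator) (use emeasure_bounded_finite[OF bounded_cball[of "0::'x" "\<rho> + \<bar>e\<bar>"]] in auto)
      fix z :: 'x
      have t1: "norm z \<le> norm (z - x) + norm x" "norm z \<le> norm (z - y) + norm y" using norm_triangle_sub[of z x] norm_triangle_sub[of z y] by simp_all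
      show "norm (\<phi> z) \<le> C * (norm (y - x))\<^sup>2 * B * indicator (cball (0::'x) (\<rho> + \<bar>e\<bar>)) z"
      proof (cases "norm z \<le> r + e")
        case True
        have "norm (z - x) \<le> norm z + norm x" by (rule norm_triangle_ineq4)
        then have a: "norm (z - x) \<le> 2 * \<rho> + \<bar>e\<bar>" using True r by linarith
        have "norm (x - y) \<le> norm x + norm y" by (rule norm_triangle_ineq4)
        then have w: "norm (x - y) \<le> 2 * \<rho> + \<bar>e\<bar>" using r by linarith
        have "\<bar>k (z - x + (x - y)) - k (z - x) - q (z - x) \<bullet> (x - y)\<bar> \<le> C * (norm (x - y))\<^sup>2" by (rule C(2)[OF a w])
        then have "\<bar>k (z - y) - k (z - x) + q (z - x) \<bullet> (y - x)\<bar> \<le> C * (norm (y - x))\<^sup>2"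
          by (simp add: norm_minus_commute inner_diff_right)
        then have "norm (\<phi> z) \<le> (C * (norm (y - x))\<^sup>2) * B" unfolding \<phi>_def real_norm_def abs_mult
          using B[OF True] C(1) by (intro mult_mono) auto
        moreover have "z \<in> cball 0 (\<rho> + \<bar>e\<bar>)" using True r by simp
        ultimately show ?thesis by simp
      next
        case False
        then have "e \<le> norm (z - x)" "e \<le> norm (z - y)" using t1 r by linarith+
        then have "\<phi> z = 0" by (simp add: \<phi>_def kernel_support)
        then show ?thesis using C(1) B0 by simp
      qed
    qed
    also have "\<dots> = C * (norm (y - x))\<^sup>2 * B * v" by (simp add: v_def)
    finally show "\<bar>smooth k h y - smooth k h x - smooth_grad q h x \<bullet> (y - x)\<bar> \<le> C * v * B * (norm (y - x))\<^sup>2"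
      by (simp add: \<phi> mult_ac)
  qed
qed

text \<open>A derivative of the mollified function is an average of difference quotients of \<open>h\<close> near \<open>x\<close>. This is the
  link to Clarke's derivative, the upper limit of such quotients.\<close>

lemma smooth_grad_le:
  assumes h: "continuous_on UNIV (h :: 'x \<Rightarrow> real)" and s0: "0 < s0"
    and le: "\<And>y s. norm (y - x) \<le> e \<Longrightarrow> 0 < s \<Longrightarrow> s \<le> s0 \<Longrightarrow> h (y + s *\<^sub>R v) - h y \<le> c * s"
  shows "smooth_grad q h x \<bullet> v \<le> c"
proof -
  define \<rho> where "\<rho> = norm x + norm v"
  obtain C where C: "C \<ge> 0" "\<And>h B r (x::'x) y. \<lbrakk>continuous_on UNIV (h :: 'x \<Rightarrow> real); r \<le> \<rho>; norm x \<le> r; norm y \<le> r;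
      \<And>z. norm z \<le> r + e \<Longrightarrow> \<bar>h z\<bar> \<le> B\<rbrakk> \<Longrightarrow>
      \<bar>smooth k h y - smooth k h x - smooth_grad q h x \<bullet> (y - x)\<bar> \<le> C * B * (norm (y - x))\<^sup>2"
    using smooth_second_order[of \<rho>] by metis
  have "compact (h ` cball 0 (\<rho> + e))"
    by (intro compact_continuous_image) (use h in \<open>auto intro: continuous_on_subset\<close>)
  then obtain B where B: "\<forall>y\<in>h ` cball 0 (\<rho> + e). norm y \<le> B" using compact_imp_bounded bounded_iff by metis
  have key: "smooth_grad q h x \<bullet> v \<le> c + C * B * (norm v)\<^sup>2 * s" if s: "0 < s" "s \<le> s0" "s \<le> 1" for s
  proof -
    have "norm (x + s *\<^sub>R v) \<le> norm x + s * norm v" using norm_triangle_ineq[of x "s *\<^sub>R v"] s by simp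
    also have "\<dots> \<le> \<rho>" using s by (simp add: \<rho>_def mult_left_le_one_le)
    finally have "\<bar>smooth k h (x + s *\<^sub>R v) - smooth k h x - smooth_grad q h x \<bullet> (x + s *\<^sub>R v - x)\<bar> \<le> C * B * (norm (x + s *\<^sub>R v - x))\<^sup>2"
      by (intro C(2)[where r=\<rho>]) (use h B in \<open>auto simp: \<rho>_def\<close>)
    then have "s * (smooth_grad q h x \<bullet> v) \<le> smooth k h (x + s *\<^sub>R v) - smooth k h x + C * B * (norm v)\<^sup>2 * s * s"
      using s by (simp add: power_mult_distrib power2_eq_square abs_le_iff mult_ac)
    also have "smooth k h (x + s *\<^sub>R v) \<le> smooth k h x + c * s"
    proof (rule smooth_le[OF h h])
      fix z :: 'x assume "norm z \<le> e"
      then show "h (x + s *\<^sub>R v + z) \<le> h (x + z) + c * s"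
        using le[of "x + z" s] s by (simp add: algebra_simps)
    qed
    finally have "s * (smooth_grad q h x \<bullet> v) \<le> s * (c + C * B * (norm v)\<^sup>2 * s)" by (simp add: algebra_simps)
    then show ?thesis using s by simp
  qed
  have "((\<lambda>s. c + C * B * (norm v)\<^sup>2 * s) \<longlongrightarrow> c + C * B * (norm v)\<^sup>2 * 0) (at_right 0)"
    by (intro tendsto_intros)
  then have "((\<lambda>s. c + C * B * (norm v)\<^sup>2 * s) \<longlongrightarrow> c) (at_right 0)" by simp
  moreover have "\<forall>\<^sub>F s in at_right 0. smooth_grad q h x \<bullet> v \<le> c + C * B * (norm v)\<^sup>2 * s"
    unfolding eventually_at_right_field using s0 key by (intro exI[of _ "min s0 1"]) auto
  ultimately show ?thesis by (rule tendsto_lowerbound) simp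
qed

text \<open>The preceding bound in the direction of the gradient itself. The margin \<open>d\<close> leaves room for short difference quotients.\<close>

lemma norm_smooth_grad_le:
  assumes h: "continuous_on UNIV (h :: 'x \<Rightarrow> real)" and d: "0 < d" and L: "0 \<le> L"
    and lip: "\<And>y z. norm (y - x) \<le> e + d \<Longrightarrow> norm (z - x) \<le> e + d \<Longrightarrow> \<bar>h y - h z\<bar> \<le> L * norm (y - z)"
  shows "norm (smooth_grad q h x) \<le> L"
proof (cases "smooth_grad q h x = 0")
  case False
  define v where "v = smooth_grad q h x"
  have v: "norm v > 0" using False by (simp add: v_def)
  have "smooth_grad q h x \<bullet> v \<le> L * norm v"
  proof (rule smooth_grad_le[OF h])
    show "0 < d / norm v" using d v by simp
    fix y s assume y: "norm (y - x) \<le> e" and s: "0 < s" "s \<le> d / norm v"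
    have "norm (y + s *\<^sub>R v - x) \<le> norm (y - x) + norm (s *\<^sub>R v)" 
      using norm_triangle_ineq[of "y - x" "s *\<^sub>R v"] by (simp add: algebra_simps)
    also have "norm (s *\<^sub>R v) \<le> d" using s v by (simp add: field_simps)
    finally have "\<bar>h (y + s *\<^sub>R v) - h y\<bar> \<le> L * norm (y + s *\<^sub>R v - y)" using y d by (intro lip) auto
    then show "h (y + s *\<^sub>R v) - h y \<le> L * norm v * s" using s by (simp add: mult_ac)
  qed
  then have "norm v * norm v \<le> L * norm v" by (simp add: v_def power2_norm_eq_inner[symmetric] power2_eq_square)
  then show ?thesis using v by (simp add: v_def)
qed (use L in simp)

lemma smooth_grad_diff:
  assumes "continuous_on UNIV h1" "continuous_on UNIV h2"
  shows "smooth_grad q (\<lambda>y. h1 y - h2 y) x = smooth_grad q h1 x - smooth_grad q h2 x"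
  unfolding smooth_grad_def using smooth_grad_integrable[OF assms(1), of x] smooth_grad_integrable[OF assms(2), of x]
  by (simp add: scaleR_diff_left)

lemma smooth_grad_cmult:
  shows "smooth_grad q (\<lambda>y. c * h y) x = c *\<^sub>R smooth_grad q h x"
  unfolding smooth_grad_def by (simp add: scaleR_scaleR[symmetric] del: scaleR_scaleR)

lemma smooth_linear:
  fixes f :: "'x \<Rightarrow> 'b::euclidean_space" and g :: "'x \<Rightarrow> real"
  assumes "continuous_on UNIV f" "continuous_on UNIV g"
  shows "smooth k (\<lambda>y. p \<bullet> f y + l * g y) x = p \<bullet> smooth k f x + l * smooth k g x"
proof -
  have i: "integrable lborel (\<lambda>z. p \<bullet> (k z *\<^sub>R f (x + z)))" "integrable lborel (\<lambda>z. l * (k z *\<^sub>R g (x + z)))"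
    by (intro integrable_inner_right integrable_mult_right smooth_integrable assms)+
  have "smooth k (\<lambda>y. p \<bullet> f y + l * g y) x = (\<integral>z. p \<bullet> (k z *\<^sub>R f (x + z)) + l * (k z *\<^sub>R g (x + z)) \<partial>lborel)"
    unfolding smooth_def by (rule Bochner_Integration.integral_cong) (simp_all add: algebra_simps)
  also have "\<dots> = (\<integral>z. p \<bullet> (k z *\<^sub>R f (x + z)) \<partial>lborel) + (\<integral>z. l * (k z *\<^sub>R g (x + z)) \<partial>lborel)"
    by (rule Bochner_Integration.integral_add[OF i])
  also have "\<dots> = p \<bullet> smooth k f x + l * smooth k g x"
    unfolding smooth_def by (subst integral_inner_right) (use smooth_integrable[OF assms(1), of x] in auto)
  finally show ?thesis .
qed

text \<open>The common form of the mollified field and of its gradient.\<close>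

lemma caratheodory_field_parametric_integral:
  fixes \<Phi> :: "real \<Rightarrow> 'x \<Rightarrow> 'a::euclidean_space" and B :: "'a \<Rightarrow> 'x \<Rightarrow> 'b::euclidean_space"
  assumes \<Phi>: "caratheodory_field \<Phi>" and B: "continuous_on UNIV (\<lambda>(a, z). B a z)" and supp: "\<And>a z. e \<le> norm z \<Longrightarrow> B a z = 0"
  shows "caratheodory_field (\<lambda>t x. \<integral>z. B (\<Phi> t (x + z)) z \<partial>lborel)"
  unfolding caratheodory_field_def
proof (intro conjI allI impI)
  fix x :: 'x
  have Bm: "(\<lambda>p. B (fst p) (snd p)) \<in> borel \<Otimes>\<^sub>M borel \<rightarrow>\<^sub>M borel"
    using borel_measurable_continuous_onI[OF B] by (simp add: borel_prod split_def)
  have "(\<lambda>p. (fst p, x + snd p)) \<in> lebesgue_on {0::real..} \<Otimes>\<^sub>M borel \<rightarrow>\<^sub>M lebesgue_on {0..} \<Otimes>\<^sub>M borel"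
    by (intro measurable_Pair measurable_fst borel_measurable_add measurable_const measurable_snd) auto
  from measurable_compose[OF this caratheodory_field_jointly_measurable[OF \<Phi>]]
  have "(\<lambda>p. \<Phi> (fst p) (x + snd p)) \<in> borel_measurable (lebesgue_on {0::real..} \<Otimes>\<^sub>M borel)" by simp
  then have "(\<lambda>p. (\<Phi> (fst p) (x + snd p), snd p)) \<in> lebesgue_on {0::real..} \<Otimes>\<^sub>M borel \<rightarrow>\<^sub>M borel \<Otimes>\<^sub>M borel"
    by measurable
  from measurable_compose[OF this Bm]
  have "(\<lambda>p. B (\<Phi> (fst p) (x + snd p)) (snd p)) \<in> borel_measurable (lebesgue_on {0::real..} \<Otimes>\<^sub>M borel)" by simp
  then have "(\<lambda>(t, z). B (\<Phi> t (x + z)) z) \<in> borel_measurable (lebesgue_on {0::real..} \<Otimes>\<^sub>M lborel)"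
    by (simp add: split_def cong: measurable_cong_sets sets_pair_measure_cong)
  then show "(\<lambda>t. \<integral>z. B (\<Phi> t (x + z)) z \<partial>lborel) \<in> borel_measurable (lebesgue_on {0..})"
    by (rule lborel.borel_measurable_lebesgue_integral)
next
  fix t :: real assume "0 \<le> t"
  then have \<Phi>c: "continuous_on UNIV (\<Phi> t)" using \<Phi> by (simp add: caratheodory_field_def)
  define Q where "Q = cbox (- \<bar>e\<bar> *\<^sub>R One) (\<bar>e\<bar> *\<^sub>R One :: 'x)"
  have jc: "continuous_on UNIV (\<lambda>(x, z). B (\<Phi> t (x + z)) z)"
    unfolding split_def
    by (rule continuous_on_compose2[OF B[unfolded split_def], of _ "\<lambda>p. (\<Phi> t (fst p + snd p), snd p)", simplified])
       (auto intro!: continuous_intros continuous_on_compose2[OF \<Phi>c])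
  have "(\<integral>z. B (\<Phi> t (x + z)) z \<partial>lborel) = integral Q (\<lambda>z. B (\<Phi> t (x + z)) z)" for x
  proof -
    have c: "continuous_on UNIV (\<lambda>z. B (\<Phi> t (x + z)) z)"
      using continuous_on_compose2[OF jc continuous_on_Pair[OF continuous_on_const[of UNIV x] continuous_on_id]] by simp
    have "(\<integral>z. B (\<Phi> t (x + z)) z \<partial>lborel) = integral UNIV (\<lambda>z. B (\<Phi> t (x + z)) z)"
      by (rule integral_lborel[symmetric], rule integrable_compact_support[OF c supp])
    also have "\<dots> = integral Q (\<lambda>z. B (\<Phi> t (x + z)) z)"
    proof (rule integral_spike_set)
      have "B (\<Phi> t (x + z)) z = 0" if "z \<notin> Q" for z
      proof (rule supp, rule ccontr)
        assume "\<not> e \<le> norm z"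
        then have "\<bar>z \<bullet> b\<bar> \<le> \<bar>e\<bar>" if "b \<in> Basis" for b using Basis_le_norm[OF that, of z] by linarith
        then have "z \<in> Q" by (auto simp: Q_def mem_box abs_le_iff minus_le_iff)
        then show False using that by simp
      qed
      then have "{z \<in> UNIV - Q. B (\<Phi> t (x + z)) z \<noteq> 0} = {}" by blast
      then show "negligible {z \<in> UNIV - Q. B (\<Phi> t (x + z)) z \<noteq> 0}" by (simp only: negligible_empty)
      show "negligible {z \<in> Q - UNIV. B (\<Phi> t (x + z)) z \<noteq> 0}" by simp
    qed
    finally show ?thesis .
  qed
  moreover have "continuous_on UNIV (\<lambda>x. integral Q (\<lambda>z. B (\<Phi> t (x + z)) z))"
    unfolding Q_def by (rule integral_continuous_on_param) (use jc in \<open>auto intro: continuous_on_subset\<close>)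
  ultimately show "continuous_on UNIV (\<lambda>x. \<integral>z. B (\<Phi> t (x + z)) z \<partial>lborel)" by simp
qed

lemma caratheodory_field_smooth:
  fixes \<Phi> :: "real \<Rightarrow> 'x \<Rightarrow> 'a::euclidean_space"
  assumes "caratheodory_field \<Phi>"
  shows "caratheodory_field (\<lambda>t. smooth k (\<Phi> t))"
  unfolding smooth_def
  by (rule caratheodory_field_parametric_integral[OF assms, of "\<lambda>a z. k z *\<^sub>R a"])
     (auto simp: kernel_support split_def intro!: continuous_intros continuous_on_compose2[OF kernel_continuous(1)])

lemma caratheodory_field_smooth_grad:
  assumes "caratheodory_field \<Phi>"
  shows "caratheodory_field (\<lambda>t. smooth_grad q (\<Phi> t))"
proof -
  have "caratheodory_field (\<lambda>t x. \<integral>z. \<Phi> t (x + z) *\<^sub>R - q z \<partial>lborel)"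
    by (rule caratheodory_field_parametric_integral[OF assms, of "\<lambda>a z. a *\<^sub>R - q z"])
       (auto simp: kernel_support split_def intro!: continuous_intros continuous_on_compose2[OF kernel_continuous(2)])
  then show ?thesis by (simp add: smooth_grad_def[abs_def])
qed

end

section \<open>Approximate maximum principle on a bounded interval\<close>

definition mollify :: "('x::euclidean_space \<Rightarrow> real) \<Rightarrow> (real \<Rightarrow> 'x \<Rightarrow> 'u \<Rightarrow> 'b::euclidean_space) \<Rightarrow> real \<Rightarrow> 'x \<Rightarrow> 'u \<Rightarrow> 'b" where
  "mollify k f t x p = smooth k (\<lambda>y. f t y p) x"

text \<open>The bound that Gronwall's inequality yields for all trajectories if \<open>m t\<close> is a Lipschitz constant of the field and bounds
  its value at the origin.\<close>

definition radius :: "(real \<Rightarrow> real) \<Rightarrow> real \<Rightarrow> real" where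
  "radius m t = 2 * integral {0..t} m * growth m t"

lemma radius_mono:
  assumes m: "loc_int m" "\<And>t. 0 \<le> t \<Longrightarrow> 0 \<le> m t" and "0 \<le> s" "s \<le> t"
  shows "radius m s \<le> radius m t"
  unfolding radius_def
  using assms integral_mono_upper[OF assms] growth_mono[OF assms] integral_nonneg[OF loc_int_integrable[OF m(1) order_refl]]
  by (intro mult_mono) (auto simp: less_imp_le)

text \<open>The integral form of \<^const>\<open>solves\<close>.\<close>

definition trajectory :: "(real \<Rightarrow> 'x::euclidean_space \<Rightarrow> 'u \<Rightarrow> 'x) \<Rightarrow> (real \<Rightarrow> 'u) \<Rightarrow> (real \<Rightarrow> 'x) \<Rightarrow> bool" where
  "trajectory F u x \<longleftrightarrow> continuous_on {0..} x \<and> loc_int (\<lambda>t. F t (x t) (u t)) \<and>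
     (\<forall>t\<ge>0. x t = integral {0..t} (\<lambda>s. F s (x s) (u s)))"

text \<open>The data together with two bounds. The function \<open>m\<close> controls the dynamics near the origin and its Lipschitz
  constant, and thereby the radius of the tube that contains all trajectories. The weight \<open>M\<close> then controls
  everything else in a neighbourhood of this tube, whose width 2 accommodates mollification at a scale of at most 1
  and difference quotients with steps of at most 1. It is at least 1, so that sets of small weighted measure have small measure.\<close>

locale control_problem =
  fixes U :: "real \<Rightarrow> 'u::euclidean_space set"
    and f :: "real \<Rightarrow> 'x::euclidean_space \<Rightarrow> 'u \<Rightarrow> 'x"
    and g :: "real \<Rightarrow> 'x \<Rightarrow> 'u \<Rightarrow> real"
    and m M :: "real \<Rightarrow> real"
  assumes f_car: "\<And>u. u \<in> selectors U \<Longrightarrow> caratheodory_field (\<lambda>t x. f t x (u t))"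
    and g_car: "\<And>u. u \<in> selectors U \<Longrightarrow> caratheodory_field (\<lambda>t x. g t x (u t))"
    and f_cont: "\<And>t p. 0 \<le> t \<Longrightarrow> p \<in> U t \<Longrightarrow> continuous_on UNIV (\<lambda>x. f t x p)"
    and g_cont: "\<And>t p. 0 \<le> t \<Longrightarrow> p \<in> U t \<Longrightarrow> continuous_on UNIV (\<lambda>x. g t x p)"
    and m: "loc_int m" "\<And>t. 0 \<le> t \<Longrightarrow> 0 \<le> m t"
    and M: "loc_int M" "\<And>t. 0 \<le> t \<Longrightarrow> 1 \<le> M t" "\<And>t. 0 \<le> t \<Longrightarrow> m t \<le> M t"
    and f_lip: "\<And>t x y p. 0 \<le> t \<Longrightarrow> p \<in> U t \<Longrightarrow> norm (f t x p - f t y p) \<le> m t * norm (x - y)"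
    and f_unit: "\<And>t x p. 0 \<le> t \<Longrightarrow> p \<in> U t \<Longrightarrow> norm x \<le> 1 \<Longrightarrow> norm (f t x p) \<le> m t"
    and f_bound: "\<And>t x p. 0 \<le> t \<Longrightarrow> p \<in> U t \<Longrightarrow> norm x \<le> radius m t + 2 \<Longrightarrow> norm (f t x p) \<le> M t"
    and g_bound: "\<And>t x p. 0 \<le> t \<Longrightarrow> p \<in> U t \<Longrightarrow> norm x \<le> radius m t + 2 \<Longrightarrow> \<bar>g t x p\<bar> \<le> M t"
    and g_lip: "\<And>t x y p. 0 \<le> t \<Longrightarrow> p \<in> U t \<Longrightarrow> norm x \<le> radius m t + 2 \<Longrightarrow> norm y \<le> radius m t + 2 \<Longrightarrow>
        \<bar>g t x p - g t y p\<bar> \<le> M t * norm (x - y)"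
begin

lemma M_nonneg: "0 \<le> t \<Longrightarrow> 0 \<le> M t" using M(2)[of t] by linarith

lemma selectorsD:
  assumes "u \<in> selectors U"
  shows "0 \<le> t \<Longrightarrow> u t \<in> U t" "u \<in> borel_measurable (lebesgue_on {0..})"
  using assms selectors_measurable_lebesgue by (auto simp: selectors_def)

text \<open>The dynamics and their mollifications share all the estimates that matter.\<close>

definition regular :: "(real \<Rightarrow> 'x \<Rightarrow> 'u \<Rightarrow> 'x) \<Rightarrow> bool" where
  "regular F \<longleftrightarrow> (\<forall>u\<in>selectors U. caratheodory_field (\<lambda>t x. F t x (u t))) \<and>
     (\<forall>t\<ge>0. \<forall>p\<in>U t. (\<forall>x y. norm (F t x p - F t y p) \<le> m t * norm (x - y)) \<and> norm (F t 0 p) \<le> m t \<and>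
        (\<forall>x. norm x \<le> radius m t \<longrightarrow> norm (F t x p) \<le> M t))"

lemma regular_f: "regular f"
  unfolding regular_def using f_car f_lip f_unit f_bound by auto

lemma regularD:
  assumes "regular F"
  shows "u \<in> selectors U \<Longrightarrow> caratheodory_field (\<lambda>t x. F t x (u t))"
    "0 \<le> t \<Longrightarrow> p \<in> U t \<Longrightarrow> norm (F t x p - F t y p) \<le> m t * norm (x - y)"
    "0 \<le> t \<Longrightarrow> p \<in> U t \<Longrightarrow> norm (F t 0 p) \<le> m t"
    "0 \<le> t \<Longrightarrow> p \<in> U t \<Longrightarrow> norm x \<le> radius m t \<Longrightarrow> norm (F t x p) \<le> M t"
  using assms by (auto simp: regular_def)

lemma field_zero_loc_int:
  assumes "regular F" "u \<in> selectors U"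
  shows "loc_int (\<lambda>t. F t 0 (u t))"
  by (rule loc_int_dominated[OF _ m(1)])
     (use regularD[OF assms(1)] selectorsD[OF assms(2)] assms(2) in \<open>auto simp: caratheodory_field_def\<close>)

lemma trajectory_exists:
  assumes F: "regular F" and u: "u \<in> selectors U"
  shows "\<exists>x. trajectory F u x"
proof -
  have lip: "norm (F t x (u t) - F t y (u t)) \<le> m t * norm (x - y)" if "0 \<le> t" for t x y
    using regularD(2)[OF F that] selectorsD[OF u] that by auto
  obtain x where x: "continuous_on {0..} x" "\<forall>t\<ge>0. x t = 0 + integral {0..t} (\<lambda>s. F s (x s) (u s))"
    using caratheodory_ode_exists[OF regularD(1)[OF F u] m lip field_zero_loc_int[OF F u], of 0] by blast
  have "loc_int (\<lambda>t. F t (x t) (u t))"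
    by (rule loc_int_field_along_curve[OF regularD(1)[OF F u] x(1) m(1) lip field_zero_loc_int[OF F u]])
  then show ?thesis using x by (auto simp: trajectory_def)
qed

lemma trajectoryD:
  assumes "trajectory F u x"
  shows "continuous_on {0..} x" "loc_int (\<lambda>t. F t (x t) (u t))" "0 \<le> t \<Longrightarrow> x t = integral {0..t} (\<lambda>s. F s (x s) (u s))" "x 0 = 0"
  using assms by (auto simp: trajectory_def)

text \<open>The zero curve is compared with the trajectory.\<close>

lemma trajectory_bound:
  assumes F: "regular F" and u: "u \<in> selectors U" and x: "trajectory F u x" and t: "0 \<le> t"
  shows "norm (x t) \<le> radius m t"
proof -
  have "norm (x t - (\<lambda>_. 0) t) \<le> 2 * (norm (x 0 - (\<lambda>_. 0) 0) + integral {0..t} m) * growth m t"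
  proof (rule integral_curve_compare[OF m t _ _ trajectoryD(2)[OF x] loc_int_const[of 0] m(1)])
    fix s :: real assume s: "0 \<le> s"
    have "norm (F s (x s) (u s)) \<le> norm (F s (x s) (u s) - F s 0 (u s)) + norm (F s 0 (u s))"
      using norm_triangle_ineq[of "F s (x s) (u s) - F s 0 (u s)" "F s 0 (u s)"] by simp
    also have "\<dots> \<le> m s * norm (x s - 0) + m s"
      by (intro add_mono regularD(2,3)[OF F s]) (use selectorsD[OF u] s in auto)
    finally show "norm (F s (x s) (u s) - 0) \<le> m s * norm (x s - 0) + m s" by simp
  qed (use trajectoryD[OF x] m(2) in auto)
  then show ?thesis using trajectoryD(4)[OF x] by (simp add: radius_def)
qed

text \<open>The distance of controls: where they differ, dynamics and running cost at the same state of the tube differ by at most \<open>2 * M t\<close>.\<close>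

definition deviation :: "(real \<Rightarrow> 'u) \<Rightarrow> (real \<Rightarrow> 'u) \<Rightarrow> real \<Rightarrow> real" where
  "deviation u w T = integral {0..T} (\<lambda>t. if u t \<noteq> w t then M t else 0)"

lemma loc_int_if:
  assumes "{t\<in>{0..}. P t} \<in> sets (lebesgue_on {0..})" and h: "loc_int h"
  shows "loc_int (\<lambda>t. if P t then h t else 0)"
proof (rule loc_int_dominated)
  show "(\<lambda>t. if P t then h t else 0) \<in> borel_measurable (lebesgue_on {0..})"
    using loc_int_measurable[OF h] assms(1) by (intro measurable_If) auto
  show "loc_int (\<lambda>t. norm (h t))" by (rule loc_int_norm[OF h])
qed auto

lemma controls_differ_measurable:
  assumes "u \<in> selectors U" "w \<in> selectors U"
  shows "{t\<in>{0..}. u t \<noteq> w t} \<in> sets (lebesgue_on {0..})"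
proof -
  have "{t\<in>space (lebesgue_on {0..}). u t \<noteq> w t} \<in> sets (lebesgue_on {0..})"
    using selectorsD(2)[OF assms(1)] selectorsD(2)[OF assms(2)] by measurable
  then show ?thesis by simp
qed

lemma loc_int_deviation:
  assumes "u \<in> selectors U" "w \<in> selectors U"
  shows "loc_int (\<lambda>t. if u t \<noteq> w t then M t else 0)"
  by (rule loc_int_if[OF controls_differ_measurable[OF assms] M(1)])

lemma deviation_nonneg:
  assumes "u \<in> selectors U" "w \<in> selectors U"
  shows "0 \<le> deviation u w T"
  unfolding deviation_def
  by (rule integral_nonneg) (use loc_int_deviation[OF assms] M_nonneg in \<open>auto intro: loc_int_integrable\<close>)

lemma deviation_triangle:
  assumes "u \<in> selectors U" "w \<in> selectors U" "v \<in> selectors U"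
  shows "deviation u v T \<le> deviation u w T + deviation w v T"
  unfolding deviation_def
  using loc_int_integrable[OF loc_int_deviation[OF assms(1,2)] order_refl, of T]
    loc_int_integrable[OF loc_int_deviation[OF assms(2,3)] order_refl, of T]
    loc_int_integrable[OF loc_int_deviation[OF assms(1,3)] order_refl, of T]
  by (subst Henstock_Kurzweil_Integration.integral_add[symmetric])
     (auto intro!: integral_le Henstock_Kurzweil_Integration.integrable_add simp: M_nonneg)

lemma trajectory_compare:
  assumes F1: "regular F1" and F2: "regular F2" and u: "u \<in> selectors U" and w: "w \<in> selectors U"
    and y: "trajectory F1 u y" and x: "trajectory F2 w x" and t: "0 \<le> t" and d: "0 \<le> d"
    and near: "\<And>t x p. 0 \<le> t \<Longrightarrow> p \<in> U t \<Longrightarrow> norm x \<le> radius m t \<Longrightarrow> norm (F1 t x p - F2 t x p) \<le> d * m t"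
  shows "norm (y t - x t) \<le> 2 * (d * integral {0..t} m + 2 * deviation u w t) * growth m t"
proof -
  let ?e = "\<lambda>t. d * m t + 2 * (if u t \<noteq> w t then M t else 0)"
  have e: "loc_int ?e" by (intro loc_int_add loc_int_mult m loc_int_deviation u w)
  have "norm (y t - x t) \<le> 2 * (norm (y 0 - x 0) + integral {0..t} ?e) * growth m t"
  proof (rule integral_curve_compare[OF m t _ _ trajectoryD(2)[OF y] trajectoryD(2)[OF x] e])
    fix s :: real assume s: "0 \<le> s"
    note us = selectorsD(1)[OF u s] selectorsD(1)[OF w s]
    have yb: "norm (x s) \<le> radius m s" by (rule trajectory_bound[OF F2 w x s])
    have a: "norm (F1 s (y s) (u s) - F1 s (x s) (u s)) \<le> m s * norm (y s - x s)" by (rule regularD(2)[OF F1 s us(1)])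
    have b: "norm (F1 s (x s) (u s) - F2 s (x s) (u s)) \<le> d * m s" by (rule near[OF s us(1) yb])
    have c: "norm (F2 s (x s) (u s) - F2 s (x s) (w s)) \<le> 2 * (if u s \<noteq> w s then M s else 0)"
      using regularD(4)[OF F2 s us(1) yb] regularD(4)[OF F2 s us(2) yb] norm_triangle_ineq4[of "F2 s (x s) (u s)" "F2 s (x s) (w s)"]
      by auto
    have "F1 s (y s) (u s) - F2 s (x s) (w s) = (F1 s (y s) (u s) - F1 s (x s) (u s)) +
       ((F1 s (x s) (u s) - F2 s (x s) (u s)) + (F2 s (x s) (u s) - F2 s (x s) (w s)))" by simp
    then have "norm (F1 s (y s) (u s) - F2 s (x s) (w s)) \<le> norm (F1 s (y s) (u s) - F1 s (x s) (u s)) +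
       (norm (F1 s (x s) (u s) - F2 s (x s) (u s)) + norm (F2 s (x s) (u s) - F2 s (x s) (w s)))"
      by (simp only: order_trans[OF norm_triangle_ineq add_left_mono[OF norm_triangle_ineq]])
    then show "norm (F1 s (y s) (u s) - F2 s (x s) (w s)) \<le> m s * norm (y s - x s) + ?e s" using a b c by linarith
  qed (use trajectoryD[OF y] trajectoryD[OF x] m(2) M_nonneg d in auto)
  also have "integral {0..t} ?e = d * integral {0..t} m + 2 * deviation u w t"
    unfolding deviation_def using loc_int_integrable[OF loc_int_mult[OF m(1)] order_refl]
      loc_int_integrable[OF loc_int_mult[OF loc_int_deviation[OF u w]] order_refl]
    by (subst Henstock_Kurzweil_Integration.integral_add) auto
  finally show ?thesis using trajectoryD(4)[OF y] trajectoryD(4)[OF x] by simp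
qed

text \<open>The choice of the trajectory is immaterial, since all trajectories of a control agree on the half-line.\<close>

definition cost :: "(real \<Rightarrow> 'x \<Rightarrow> 'u \<Rightarrow> 'x) \<Rightarrow> (real \<Rightarrow> 'x \<Rightarrow> 'u \<Rightarrow> real) \<Rightarrow> real \<Rightarrow> (real \<Rightarrow> 'u) \<Rightarrow> real" where
  "cost F G T u = integral {0..T} (\<lambda>t. G t ((SOME x. trajectory F u x) t) (u t))"

lemma trajectory_unique:
  assumes "regular F" "u \<in> selectors U" "trajectory F u y" "trajectory F u x" "0 \<le> t"
  shows "y t = x t"
  using trajectory_compare[OF assms(1,1,2,2,3,4,5), of 0] by (simp add: deviation_def)

lemma cost_eq:
  assumes "regular F" "u \<in> selectors U" "trajectory F u x"
  shows "cost F G T u = integral {0..T} (\<lambda>t. G t (x t) (u t))"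
  unfolding cost_def
proof (rule Henstock_Kurzweil_Integration.integral_cong)
  fix t assume "t \<in> {0..T}"
  moreover have "trajectory F u (SOME x. trajectory F u x)" using trajectory_exists[OF assms(1,2)] by (rule someI_ex)
  ultimately show "G t ((SOME x. trajectory F u x) t) (u t) = G t (x t) (u t)"
    using trajectory_unique[OF assms(1,2) _ assms(3)] by simp
qed

context
  fixes e :: real and k :: "'x \<Rightarrow> real" and q
  assumes kq: "mollifier e k q" and e: "0 < e" "e \<le> 1"
begin

lemma mollify_near_f:
  assumes "0 \<le> t" "p \<in> U t"
  shows "norm (mollify k f t x p - f t x p) \<le> e * m t"
  unfolding mollify_def
proof (rule smooth_near[OF kq f_cont[OF assms]])
  fix z :: 'x assume z: "norm z \<le> e"
  have "norm (f t (x + z) p - f t x p) \<le> m t * norm z" using f_lip[OF assms, of "x + z" x] by simp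
  also have "\<dots> \<le> m t * e" using z m(2)[OF assms(1)] by (rule mult_left_mono)
  finally show "norm (f t (x + z) p - f t x p) \<le> e * m t" by (simp add: mult.commute)
qed

lemma mollify_near_g:
  assumes "0 \<le> t" "p \<in> U t" "norm x \<le> radius m t"
  shows "\<bar>mollify k g t x p - g t x p\<bar> \<le> e * M t"
  unfolding mollify_def real_norm_def[symmetric]
proof (rule smooth_near[OF kq g_cont[OF assms(1,2)]])
  fix z :: 'x assume z: "norm z \<le> e"
  have "norm (x + z) \<le> radius m t + 2" using norm_triangle_ineq[of x z] z e assms(3) by linarith
  then have "norm (g t (x + z) p - g t x p) \<le> M t * norm z" using g_lip[OF assms(1,2), of "x + z" x] assms(3) by simp
  also have "\<dots> \<le> M t * e" using z M_nonneg[OF assms(1)] by (rule mult_left_mono)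
  finally show "norm (g t (x + z) p - g t x p) \<le> e * M t" by (simp add: mult.commute)
qed

lemma regular_mollify: "regular (mollify k f)"
  unfolding regular_def
proof (intro conjI ballI allI impI)
  fix u assume "u \<in> selectors U"
  from caratheodory_field_smooth[OF kq f_car[OF this]]
  show "caratheodory_field (\<lambda>t x. mollify k f t x (u t))" by (simp add: mollify_def)
next
  fix t :: real and p assume t: "0 \<le> t" "p \<in> U t"
  show "norm (mollify k f t x p - mollify k f t y p) \<le> m t * norm (x - y)" for x y
    unfolding mollify_def by (rule smooth_dist_le[OF kq f_cont[OF t] f_cont[OF t]]) (rule order_trans[OF f_lip[OF t]], simp)
  show "norm (mollify k f t 0 p) \<le> m t"
    unfolding mollify_def by (rule smooth_norm_le[OF kq f_cont[OF t]]) (use f_unit[OF t] e in auto)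
  show "norm (mollify k f t x p) \<le> M t" if "norm x \<le> radius m t" for x
    unfolding mollify_def
  proof (rule smooth_norm_le[OF kq f_cont[OF t]])
    fix z :: 'x assume "norm z \<le> e"
    then show "norm (f t (x + z) p) \<le> M t" using norm_triangle_ineq[of x z] that e by (intro f_bound[OF t]) linarith
  qed
qed

lemma mollify_g_bound:
  assumes "0 \<le> t" "p \<in> U t" "norm x \<le> radius m t"
  shows "\<bar>mollify k g t x p\<bar> \<le> M t"
  unfolding mollify_def real_norm_def[symmetric]
proof (rule smooth_norm_le[OF kq g_cont[OF assms(1,2)]])
  fix z :: 'x assume "norm z \<le> e"
  then show "norm (g t (x + z) p) \<le> M t" using norm_triangle_ineq[of x z] assms(3) e 
    unfolding real_norm_def by (intro g_bound[OF assms(1,2)]) linarith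
qed

lemma mollify_g_car: "u \<in> selectors U \<Longrightarrow> caratheodory_field (\<lambda>t x. mollify k g t x (u t))"
  using caratheodory_field_smooth[OF kq g_car] by (simp add: mollify_def)

lemma loc_int_g_along:
  assumes car: "caratheodory_field (\<lambda>t x. G t x (u t))" and u: "u \<in> selectors U" and x: "continuous_on {0..} x" "\<And>t. 0 \<le> t \<Longrightarrow> norm (x t) \<le> radius m t"
    and G: "\<And>t x p. 0 \<le> t \<Longrightarrow> p \<in> U t \<Longrightarrow> norm x \<le> radius m t \<Longrightarrow> \<bar>G t x p\<bar> \<le> M t"
  shows "loc_int (\<lambda>t. G t (x t) (u t) :: real)"
  by (rule loc_int_dominated[OF caratheodory_field_compose[OF car continuous_measurable[OF x(1)]] M(1)])
     (use G selectorsD[OF u] x(2) in auto)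

lemma loc_int_f_along:
  assumes F: "regular F" and u: "u \<in> selectors U" and x: "continuous_on {0..} x" "\<And>t. 0 \<le> t \<Longrightarrow> norm (x t) \<le> radius m t"
  shows "loc_int (\<lambda>t. F t (x t) (u t))"
  by (rule loc_int_dominated[OF caratheodory_field_compose[OF regularD(1)[OF F u] continuous_measurable[OF x(1)]] M(1)])
     (use regularD(4)[OF F] selectorsD[OF u] x(2) in auto)

text \<open>The error is uniform in the control, so near optimality is preserved by mollification.\<close>

lemma cost_mollify_near:
  assumes u: "u \<in> selectors U" and T: "0 \<le> T"
  shows "\<bar>cost (mollify k f) (mollify k g) T u - cost f g T u\<bar> \<le> e * ((1 + 2 * integral {0..T} m * growth m T) * integral {0..T} M)"
proof -
  obtain y where y: "trajectory (mollify k f) u y" using trajectory_exists[OF regular_mollify u] by blast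
  obtain x where x: "trajectory f u x" using trajectory_exists[OF regular_f u] by blast
  note yb = trajectory_bound[OF regular_mollify u y] and xb = trajectory_bound[OF regular_f u x]
  let ?c = "e * (1 + 2 * integral {0..T} m * growth m T)"
  have li: "loc_int (\<lambda>t. mollify k g t (y t) (u t))"
    by (rule loc_int_g_along[where G="mollify k g", OF mollify_g_car[OF u] u trajectoryD(1)[OF y] yb mollify_g_bound])
  have li2: "loc_int (\<lambda>t. g t (x t) (u t))"
    by (rule loc_int_g_along[where G=g, OF g_car[OF u] u trajectoryD(1)[OF x] xb]) (auto intro: g_bound)
  have "cost (mollify k f) (mollify k g) T u - cost f g T u = integral {0..T} (\<lambda>t. mollify k g t (y t) (u t) - g t (x t) (u t))"
    unfolding cost_eq[OF regular_mollify u y] cost_eq[OF regular_f u x]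
    using li li2 by (simp add: Henstock_Kurzweil_Integration.integral_diff loc_int_integrable)
  also have "\<bar>\<dots>\<bar> \<le> integral {0..T} (\<lambda>t. ?c * M t)"
    unfolding real_norm_def[symmetric]
  proof (rule norm_integral_le_dominated[OF loc_int_diff[OF li li2] loc_int_mult[OF M(1)] order_refl])
    fix t assume t: "0 \<le> t" "t \<le> T"
    note ut = selectorsD(1)[OF u t(1)]
    have "norm (y t - x t) \<le> 2 * (e * integral {0..t} m + 2 * deviation u u t) * growth m t"
      by (rule trajectory_compare[OF regular_mollify regular_f u u y x t(1)]) (use e mollify_near_f in auto)
    also have "\<dots> = e * (2 * (integral {0..t} m * growth m t))" by (simp add: deviation_def)
    also have "\<dots> \<le> e * (2 * (integral {0..T} m * growth m T))"
      using integral_mono_upper[OF m t] growth_mono[OF m t] e integral_nonneg[OF loc_int_integrable[OF m(1) order_refl]] m(2)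
      by (intro mult_left_mono mult_mono) (auto simp: less_imp_le)
    finally have yx: "norm (y t - x t) \<le> e * (2 * (integral {0..T} m * growth m T))" .
    have 1: "\<bar>mollify k g t (y t) (u t) - g t (y t) (u t)\<bar> \<le> e * M t" by (rule mollify_near_g[OF t(1) ut yb[OF t(1)]])
    have "\<bar>g t (y t) (u t) - g t (x t) (u t)\<bar> \<le> M t * norm (y t - x t)"
      by (rule g_lip[OF t(1) ut]) (use yb[OF t(1)] xb[OF t(1)] in auto)
    also have "\<dots> \<le> M t * (e * (2 * (integral {0..T} m * growth m T)))"
      using yx M_nonneg[OF t(1)] by (rule mult_left_mono)
    finally have "\<bar>mollify k g t (y t) (u t) - g t (x t) (u t)\<bar> \<le> e * M t + M t * (e * (2 * (integral {0..T} m * growth m T)))"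
      using 1 by linarith
    then show "norm (mollify k g t (y t) (u t) - g t (x t) (u t)) \<le> ?c * M t" by (simp add: algebra_simps)
  qed
  finally show ?thesis by (simp add: mult_ac)
qed

definition ham :: "real \<Rightarrow> 'x \<Rightarrow> real \<Rightarrow> 'x \<Rightarrow> 'u \<Rightarrow> real" where
  "ham lam \<psi> t y p = \<psi> \<bullet> mollify k f t y p + lam * mollify k g t y p"

text \<open>The gradient of \<open>ham\<close> in the state, since \<open>ham\<close> mollifies the Hamiltonian as a whole (see \<open>ham_eq\<close> below).\<close>

definition ham_grad :: "real \<Rightarrow> 'x \<Rightarrow> real \<Rightarrow> 'x \<Rightarrow> 'u \<Rightarrow> 'x" where
  "ham_grad lam \<psi> t y p = smooth_grad q (\<lambda>z. \<psi> \<bullet> f t z p + lam * g t z p) y"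

text \<open>The condition \<open>\<psi> T = 0\<close> is the transversality condition of a free end point. The normalisation is at time \<open>0\<close>, which stays
  put when the horizon \<open>T\<close> recedes.\<close>

definition adjoint :: "real \<Rightarrow> (real \<Rightarrow> 'u) \<Rightarrow> (real \<Rightarrow> 'x) \<Rightarrow> real \<Rightarrow> (real \<Rightarrow> 'x) \<Rightarrow> bool" where
  "adjoint T w x lam \<psi> \<longleftrightarrow> 0 \<le> lam \<and> lam + norm (\<psi> 0) = 1 \<and> continuous_on {0..} \<psi> \<and> 
     loc_int (\<lambda>t. ham_grad lam (\<psi> t) t (x t) (w t)) \<and> \<psi> T = 0 \<and>
     (\<forall>t\<in>{0..T}. \<psi> t = \<psi> 0 - integral {0..t} (\<lambda>s. ham_grad lam (\<psi> s) s (x s) (w s)))"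

lemma hf_cont:
  assumes "0 \<le> t" "p \<in> U t"
  shows "continuous_on UNIV (\<lambda>z. \<psi> \<bullet> f t z p + lam * g t z p)"
  by (intro continuous_intros f_cont[OF assms] g_cont[OF assms])

lemma ham_eq:
  assumes "0 \<le> t" "p \<in> U t"
  shows "ham lam \<psi> t y p = smooth k (\<lambda>z. \<psi> \<bullet> f t z p + lam * g t z p) y"
  unfolding ham_def mollify_def using smooth_linear[OF kq f_cont[OF assms] g_cont[OF assms]] by simp

lemma hf_lip:
  assumes "0 \<le> t" "p \<in> U t" "norm x \<le> radius m t + 2" "norm y \<le> radius m t + 2"
  shows "\<bar>(\<psi> \<bullet> f t x p + lam * g t x p) - (\<psi> \<bullet> f t y p + lam * g t y p)\<bar> \<le> (norm \<psi> + \<bar>lam\<bar>) * M t * norm (x - y)"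
proof -
  have "\<bar>(\<psi> \<bullet> f t x p + lam * g t x p) - (\<psi> \<bullet> f t y p + lam * g t y p)\<bar> = \<bar>\<psi> \<bullet> (f t x p - f t y p) + lam * (g t x p - g t y p)\<bar>"
    by (simp add: inner_diff_right algebra_simps)
  also have "\<dots> \<le> \<bar>\<psi> \<bullet> (f t x p - f t y p)\<bar> + \<bar>lam * (g t x p - g t y p)\<bar>" by (rule abs_triangle_ineq)
  also have "\<dots> \<le> norm \<psi> * (m t * norm (x - y)) + \<bar>lam\<bar> * (M t * norm (x - y))"
    unfolding abs_mult
    by (intro add_mono mult_left_mono g_lip[OF assms] order_trans[OF Cauchy_Schwarz_ineq2] f_lip[OF assms(1,2)]) auto
  also have "\<dots> \<le> norm \<psi> * (M t * norm (x - y)) + \<bar>lam\<bar> * (M t * norm (x - y))"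
    using M(3)[OF assms(1)] by (intro add_mono mult_left_mono mult_right_mono) auto
  finally show ?thesis by (simp add: algebra_simps)
qed

lemma ham_grad_bound:
  assumes "0 \<le> t" "p \<in> U t" "norm x \<le> radius m t"
  shows "norm (ham_grad lam \<psi> t x p) \<le> (norm \<psi> + \<bar>lam\<bar>) * M t"
  unfolding ham_grad_def
proof (rule norm_smooth_grad_le[OF kq hf_cont[OF assms(1,2)], of 1])
  show "0 \<le> (norm \<psi> + \<bar>lam\<bar>) * M t" using M_nonneg[OF assms(1)] by simp
  fix y z assume "norm (y - x) \<le> e + 1" "norm (z - x) \<le> e + 1"
  then have "norm y \<le> radius m t + 2" "norm z \<le> radius m t + 2"
    using norm_triangle_sub[of y x] norm_triangle_sub[of z x] e assms(3) by linarith+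
  then show "\<bar>(\<psi> \<bullet> f t y p + lam * g t y p) - (\<psi> \<bullet> f t z p + lam * g t z p)\<bar> \<le> (norm \<psi> + \<bar>lam\<bar>) * M t * norm (y - z)"
    by (rule hf_lip[OF assms(1,2)])
qed simp

lemma ham_grad_diff:
  assumes "0 \<le> t" "p \<in> U t"
  shows "ham_grad lam \<psi> t x p - ham_grad lam \<psi>' t x p = ham_grad 0 (\<psi> - \<psi>') t x p"
  unfolding ham_grad_def
  using smooth_grad_diff[OF kq hf_cont[OF assms] hf_cont[OF assms], of \<psi> lam \<psi>' lam x] by (simp add: inner_diff_left)

lemma ham_grad_scale: "ham_grad (c * lam) (c *\<^sub>R \<psi>) t x p = c *\<^sub>R ham_grad lam \<psi> t x p"
  unfolding ham_grad_def using smooth_grad_cmult[OF kq, of c "\<lambda>z. \<psi> \<bullet> f t z p + lam * g t z p" x] by (simp add: algebra_simps)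

text \<open>The equation is homogeneous in the pair of \<open>lam\<close> and \<open>\<psi>\<close>: the backward solution for \<open>lam = 1\<close> is
  normalised afterwards.\<close>

lemma adjoint_exists:
  assumes w: "w \<in> selectors U" and x: "trajectory (mollify k f) w x" and T: "0 \<le> T"
  shows "\<exists>lam \<psi>. adjoint T w x lam \<psi>"
proof -
  note xb = trajectory_bound[OF regular_mollify w x]
  define \<Phi> where "\<Phi> t \<psi> = - ham_grad 1 \<psi> t (x t) (w t)" for t \<psi>
  have lip: "norm (\<Phi> t a - \<Phi> t b) \<le> M t * norm (a - b)" if "0 \<le> t" for t a b
  proof -
    have "\<Phi> t a - \<Phi> t b = ham_grad 0 (b - a) t (x t) (w t)"
      using ham_grad_diff[OF that selectorsD(1)[OF w that], of 1 b "x t" a] by (simp add: \<Phi>_def)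
    then show ?thesis using ham_grad_bound[OF that selectorsD(1)[OF w that] xb[OF that], of 0 "b - a"]
      by (simp add: norm_minus_commute mult.commute)
  qed
  have car: "caratheodory_field \<Phi>"
    unfolding caratheodory_field_def
  proof (intro conjI allI impI)
    fix \<psi>
    have "caratheodory_field (\<lambda>t z. \<psi> \<bullet> f t z (w t) + 1 * g t z (w t))"
      unfolding caratheodory_field_def
      by (intro conjI allI impI borel_measurable_add borel_measurable_times borel_measurable_inner borel_measurable_const continuous_intros)
         (use f_car[OF w] g_car[OF w] in \<open>auto simp: caratheodory_field_def\<close>)
    from caratheodory_field_compose[OF caratheodory_field_smooth_grad[OF kq this] continuous_measurable[OF trajectoryD(1)[OF x]]]
    show "(\<lambda>t. \<Phi> t \<psi>) \<in> borel_measurable (lebesgue_on {0..})"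
      unfolding \<Phi>_def ham_grad_def by simp
  next
    fix t :: real assume t: "0 \<le> t"
    show "continuous_on UNIV (\<Phi> t)"
      by (rule lipschitz_on_continuous_on[of "M t"])
         (use lip[OF t] M_nonneg[OF t] in \<open>auto intro!: lipschitz_onI simp: dist_norm\<close>)
  qed
  have zero: "loc_int (\<lambda>t. \<Phi> t 0)"
  proof (rule loc_int_dominated[OF _ M(1)])
    show "(\<lambda>t. \<Phi> t 0) \<in> borel_measurable (lebesgue_on {0..})" using car by (simp add: caratheodory_field_def)
    show "norm (\<Phi> t 0) \<le> M t" if "0 \<le> t" for t
      using ham_grad_bound[OF that selectorsD(1)[OF w that] xb[OF that], of 1 0] by (simp add: \<Phi>_def)
  qed
  obtain p where p: "continuous_on {0..} p" "p T = 0" "\<forall>t\<in>{0..T}. p t = p 0 + integral {0..t} (\<lambda>s. \<Phi> s (p s))"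
    using caratheodory_ode_exists_backward[OF car M(1) M_nonneg lip zero T] by blast
  have li: "loc_int (\<lambda>s. \<Phi> s (p s))" by (rule loc_int_field_along_curve[OF car p(1) M(1) lip zero])
  define lam where "lam = 1 / (1 + norm (p 0))"
  have lam: "0 < lam" by (simp add: lam_def add_pos_nonneg)
  have eq: "ham_grad lam (lam *\<^sub>R p t) t (x t) (w t) = - (lam *\<^sub>R \<Phi> t (p t))" for t
    using ham_grad_scale[of lam 1 "p t" t "x t" "w t"] by (simp add: \<Phi>_def)
  have "adjoint T w x lam (\<lambda>t. lam *\<^sub>R p t)"
    unfolding adjoint_def eq
  proof (intro conjI ballI)
    show "0 \<le> lam" using lam by simp
    have "1 + norm (p 0) \<noteq> 0" by (metis add_pos_nonneg less_irrefl norm_ge_zero zero_less_one)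
    then show "lam + norm (lam *\<^sub>R p 0) = 1" using lam by (simp add: lam_def field_simps)
    show "continuous_on {0..} (\<lambda>t. lam *\<^sub>R p t)" by (intro continuous_intros p)
    show "loc_int (\<lambda>t. - (lam *\<^sub>R \<Phi> t (p t)))"
      using li by (intro loc_int_uminus) (auto simp: loc_int_def intro: absolutely_integrable_scaleR_left)
    show "lam *\<^sub>R p T = 0" using p by simp
    fix t assume "t \<in> {0..T}"
    then have "p t = p 0 + integral {0..t} (\<lambda>s. \<Phi> s (p s))" using p(3) by blast
    then have "lam *\<^sub>R p t = lam *\<^sub>R p 0 + lam *\<^sub>R integral {0..t} (\<lambda>s. \<Phi> s (p s))" by (metis scaleR_add_right)
    then show "lam *\<^sub>R p t = lam *\<^sub>R p 0 - integral {0..t} (\<lambda>s. - (lam *\<^sub>R \<Phi> s (p s)))" by simp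
  qed
  then show ?thesis by blast
qed

lemma adjointD:
  assumes "adjoint T w x lam \<psi>"
  shows "0 \<le> lam" "lam + norm (\<psi> 0) = 1" "continuous_on {0..} \<psi>" "loc_int (\<lambda>t. ham_grad lam (\<psi> t) t (x t) (w t))" "\<psi> T = 0"
    "t \<in> {0..T} \<Longrightarrow> \<psi> t = \<psi> 0 - integral {0..t} (\<lambda>s. ham_grad lam (\<psi> s) s (x s) (w s))"
    "lam \<le> 1" "norm (\<psi> 0) \<le> 1"
proof -
  note a = assms[unfolded adjoint_def]
  show 1: "0 \<le> lam" "lam + norm (\<psi> 0) = 1" "continuous_on {0..} \<psi>" "loc_int (\<lambda>t. ham_grad lam (\<psi> t) t (x t) (w t))" "\<psi> T = 0"
    "t \<in> {0..T} \<Longrightarrow> \<psi> t = \<psi> 0 - integral {0..t} (\<lambda>s. ham_grad lam (\<psi> s) s (x s) (w s))"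
    using a by blast+
  show "lam \<le> 1" using 1(2) norm_ge_zero[of "\<psi> 0"] by linarith
  show "norm (\<psi> 0) \<le> 1" using 1(1,2) by linarith
qed

text \<open>Gronwall's inequality is applied forward from the normalised value at time \<open>0\<close>, which makes the bound independent of the
  horizon \<open>T\<close>.\<close>

lemma adjoint_bound:
  assumes w: "w \<in> selectors U" and x: "trajectory (mollify k f) w x" and adj: "adjoint T w x lam \<psi>" and t: "0 \<le> t" "t \<le> T"
  shows "norm (\<psi> t) \<le> 2 * (1 + integral {0..t} M) * growth M t"
proof (rule gronwall[OF M(1) M_nonneg t(1)])
  note xb = trajectory_bound[OF regular_mollify w x]
  note \<psi> = adjointD[OF adj]
  have lam1: "lam \<le> 1" and p1: "norm (\<psi> 0) \<le> 1" using \<psi>(7,8) .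
  show "continuous_on {0..} (\<lambda>t. norm (\<psi> t))" by (intro continuous_intros \<psi>)
  show "0 \<le> 1 + integral {0..t} M" using integral_nonneg[OF loc_int_integrable[OF M(1) order_refl], of t] M_nonneg by simp
  fix s assume s: "0 \<le> s" "s \<le> t"
  have l1: "loc_int (\<lambda>r. M r * norm (\<psi> r))" by (intro loc_int_mult_continuous M continuous_intros \<psi>)
  have "norm (\<psi> s) \<le> norm (\<psi> 0) + norm (integral {0..s} (\<lambda>r. ham_grad lam (\<psi> r) r (x r) (w r)))"
    using \<psi>(6)[of s] s t norm_triangle_ineq4[of "\<psi> 0"] by simp
  also have "norm (integral {0..s} (\<lambda>r. ham_grad lam (\<psi> r) r (x r) (w r))) \<le> integral {0..s} (\<lambda>r. M r + M r * norm (\<psi> r))"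
  proof (rule norm_integral_le_dominated[OF \<psi>(4) loc_int_add[OF M(1) l1] order_refl])
    fix r assume r: "0 \<le> r" "r \<le> s"
    have "norm (ham_grad lam (\<psi> r) r (x r) (w r)) \<le> (norm (\<psi> r) + \<bar>lam\<bar>) * M r"
      by (rule ham_grad_bound[OF r(1) selectorsD(1)[OF w r(1)] xb[OF r(1)]])
    also have "\<dots> \<le> (norm (\<psi> r) + 1) * M r" using lam1 \<psi>(1) M_nonneg[OF r(1)] by (intro mult_right_mono) auto
    finally show "norm (ham_grad lam (\<psi> r) r (x r) (w r)) \<le> M r + M r * norm (\<psi> r)" by (simp add: algebra_simps)
  qed
  also have "\<dots> = integral {0..s} M + integral {0..s} (\<lambda>r. M r * norm (\<psi> r))"
    by (rule Henstock_Kurzweil_Integration.integral_add) (intro loc_int_integrable M l1 order_refl)+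
  also have "integral {0..s} M \<le> integral {0..t} M" by (rule integral_mono_upper[OF M(1) M_nonneg s])
  finally show "norm (\<psi> s) \<le> 1 + integral {0..t} M + integral {0..s} (\<lambda>r. M r * norm (\<psi> r))" using p1 by linarith
qed simp_all

end

lemma loc_int_ham_along:
  assumes kq: "mollifier e k q" and e: "0 < e" "e \<le> 1" and \<psi>: "continuous_on {0..} \<psi>" and u: "u \<in> selectors U"
    and x: "continuous_on {0..} x" "\<And>t. 0 \<le> t \<Longrightarrow> norm (x t) \<le> radius m t"
  shows "loc_int (\<lambda>t. ham k lam (\<psi> t) t (x t) (u t))"
proof -
  have a: "loc_int (\<lambda>t. mollify k f t (x t) (u t))"
    by (rule loc_int_f_along[OF kq e regular_mollify[OF kq e] u x])
  have b: "loc_int (\<lambda>t. mollify k g t (x t) (u t))"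
    by (rule loc_int_g_along[where G="mollify k g", OF kq e mollify_g_car[OF kq e u] u x mollify_g_bound[OF kq e]])
  show ?thesis
    unfolding ham_def[OF kq e]
    using loc_int_add[OF loc_int_inner_continuous[OF a \<psi>] loc_int_mult[OF b, of lam]] by (simp add: inner_commute)
qed

context
  fixes e :: real and k :: "'x \<Rightarrow> real" and q
  assumes kq: "mollifier e k q" and e: "0 < e" "e \<le> 1"
begin

text \<open>Integration by parts against the adjoint curve cancels the first variation of the state. What remains is the increment of
  the Hamiltonian along the unperturbed curve, up to mixed and second order terms, which are quadratic in the deviation.\<close>

lemma cost_increment:
  assumes T: "0 \<le> T"
  obtains C where "0 \<le> C"
    "\<And>w x lam \<psi> u. \<lbrakk>w \<in> selectors U; trajectory (mollify k f) w x; adjoint q T w x lam \<psi>; u \<in> selectors U\<rbrakk> \<Longrightarrow>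
      integral {0..T} (\<lambda>t. ham k lam (\<psi> t) t (x t) (u t) - ham k lam (\<psi> t) t (x t) (w t)) - C * (deviation u w T)\<^sup>2
        \<le> lam * (cost (mollify k f) (mollify k g) T u - cost (mollify k f) (mollify k g) T w)"
proof -
  define \<rho> where "\<rho> = radius m T"
  obtain C0 where C0: "C0 \<ge> 0" "\<And>h B r (x::'x) y. \<lbrakk>continuous_on UNIV h; r \<le> \<rho>; norm x \<le> r; norm y \<le> r;
      \<And>z. norm z \<le> r + e \<Longrightarrow> \<bar>h z\<bar> \<le> B\<rbrakk> \<Longrightarrow>
      \<bar>smooth k h y - smooth k h x - smooth_grad q h x \<bullet> (y - x)\<bar> \<le> C0 * B * (norm (y - x))\<^sup>2"
    using smooth_second_order[OF kq, of \<rho>] by metis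
  \<comment> \<open>\<open>P\<close> will bound \<open>norm (\<psi> t) + lam\<close>, and \<open>a\<close> times the deviation the distance of the trajectories\<close>
  define P where "P = 2 * (1 + integral {0..T} M) * growth M T + 1"
  define a where "a = 4 * growth m T"
  define C where "C = 2 * P * a + C0 * P * a\<^sup>2 * integral {0..T} M"
  have IM: "0 \<le> integral {0..T} M" using integral_nonneg[OF loc_int_integrable[OF M(1) order_refl], of T] M_nonneg by simp
  have P1: "1 \<le> P" using IM by (simp add: P_def less_imp_le)
  have a0: "0 \<le> a" by (simp add: a_def less_imp_le)
  show ?thesis
  proof (rule that[of C])
    show "0 \<le> C" using IM P1 a0 C0(1) by (simp add: C_def)
    fix w x lam \<psi> u
    assume w: "w \<in> selectors U" and x: "trajectory (mollify k f) w x" and adj: "adjoint q T w x lam \<psi>" and u: "u \<in> selectors U"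
    let ?F = "mollify k f" and ?G = "mollify k g" and ?d = "deviation u w T"
    note rF = regular_mollify[OF kq e]
    obtain y where y: "trajectory ?F u y" using trajectory_exists[OF rF u] by blast
    note xb = trajectory_bound[OF rF w x] and yb = trajectory_bound[OF rF u y]
    note \<psi> = adjointD[OF kq e adj]
    define \<zeta> where "\<zeta> t = ham_grad q lam (\<psi> t) t (x t) (w t)" for t
    have d0: "0 \<le> ?d" by (rule deviation_nonneg[OF u w])
    have P: "norm (\<psi> t) + \<bar>lam\<bar> \<le> P" if t: "0 \<le> t" "t \<le> T" for t
    proof -
      have "norm (\<psi> t) \<le> 2 * (1 + integral {0..t} M) * growth M t" by (rule adjoint_bound[OF kq e w x adj t])
      also have "\<dots> \<le> 2 * (1 + integral {0..T} M) * growth M T"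
        using integral_mono_upper[OF M(1) M_nonneg t] growth_mono[OF M(1) M_nonneg t] IM
          integral_nonneg[OF loc_int_integrable[OF M(1) order_refl], of t] M_nonneg
        by (intro mult_mono) (auto simp: less_imp_le)
      finally show ?thesis using \<psi>(1,7) by (simp add: P_def)
    qed
    have dist: "norm (y t - x t) \<le> a * ?d" if t: "0 \<le> t" "t \<le> T" for t
    proof -
      have "norm (y t - x t) \<le> 2 * (0 * integral {0..t} m + 2 * deviation u w t) * growth m t"
        by (rule trajectory_compare[OF rF rF u w y x t(1)]) auto
      also have "\<dots> = 4 * (deviation u w t * growth m t)" by simp
      also have "\<dots> \<le> 4 * (?d * growth m T)"
      proof -
        have "deviation u w t \<le> ?d" unfolding deviation_def
          by (rule integral_mono_upper[OF loc_int_deviation[OF u w] _ t]) (use M_nonneg in auto)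
        then show ?thesis using growth_mono[OF m t] d0 by (intro mult_left_mono mult_mono) (auto simp: less_imp_le)
      qed
      finally show ?thesis by (simp add: a_def mult_ac)
    qed
    have lF: "loc_int (\<lambda>t. ?F t (z t) (v t))" if "v \<in> selectors U" "trajectory ?F v' z" "v' \<in> selectors U" for v v' z
      by (rule loc_int_f_along[OF kq e rF that(1) trajectoryD(1)[OF that(2)] trajectory_bound[OF rF that(3,2)]])
    have lG: "loc_int (\<lambda>t. ?G t (z t) (v t))" if "v \<in> selectors U" "trajectory ?F v' z" "v' \<in> selectors U" for v v' z
      by (rule loc_int_g_along[where G="?G", OF kq e mollify_g_car[OF kq e that(1)] that(1) trajectoryD(1)[OF that(2)]
          trajectory_bound[OF rF that(3,2)] mollify_g_bound[OF kq e]])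
    have lH: "loc_int (\<lambda>t. ham k lam (\<psi> t) t (x t) (v t))" if "v \<in> selectors U" for v
      by (rule loc_int_ham_along[OF kq e \<psi>(3) that trajectoryD(1)[OF x] xb])
    define \<delta> where "\<delta> t = ?F t (y t) (u t) - ?F t (x t) (w t)" for t
    have l\<delta>: "loc_int \<delta>" unfolding \<delta>_def by (intro loc_int_diff lF[OF u y u] lF[OF w x w])
    have yx: "y t - x t = integral {0..t} \<delta>" if "0 \<le> t" for t
      unfolding \<delta>_def trajectoryD(3)[OF y that] trajectoryD(3)[OF x that]
      by (rule Henstock_Kurzweil_Integration.integral_diff[symmetric]) (intro loc_int_integrable lF[OF u y u] lF[OF w x w] order_refl)+
    have l\<zeta>: "loc_int \<zeta>" unfolding \<zeta>_def by (rule \<psi>(4))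
    have yxc: "continuous_on {0..} (\<lambda>t. y t - x t)" by (intro continuous_intros trajectoryD(1)[OF y] trajectoryD(1)[OF x])
    have parts: "integral {0..T} (\<lambda>t. \<psi> t \<bullet> \<delta> t) = integral {0..T} (\<lambda>t. \<zeta> t \<bullet> (y t - x t))"
    proof -
      have "integral {0..T} (\<lambda>t. \<psi> t \<bullet> \<delta> t) = - integral {0..T} (\<lambda>t. - \<zeta> t \<bullet> integral {0..t} \<delta>)"
      proof (rule integral_by_parts_inner[OF loc_int_uminus[OF l\<zeta>] l\<delta> T \<psi>(3) _ \<psi>(5)])
        fix t assume "0 \<le> t" "t \<le> T"
        then show "\<psi> t = \<psi> 0 + integral {0..t} (\<lambda>t. - \<zeta> t)" using \<psi>(6)[of t] by (simp add: \<zeta>_def)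
      qed
      also have "\<dots> = integral {0..T} (\<lambda>t. \<zeta> t \<bullet> integral {0..t} \<delta>)" by simp
      also have "\<dots> = integral {0..T} (\<lambda>t. \<zeta> t \<bullet> (y t - x t))"
        by (rule Henstock_Kurzweil_Integration.integral_cong) (simp add: yx)
      finally show ?thesis .
    qed
    let ?A = "\<lambda>t. lam * (?G t (y t) (u t) - ?G t (x t) (w t))"
    have lA: "loc_int ?A" by (intro loc_int_mult loc_int_diff lG[OF u y u] lG[OF w x w])
    have l1: "loc_int (\<lambda>t. \<psi> t \<bullet> \<delta> t)" using loc_int_inner_continuous[OF l\<delta> \<psi>(3)] by (simp add: inner_commute)
    have l2: "loc_int (\<lambda>t. \<zeta> t \<bullet> (y t - x t))" by (rule loc_int_inner_continuous[OF l\<zeta> yxc])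
    have "lam * (cost ?F ?G T u - cost ?F ?G T w) = integral {0..T} ?A"
      unfolding cost_eq[OF rF u y] cost_eq[OF rF w x]
      using loc_int_integrable[OF lG[OF u y u] order_refl] loc_int_integrable[OF lG[OF w x w] order_refl]
      by (simp add: Henstock_Kurzweil_Integration.integral_diff)
    \<comment> \<open>by adding zero in this form the integrand becomes an increment of the Hamiltonian\<close>
    also have "\<dots> = integral {0..T} ?A + (integral {0..T} (\<lambda>t. \<psi> t \<bullet> \<delta> t) - integral {0..T} (\<lambda>t. \<zeta> t \<bullet> (y t - x t)))"
      using parts by simp
    also have "\<dots> = integral {0..T} (\<lambda>t. ?A t + (\<psi> t \<bullet> \<delta> t - \<zeta> t \<bullet> (y t - x t)))"
      using loc_int_integrable[OF lA order_refl] loc_int_integrable[OF l1 order_refl] loc_int_integrable[OF l2 order_refl]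
      by (simp add: Henstock_Kurzweil_Integration.integral_diff Henstock_Kurzweil_Integration.integral_add Henstock_Kurzweil_Integration.integrable_diff)
    finally have inc: "lam * (cost ?F ?G T u - cost ?F ?G T w) = integral {0..T} (\<lambda>t. ?A t + (\<psi> t \<bullet> \<delta> t - \<zeta> t \<bullet> (y t - x t)))" .
    let ?D = "\<lambda>t. ham k lam (\<psi> t) t (x t) (u t) - ham k lam (\<psi> t) t (x t) (w t)"
    let ?E = "\<lambda>t. (2 * P * a * ?d) * (if u t \<noteq> w t then M t else 0) + (C0 * P * (a * ?d)\<^sup>2) * M t"
    have lD: "loc_int ?D" by (intro loc_int_diff lH u w)
    have lE: "loc_int ?E" by (intro loc_int_add loc_int_mult loc_int_deviation u w M)
    have "integral {0..T} (\<lambda>t. ?D t - ?E t) \<le> integral {0..T} (\<lambda>t. ?A t + (\<psi> t \<bullet> \<delta> t - \<zeta> t \<bullet> (y t - x t)))"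
    proof (rule integral_le)
      show "(\<lambda>t. ?D t - ?E t) integrable_on {0..T}" by (intro loc_int_integrable loc_int_diff lD lE order_refl)
      show "(\<lambda>t. ?A t + (\<psi> t \<bullet> \<delta> t - \<zeta> t \<bullet> (y t - x t))) integrable_on {0..T}"
        by (intro loc_int_integrable loc_int_add loc_int_diff lA l1 l2 order_refl)
      fix t assume "t \<in> {0..T}"
      then have t: "0 \<le> t" "t \<le> T" by auto
      note ut = selectorsD(1)[OF u t(1)] and wt = selectorsD(1)[OF w t(1)]
      define h where "h p z = \<psi> t \<bullet> f t z p + lam * g t z p" for p z
      have hs: "ham k lam (\<psi> t) t z p = smooth k (h p) z" if "p \<in> U t" for z p
        unfolding h_def by (rule ham_eq[OF kq e t(1) that])
      have hc: "continuous_on UNIV (h p)" if "p \<in> U t" for p unfolding h_def by (rule hf_cont[OF kq e t(1) that])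
      have hl: "\<bar>smooth k (h p) (y t) - smooth k (h p) (x t)\<bar> \<le> P * M t * (a * ?d)" if p: "p \<in> U t" for p
        unfolding real_norm_def[symmetric]
      proof (rule smooth_dist_le[OF kq hc[OF p] hc[OF p]])
        fix z :: 'x assume z: "norm z \<le> e"
        have "norm (y t + z) \<le> radius m t + 2" "norm (x t + z) \<le> radius m t + 2"
          using norm_triangle_ineq[of "y t" z] norm_triangle_ineq[of "x t" z] z e xb[OF t(1)] yb[OF t(1)] by linarith+
        then have "\<bar>h p (y t + z) - h p (x t + z)\<bar> \<le> (norm (\<psi> t) + \<bar>lam\<bar>) * M t * norm (y t + z - (x t + z))"
          unfolding h_def by (rule hf_lip[OF kq e t(1) p])
        also have "\<dots> \<le> P * M t * (a * ?d)"
          using P[OF t] dist[OF t] M_nonneg[OF t(1)] P1 by (intro mult_mono) auto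
        finally show "norm (h p (y t + z) - h p (x t + z)) \<le> P * M t * (a * ?d)" by simp
      qed
      have so: "\<bar>smooth k (h (w t)) (y t) - smooth k (h (w t)) (x t) - \<zeta> t \<bullet> (y t - x t)\<bar> \<le> C0 * (P * M t) * (norm (y t - x t))\<^sup>2"
        unfolding \<zeta>_def ham_grad_def[OF kq e] h_def[symmetric]
      proof (rule C0(2)[OF hc[OF wt] _ xb[OF t(1)] yb[OF t(1)]])
        show "radius m t \<le> \<rho>" unfolding \<rho>_def by (rule radius_mono[OF m t])
        fix z :: 'x assume "norm z \<le> radius m t + e"
        then have z: "norm z \<le> radius m t + 2" using e by linarith
        have "\<bar>h (w t) z\<bar> \<le> \<bar>\<psi> t \<bullet> f t z (w t)\<bar> + \<bar>lam * g t z (w t)\<bar>" unfolding h_def by (rule abs_triangle_ineq)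
        also have "\<dots> \<le> norm (\<psi> t) * M t + \<bar>lam\<bar> * M t" unfolding abs_mult
          by (intro add_mono order_trans[OF Cauchy_Schwarz_ineq2] mult_left_mono f_bound[OF t(1) wt z] g_bound[OF t(1) wt z]) auto
        also have "\<dots> \<le> P * M t" using mult_right_mono[OF P[OF t] M_nonneg[OF t(1)]] by (simp add: algebra_simps)
        finally show "\<bar>h (w t) z\<bar> \<le> P * M t" .
      qed
      also have "C0 * (P * M t) * (norm (y t - x t))\<^sup>2 \<le> C0 * (P * M t) * (a * ?d)\<^sup>2"
        using C0(1) P1 M_nonneg[OF t(1)] dist[OF t] by (intro mult_left_mono power_mono) auto
      finally have so': "smooth k (h (w t)) (y t) - smooth k (h (w t)) (x t) - \<zeta> t \<bullet> (y t - x t) \<ge> - ((C0 * P * (a * ?d)\<^sup>2) * M t)"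
        by (simp add: abs_le_iff mult_ac)
      \<comment> \<open>the mixed difference vanishes where the controls agree; elsewhere, on a set whose weighted measure is the deviation, it is of first order in the deviation\<close>
      have cross: "(smooth k (h (u t)) (y t) - smooth k (h (w t)) (y t)) - (smooth k (h (u t)) (x t) - smooth k (h (w t)) (x t))
          \<ge> - ((2 * P * a * ?d) * (if u t \<noteq> w t then M t else 0))"
      proof (cases "u t = w t")
        case False
        have "(smooth k (h (u t)) (y t) - smooth k (h (w t)) (y t)) - (smooth k (h (u t)) (x t) - smooth k (h (w t)) (x t))
            \<ge> - (2 * (P * M t * (a * ?d)))"
          using hl[OF ut] hl[OF wt] unfolding abs_le_iff by linarith
        then show ?thesis using False by (simp add: mult_ac)
      qed simp
      have "?A t + (\<psi> t \<bullet> \<delta> t - \<zeta> t \<bullet> (y t - x t)) = ham k lam (\<psi> t) t (y t) (u t) - ham k lam (\<psi> t) t (x t) (w t) - \<zeta> t \<bullet> (y t - x t)"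
        by (simp add: ham_def[OF kq e] \<delta>_def inner_diff_right algebra_simps)
      then have eq: "?A t + (\<psi> t \<bullet> \<delta> t - \<zeta> t \<bullet> (y t - x t)) = smooth k (h (u t)) (y t) - smooth k (h (w t)) (x t) - \<zeta> t \<bullet> (y t - x t)"
        by (simp add: hs[OF ut] hs[OF wt])
      have "?D t = smooth k (h (u t)) (x t) - smooth k (h (w t)) (x t)" by (simp add: hs[OF ut] hs[OF wt])
      then show "?D t - ?E t \<le> ?A t + (\<psi> t \<bullet> \<delta> t - \<zeta> t \<bullet> (y t - x t))"
        unfolding eq using so' cross by linarith
    qed
    moreover have "integral {0..T} (\<lambda>t. ?D t - ?E t) = integral {0..T} ?D - integral {0..T} ?E"
      by (rule Henstock_Kurzweil_Integration.integral_diff) (intro loc_int_integrable lD lE order_refl)+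
    moreover have "integral {0..T} ?E = (2 * P * a * ?d) * ?d + (C0 * P * (a * ?d)\<^sup>2) * integral {0..T} M"
      unfolding deviation_def
      using loc_int_integrable[OF loc_int_mult[OF loc_int_deviation[OF u w]] order_refl] loc_int_integrable[OF loc_int_mult[OF M(1)] order_refl]
      by (subst Henstock_Kurzweil_Integration.integral_add) auto
    moreover have "(2 * P * a * ?d) * ?d + (C0 * P * (a * ?d)\<^sup>2) * integral {0..T} M = C * ?d\<^sup>2"
      by (simp add: C_def power2_eq_square algebra_simps)
    ultimately show "integral {0..T} ?D - C * ?d\<^sup>2 \<le> lam * (cost ?F ?G T u - cost ?F ?G T w)"
      using inc by simp
  qed
qed

text \<open>If the Hamiltonian gap exceeded the bound on a set of weighted measure larger than \<open>\<kappa>\<close>, then switching to \<open>v\<close> on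
  a part of measure exactly \<open>\<kappa>\<close> would contradict the near-maximality of \<open>w\<close>: the gain is linear in \<open>\<kappa>\<close>,
  and the error of the expansion is quadratic.\<close>

lemma hamiltonian_gap:
  assumes T: "0 \<le> T" and \<sigma>: "0 < \<sigma>" and \<kappa>: "0 < \<kappa>"
    and w: "w \<in> selectors U" and x: "trajectory (mollify k f) w x" and adj: "adjoint q T w x lam \<psi>" and v: "v \<in> selectors U"
    and C: "C * \<kappa> \<le> \<sigma> / 2" "0 \<le> C"
    and inc: "\<And>u. u \<in> selectors U \<Longrightarrow>
      integral {0..T} (\<lambda>t. ham k lam (\<psi> t) t (x t) (u t) - ham k lam (\<psi> t) t (x t) (w t)) - C * (deviation u w T)\<^sup>2
        \<le> lam * (cost (mollify k f) (mollify k g) T u - cost (mollify k f) (mollify k g) T w)"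
    and near: "\<And>u. u \<in> selectors U \<Longrightarrow> cost (mollify k f) (mollify k g) T u \<le>
        cost (mollify k f) (mollify k g) T w + \<sigma> * deviation u w T + \<sigma> * \<kappa> / 2"
  shows "integral {0..T} (\<lambda>t. if 3 * \<sigma> * M t < ham k lam (\<psi> t) t (x t) (v t) - ham k lam (\<psi> t) t (x t) (w t) then M t else 0) \<le> \<kappa>"
proof (rule ccontr)
  let ?F = "mollify k f" and ?G = "mollify k g"
  let ?D = "\<lambda>v t. ham k lam (\<psi> t) t (x t) (v t) - ham k lam (\<psi> t) t (x t) (w t)"
  note rF = regular_mollify[OF kq e] and \<psi> = adjointD[OF kq e adj]
  note xb = trajectory_bound[OF rF w x]
  have lH: "loc_int (\<lambda>t. ham k lam (\<psi> t) t (x t) (v t))" if "v \<in> selectors U" for v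
    by (rule loc_int_ham_along[OF kq e \<psi>(3) that trajectoryD(1)[OF x] xb])
  have lD: "loc_int (?D v)" if "v \<in> selectors U" for v by (intro loc_int_diff lH that w)
  define B where "B t \<longleftrightarrow> 3 * \<sigma> * M t < ?D v t" for t
  have mB: "{t\<in>{0..}. B t} \<in> sets (lebesgue_on {0..})"
  proof -
    have "{t\<in>space (lebesgue_on {0..}). 3 * \<sigma> * M t < ?D v t} \<in> sets (lebesgue_on {0..})"
      using loc_int_measurable[OF loc_int_mult[OF M(1), of "3 * \<sigma>"]] loc_int_measurable[OF lD[OF v]] by (rule borel_measurable_less)
    then show ?thesis by (simp add: B_def)
  qed
  define \<beta> where "\<beta> s = integral {0..s} (\<lambda>t. if B t then M t else 0)" for s
  have lB: "loc_int (\<lambda>t. if B t then M t else 0)" by (rule loc_int_if[OF mB M(1)])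
  assume "\<not> ?thesis"
  then have "\<kappa> < \<beta> T" by (simp add: \<beta>_def B_def)
  moreover have "\<beta> 0 = 0" by (simp add: \<beta>_def)
  moreover have "continuous_on {0..T} \<beta>"
    using continuous_indefinite_integral[OF lB] unfolding \<beta>_def by (rule continuous_on_subset) auto
  \<comment> \<open>the weighted measure of the bad set grows continuously with time, so a part of size exactly \<open>\<kappa>\<close> can be cut out\<close>
  ultimately obtain s where s: "0 \<le> s" "s \<le> T" "\<beta> s = \<kappa>" using IVT'[of \<beta> 0 \<kappa> T] T \<kappa> by auto
  define A where "A t \<longleftrightarrow> 0 \<le> t \<and> t \<le> s \<and> B t" for t
  have mA: "{t\<in>{0..}. A t} \<in> sets (lebesgue_on {0..})"
  proof -
    have "{t\<in>{0..}. A t} = {t\<in>{0..}. B t} \<inter> {0..s}" by (auto simp: A_def)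
    moreover have "{0..s} \<in> sets (lebesgue_on {0..})" by (auto simp: sets_restrict_space)
    ultimately show ?thesis using mB by auto
  qed
  have IA: "integral {0..T} (\<lambda>t. if A t then h t else 0) = integral {0..s} (\<lambda>t. if B t then h t else 0)" for h :: "real \<Rightarrow> real"
  proof -
    have "integral {0..T} (\<lambda>t. if A t then h t else 0) = integral {0..T} (\<lambda>t. if t \<in> {0..s} then (if B t then h t else 0) else 0)"
      by (rule Henstock_Kurzweil_Integration.integral_cong) (simp add: A_def)
    also have "\<dots> = integral {0..s} (\<lambda>t. if B t then h t else 0)"
      unfolding integral_restrict_Int using s by (simp add: Int_absorb1)
    finally show ?thesis .
  qed
  define u1 where "u1 t = (if t \<in> {0..} then (if A t then v t else w t) else 0)" for t
  have "(\<lambda>t. if A t then v t else w t) \<in> borel_measurable (lebesgue_on {0..})"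
    using selectorsD(2)[OF v] selectorsD(2)[OF w] mA by (intro measurable_If) auto
  then have "u1 \<in> borel_measurable lebesgue" unfolding u1_def by (subst borel_measurable_if) auto
  then obtain N where N: "N \<in> null_sets lborel" 
    "\<And>c. c \<in> borel_measurable (restrict_space borel {0..}) \<Longrightarrow> (\<lambda>t. if t \<in> N then c t else u1 t) \<in> borel_measurable (restrict_space borel {0..})"
    using borel_modification by blast
  \<comment> \<open>the switched control is made Borel measurable by returning to \<open>w\<close> on a null set\<close>
  define u where "u t = (if t \<in> N then w t else u1 t)" for t
  have u: "u \<in> selectors U"
    using N(2)[of w] v w by (auto simp: selectors_def u_def[abs_def] u1_def)
  have neg: "negligible N" using N(1) by (simp add: negligible_iff_null_sets null_sets_completionI)
  have ueq: "u t = (if A t then v t else w t)" if "t \<in> {0..T} - N" for t using that by (simp add: u_def u1_def)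
  have dev: "deviation u w T \<le> \<kappa>"
  proof -
    have "deviation u w T \<le> integral {0..T} (\<lambda>t. if A t then M t else 0)"
      unfolding deviation_def
    proof (rule integral_le)
      show "(\<lambda>t. if u t \<noteq> w t then M t else 0) integrable_on {0..T}"
        by (rule loc_int_integrable[OF loc_int_deviation[OF u w] order_refl])
      show "(\<lambda>t. if A t then M t else 0) integrable_on {0..T}"
        by (rule loc_int_integrable[OF loc_int_if[OF mA M(1)] order_refl])
      show "(if u t \<noteq> w t then M t else 0) \<le> (if A t then M t else 0)" if "t \<in> {0..T}" for t
        using that M_nonneg[of t] by (simp add: u_def u1_def)
    qed
    then show ?thesis using s(3) IA[of M] by (simp add: \<beta>_def)
  qed
  have dev0: "0 \<le> deviation u w T" by (rule deviation_nonneg[OF u w])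
  have "3 * \<sigma> * \<kappa> = integral {0..T} (\<lambda>t. 3 * \<sigma> * (if A t then M t else 0))"
    using s(3) IA[of M] by (simp add: \<beta>_def)
  also have "\<dots> \<le> integral {0..T} (\<lambda>t. if A t then ?D v t else 0)"
  proof (rule integral_le)
    show "(\<lambda>t. 3 * \<sigma> * (if A t then M t else 0)) integrable_on {0..T}"
      by (intro loc_int_integrable loc_int_mult loc_int_if[OF mA M(1)] order_refl)
    show "(\<lambda>t. if A t then ?D v t else 0) integrable_on {0..T}"
      by (intro loc_int_integrable loc_int_if[OF mA lD[OF v]] order_refl)
    show "3 * \<sigma> * (if A t then M t else 0) \<le> (if A t then ?D v t else 0)" for t
      by (auto simp: A_def B_def)
  qed
  also have "\<dots> = integral {0..T} (?D u)"
    by (rule integral_spike[OF neg]) (simp add: ueq)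
  finally have gain: "3 * \<sigma> * \<kappa> \<le> integral {0..T} (?D u)" .
  have "C * (deviation u w T)\<^sup>2 \<le> C * \<kappa>\<^sup>2" using dev dev0 C(2) by (intro mult_left_mono power_mono)
  also have "\<dots> \<le> \<sigma> / 2 * \<kappa>" using mult_right_mono[OF C(1), of \<kappa>] \<kappa> by (simp add: power2_eq_square mult_ac)
  finally have "3 * \<sigma> * \<kappa> - \<sigma> / 2 * \<kappa> \<le> lam * (cost ?F ?G T u - cost ?F ?G T w)" using gain inc[OF u] by linarith
  also have "\<dots> \<le> lam * (\<sigma> * deviation u w T + \<sigma> * \<kappa> / 2)" using near[OF u] \<psi>(1) by (intro mult_left_mono) auto
  also have "\<dots> \<le> 1 * (\<sigma> * \<kappa> + \<sigma> * \<kappa> / 2)" using \<psi>(1,7) dev dev0 \<sigma> \<kappa> by (intro mult_mono add_mono mult_left_mono) auto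
  finally have "\<sigma> * \<kappa> \<le> 0" by (simp add: algebra_simps)
  then show False using \<sigma> \<kappa> by (simp add: mult_le_0_iff)
qed

end

text \<open>Let \<open>w\<close> be nearly maximal for the mollified cost minus \<open>\<sigma>\<close> times the deviation from \<open>u0\<close>. Comparison with \<open>u0\<close> shows
  that \<open>w\<close> is near \<open>u0\<close>, and by the triangle inequality no control beats \<open>w\<close> by more than \<open>\<sigma>\<close> times its
  deviation from \<open>w\<close>, plus a slack. This resembles Ekeland's variational principle; the slack \<open>\<sigma> * \<kappa> / 2\<close> is harmless
  because the variations of \<open>w\<close> that are used have the fixed size \<open>\<kappa>\<close>.\<close>

lemma finite_horizon:
  assumes T: "0 \<le> T" and \<sigma>: "0 < \<sigma>" and \<kappa>0: "0 < \<kappa>0" and \<epsilon>0: "0 < \<epsilon>0" "\<epsilon>0 \<le> 1" and u0: "u0 \<in> selectors U"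
    and opt: "\<And>u. u \<in> selectors U \<Longrightarrow> cost f g T u \<le> cost f g T u0 + \<sigma>\<^sup>2"
  obtains e k q w x lam \<psi> where "0 < e" "e \<le> \<epsilon>0" "mollifier e k q" "w \<in> selectors U" "trajectory (mollify k f) w x"
    "deviation w u0 T \<le> 3 * \<sigma>" "adjoint q T w x lam \<psi>"
    "\<And>v. v \<in> selectors U \<Longrightarrow> integral {0..T} (\<lambda>t. if 3 * \<sigma> * M t < 
        ham k lam (\<psi> t) t (x t) (v t) - ham k lam (\<psi> t) t (x t) (w t) then M t else 0) \<le> \<kappa>0"
proof -
  define c where "c = (1 + 2 * integral {0..T} m * growth m T) * integral {0..T} M"
  have c0: "0 \<le> c" unfolding c_def
    using integral_nonneg[OF loc_int_integrable[OF M(1) order_refl], of T] M_nonneg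
      integral_nonneg[OF loc_int_integrable[OF m(1) order_refl], of T] m(2) by (auto simp: less_imp_le)
  \<comment> \<open>mollification at this scale changes the cost by at most \<open>\<sigma>\<^sup>2 / 2\<close>\<close>
  define e where "e = min \<epsilon>0 (\<sigma>\<^sup>2 / (2 * (c + 1)))"
  have e: "0 < e" "e \<le> \<epsilon>0" "e \<le> 1" using \<epsilon>0 \<sigma> c0 by (auto simp: e_def)
  have ec: "e * c \<le> \<sigma>\<^sup>2 / 2"
  proof -
    have "e * c \<le> \<sigma>\<^sup>2 / (2 * (c + 1)) * (c + 1)" using c0 by (intro mult_mono) (auto simp: e_def)
    also have "\<dots> = \<sigma>\<^sup>2 / 2" using c0 by (simp add: field_simps)
    finally show ?thesis .
  qed
  obtain k :: "'x \<Rightarrow> real" and q where kq: "mollifier e k q" using mollifier_exists[OF e(1)] by blast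
  let ?J = "cost (mollify k f) (mollify k g) T"
  have J: "?J u \<le> ?J u0 + 2 * \<sigma>\<^sup>2" if "u \<in> selectors U" for u
  proof -
    have "\<bar>?J u - cost f g T u\<bar> \<le> \<sigma>\<^sup>2 / 2" "\<bar>?J u0 - cost f g T u0\<bar> \<le> \<sigma>\<^sup>2 / 2"
      by (rule order_trans[OF cost_mollify_near[OF kq e(1,3) _ T] ec[unfolded c_def]], fact that u0)+
    then show ?thesis using opt[OF that] by linarith
  qed
  obtain C where C: "0 \<le> C"
    "\<And>w x lam \<psi> u. \<lbrakk>w \<in> selectors U; trajectory (mollify k f) w x; adjoint q T w x lam \<psi>; u \<in> selectors U\<rbrakk> \<Longrightarrow>
      integral {0..T} (\<lambda>t. ham k lam (\<psi> t) t (x t) (u t) - ham k lam (\<psi> t) t (x t) (w t)) - C * (deviation u w T)\<^sup>2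
        \<le> lam * (?J u - ?J w)"
    by (rule cost_increment[OF kq e(1,3) T]) (rule that)
  \<comment> \<open>variations of this size have an error \<open>C * \<kappa>\<^sup>2\<close> of at most \<open>\<sigma> * \<kappa> / 2\<close>\<close>
  define \<kappa> where "\<kappa> = min \<kappa>0 (min \<sigma> (\<sigma> / (2 * (C + 1))))"
  have \<kappa>: "0 < \<kappa>" "\<kappa> \<le> \<kappa>0" "\<kappa> \<le> \<sigma>" using \<kappa>0 \<sigma> C(1) by (auto simp: \<kappa>_def)
  have C\<kappa>: "C * \<kappa> \<le> \<sigma> / 2"
  proof -
    have "C * \<kappa> \<le> (C + 1) * (\<sigma> / (2 * (C + 1)))" using C(1) \<kappa>(1) by (intro mult_mono) (auto simp: \<kappa>_def)
    also have "\<dots> = \<sigma> / 2" using C(1) by (simp add: field_simps)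
    finally show ?thesis .
  qed
  define Z where "Z = (\<lambda>u. ?J u - \<sigma> * deviation u u0 T) ` selectors U"
  have Z: "Z \<noteq> {}" "bdd_above Z" 
  proof -
    show "Z \<noteq> {}" using u0 by (auto simp: Z_def)
    show "bdd_above Z" unfolding Z_def
    proof (rule bdd_aboveI2)
      fix u assume u: "u \<in> selectors U"
      have "0 \<le> \<sigma> * deviation u u0 T" using \<sigma> deviation_nonneg[OF u u0] by simp
      then show "?J u - \<sigma> * deviation u u0 T \<le> ?J u0 + 2 * \<sigma>\<^sup>2" using J[OF u] by linarith
    qed
  qed
  have "Sup Z - \<sigma> * \<kappa> / 2 < Sup Z" using \<sigma> \<kappa> by simp
  then obtain w where w: "w \<in> selectors U" "Sup Z - \<sigma> * \<kappa> / 2 < ?J w - \<sigma> * deviation w u0 T"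
    using less_cSupE[OF _ Z(1)] unfolding Z_def by blast
  have wmax: "?J u - \<sigma> * deviation u u0 T \<le> ?J w - \<sigma> * deviation w u0 T + \<sigma> * \<kappa> / 2" if "u \<in> selectors U" for u
  proof -
    have "?J u - \<sigma> * deviation u u0 T \<le> Sup Z" using that Z(2) by (intro cSup_upper) (auto simp: Z_def)
    then show ?thesis using w(2) by linarith
  qed
  have near: "?J u \<le> ?J w + \<sigma> * deviation u w T + \<sigma> * \<kappa> / 2" if u: "u \<in> selectors U" for u
  proof -
    have "\<sigma> * deviation u u0 T \<le> \<sigma> * (deviation u w T + deviation w u0 T)"
      using deviation_triangle[OF u w(1) u0] \<sigma> by (intro mult_left_mono) auto
    then show ?thesis using wmax[OF u] by (simp add: algebra_simps)
  qed
  have dev: "deviation w u0 T \<le> 3 * \<sigma>"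
  proof -
    have "deviation u0 u0 T = 0" by (simp add: deviation_def)
    then have "\<sigma> * deviation w u0 T \<le> 2 * \<sigma>\<^sup>2 + \<sigma> * \<kappa> / 2" using wmax[OF u0] J[OF w(1)] by simp
    also have "\<dots> \<le> \<sigma> * (3 * \<sigma>)" using mult_left_mono[OF \<kappa>(3), of \<sigma>] \<sigma> by (simp add: power2_eq_square)
    finally show ?thesis using \<sigma> by simp
  qed
  obtain x where x: "trajectory (mollify k f) w x" using trajectory_exists[OF regular_mollify[OF kq e(1,3)] w(1)] by blast
  obtain lam \<psi> where adj: "adjoint q T w x lam \<psi>" using adjoint_exists[OF kq e(1,3) w(1) x T] by blast
  show ?thesis
  proof (rule that[OF e(1,2) kq w(1) x dev adj])
    fix v assume v: "v \<in> selectors U"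
    show "integral {0..T} (\<lambda>t. if 3 * \<sigma> * M t < 
        ham k lam (\<psi> t) t (x t) (v t) - ham k lam (\<psi> t) t (x t) (w t) then M t else 0) \<le> \<kappa>0"
      using hamiltonian_gap[OF kq e(1,3) T \<sigma> \<kappa>(1) w(1) x adj v C\<kappa> C(1) C(2)[OF w(1) x adj] near] \<kappa>(2) by linarith
  qed
qed

end

section \<open>Almost everywhere limits of convex combinations\<close>

text \<open>Dyadic convex combinations of the terms from the \<open>n\<close>-th on. Midpoints are what the parallelogram law needs,
  and properties that are stable under midpoints are inherited from the terms by induction.\<close>

inductive_set midpoint_combinations :: "(nat \<Rightarrow> real \<Rightarrow> 'e::real_vector) \<Rightarrow> nat \<Rightarrow> (real \<Rightarrow> 'e) set"
  for z n where
    base: "n \<le> k \<Longrightarrow> z k \<in> midpoint_combinations z n"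
  | midpoint: "a \<in> midpoint_combinations z n \<Longrightarrow> b \<in> midpoint_combinations z n \<Longrightarrow>
      (\<lambda>t. (1/2) *\<^sub>R (a t + b t)) \<in> midpoint_combinations z n"

lemma midpoint_combinations_antimono:
  assumes "n \<le> k" "a \<in> midpoint_combinations z k"
  shows "a \<in> midpoint_combinations z n"
  using assms(2) by induction (use assms(1) in \<open>auto intro: midpoint_combinations.intros\<close>)

text \<open>Among the midpoint combinations of the tails, those of almost minimal norm form a Cauchy sequence in mean square, by the
  parallelogram law.\<close>

lemma midpoint_combinations_AE_convergent:
  fixes z :: "nat \<Rightarrow> real \<Rightarrow> 'e::euclidean_space"
  assumes fin: "finite_measure \<nu>" and z: "\<And>n. z n \<in> borel_measurable \<nu>" "\<And>n t. t \<in> space \<nu> \<Longrightarrow> norm (z n t) \<le> 1"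
  obtains a r where "\<And>n. a n \<in> midpoint_combinations z n" "strict_mono r" "AE t in \<nu>. Cauchy (\<lambda>i. a (r i) t)"
proof -
  interpret finite_measure \<nu> by (rule fin)
  define I where "I h = (\<integral>t. (norm (h t))\<^sup>2 \<partial>\<nu>)" for h :: "real \<Rightarrow> 'e"
  have meas: "a \<in> borel_measurable \<nu>" and bnd: "t \<in> space \<nu> \<Longrightarrow> norm (a t) \<le> 1"
    if "a \<in> midpoint_combinations z n" for a n t
  proof -
    have "a \<in> borel_measurable \<nu> \<and> (\<forall>t\<in>space \<nu>. norm (a t) \<le> 1)"
      using that
    proof induction
      case (midpoint a b)
      have "norm ((1/2) *\<^sub>R (a t + b t)) \<le> 1" if "t \<in> space \<nu>" for t
      proof -
        have "norm (a t + b t) \<le> norm (a t) + norm (b t)" by (rule norm_triangle_ineq)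
        then show ?thesis using midpoint that by fastforce
      qed
      then show ?case using midpoint by (auto intro!: borel_measurable_scaleR borel_measurable_add)
    qed (use z in auto)
    then show "a \<in> borel_measurable \<nu>" "t \<in> space \<nu> \<Longrightarrow> norm (a t) \<le> 1" by auto
  qed
  have int: "integrable \<nu> (\<lambda>t. (norm (h t))\<^sup>2)" if "h \<in> borel_measurable \<nu>" "\<And>t. t \<in> space \<nu> \<Longrightarrow> norm (h t) \<le> c" for h :: "real \<Rightarrow> 'e" and c
  proof (rule integrable_const_bound[of _ "c\<^sup>2"])
    show "AE t in \<nu>. norm ((norm (h t))\<^sup>2) \<le> c\<^sup>2" using that(2) by (intro AE_I2) (auto intro: power_mono)
    show "(\<lambda>t. (norm (h t))\<^sup>2) \<in> borel_measurable \<nu>" using that(1) by measurable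
  qed
  have I0: "0 \<le> I h" for h by (simp add: I_def)
  define \<beta> where "\<beta> n = (INF a\<in>midpoint_combinations z n. I a)" for n
  have ne: "midpoint_combinations z n \<noteq> {}" for n using midpoint_combinations.base[of n n z] by auto
  have bb: "bdd_below (I ` A)" for A by (rule bdd_belowI2) (rule I0)
  have \<beta>le: "\<beta> n \<le> I a" if "a \<in> midpoint_combinations z n" for a n
    unfolding \<beta>_def using that by (rule cINF_lower[OF bb])
  define iv where "iv n = inverse (real (Suc n))" for n
  have ivm: "iv k \<le> iv n" if "n \<le> k" for n k
    unfolding iv_def by (rule le_imp_inverse_le) (use that in auto)
  have "\<exists>a. a \<in> midpoint_combinations z n \<and> I a < \<beta> n + iv n" for n
  proof -
    have "(INF a\<in>midpoint_combinations z n. I a) < \<beta> n + iv n" by (simp add: \<beta>_def iv_def)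
    then show ?thesis using cINF_less_iff[OF ne bb] by blast
  qed
  then obtain a where a: "\<And>n. a n \<in> midpoint_combinations z n" "\<And>n. I (a n) < \<beta> n + iv n" by metis
  have \<beta>mono: "incseq \<beta>" unfolding incseq_def
  proof (intro allI impI)
    fix n k :: nat assume "n \<le> k"
    then show "\<beta> n \<le> \<beta> k" unfolding \<beta>_def
      by (intro cINF_superset_mono[OF ne bb]) (auto intro: midpoint_combinations_antimono)
  qed
  have \<beta>bd: "\<beta> n \<le> measure \<nu> (space \<nu>)" for n
  proof -
    have "I (z n) \<le> (\<integral>t. 1 \<partial>\<nu>)" unfolding I_def
      by (rule integral_mono[OF int[OF z(1) z(2)]]) (use z(2) in \<open>auto simp: power_le_one\<close>)
    moreover have "\<beta> n \<le> I (z n)" by (rule \<beta>le[OF midpoint_combinations.base[OF order_refl]])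
    moreover have "(\<integral>t. 1 \<partial>\<nu>) = measure \<nu> (space \<nu>)" by simp
    ultimately show ?thesis by linarith
  qed
  obtain L where L: "\<beta> \<longlonglongrightarrow> L" "\<And>n. \<beta> n \<le> L" using incseq_convergent[OF \<beta>mono, of "measure \<nu> (space \<nu>)"] \<beta>bd by auto
  have diff: "I (\<lambda>t. a n t - a k t) \<le> 2 * (L - \<beta> n) + 4 * iv n" if nk: "n \<le> k" for n k
  proof -
    have ak: "a k \<in> midpoint_combinations z n" using midpoint_combinations_antimono[OF nk a(1)] .
    let ?m = "\<lambda>t. (1/2) *\<^sub>R (a n t + a k t)"
    have mid: "\<beta> n \<le> I ?m" by (rule \<beta>le[OF midpoint_combinations.midpoint[OF a(1) ak]])
    have i1: "integrable \<nu> (\<lambda>t. (norm (a n t))\<^sup>2)" and i2: "integrable \<nu> (\<lambda>t. (norm (a k t))\<^sup>2)"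
      and i3: "integrable \<nu> (\<lambda>t. (norm (?m t))\<^sup>2)"
      using int[OF meas[OF a(1)] bnd[OF a(1)], of n] int[OF meas[OF ak] bnd[OF ak]]
        int[OF meas[OF midpoint_combinations.midpoint[OF a(1) ak]] bnd[OF midpoint_combinations.midpoint[OF a(1) ak]]] by simp_all
    have "(norm (a n t - a k t))\<^sup>2 = 2 * (norm (a n t))\<^sup>2 + 2 * (norm (a k t))\<^sup>2 - 4 * (norm (?m t))\<^sup>2" for t
      by (simp add: power2_norm_eq_inner inner_add inner_diff inner_commute power_mult_distrib algebra_simps)
    then have "I (\<lambda>t. a n t - a k t) = (\<integral>t. 2 * (norm (a n t))\<^sup>2 + 2 * (norm (a k t))\<^sup>2 - 4 * (norm (?m t))\<^sup>2 \<partial>\<nu>)"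
      by (simp add: I_def)
    also have "\<dots> = 2 * I (a n) + 2 * I (a k) - 4 * I ?m"
      unfolding I_def using i1 i2 i3
      by (subst Bochner_Integration.integral_diff; (subst Bochner_Integration.integral_add)?; auto)
    also have "\<dots> \<le> 2 * (\<beta> n + iv n) + 2 * (\<beta> k + iv k) - 4 * \<beta> n"
      using a(2)[of n] a(2)[of k] mid by (simp add: algebra_simps)
    also have "\<dots> \<le> 2 * (L - \<beta> n) + 4 * iv n"
      using L(2)[of k] ivm[OF nk] by (simp add: algebra_simps)
    finally show ?thesis .
  qed
  have dm: "(\<lambda>t. a i t - a j t) \<in> borel_measurable \<nu>" for i j using meas[OF a(1)] by (intro borel_measurable_diff)
  have db: "norm (a i t - a j t) \<le> 2" if "t \<in> space \<nu>" for i j t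
    using norm_triangle_ineq4[of "a i t" "a j t"] bnd[OF a(1) that, of i] bnd[OF a(1) that, of j] by linarith
  have ai: "integrable \<nu> (a n)" for n
    by (rule integrable_const_bound[of _ 1]) (use meas[OF a(1)] bnd[OF a(1)] in \<open>auto intro!: AE_I2\<close>)
  have cauchy: "\<exists>N. \<forall>i\<ge>N. \<forall>j\<ge>N. (\<integral>t. norm (a i t - a j t) \<partial>\<nu>) < \<epsilon>" if \<epsilon>: "\<epsilon> > 0" for \<epsilon>
  proof -
    define \<delta> where "\<delta> = \<epsilon> / (2 * (measure \<nu> (space \<nu>) + 1))"
    have \<delta>: "\<delta> > 0" using \<epsilon> by (simp add: \<delta>_def add_nonneg_pos)
    have "(\<lambda>n. 2 * (L - \<beta> n) + 4 * iv n) \<longlonglongrightarrow> 2 * (L - L) + 4 * 0"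
      unfolding iv_def by (intro tendsto_intros L LIMSEQ_inverse_real_of_nat)
    then have "(\<lambda>n. 2 * (L - \<beta> n) + 4 * iv n) \<longlonglongrightarrow> 0" by simp
    then have "\<forall>\<^sub>F n in sequentially. 2 * (L - \<beta> n) + 4 * iv n < \<delta> * \<epsilon> / 2"
      using \<delta> \<epsilon> by (intro order_tendstoD(2)) auto
    then obtain N where N: "\<And>n. N \<le> n \<Longrightarrow> 2 * (L - \<beta> n) + 4 * iv n < \<delta> * \<epsilon> / 2"
      unfolding eventually_sequentially by blast
    have le: "(\<integral>t. norm (a i t - a j t) \<partial>\<nu>) < \<epsilon>" if ij: "N \<le> i" "i \<le> j" for i j
    proof -
      have i2: "integrable \<nu> (\<lambda>t. (norm (a i t - a j t))\<^sup>2)" by (rule int[OF dm db])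
      have "(\<integral>t. norm (a i t - a j t) \<partial>\<nu>) \<le> (\<integral>t. \<delta> + (norm (a i t - a j t))\<^sup>2 / \<delta> \<partial>\<nu>)"
      proof (rule integral_mono)
        show "integrable \<nu> (\<lambda>t. norm (a i t - a j t))" by (intro integrable_norm Bochner_Integration.integrable_diff ai)
        show "integrable \<nu> (\<lambda>t. \<delta> + (norm (a i t - a j t))\<^sup>2 / \<delta>)" using i2 by (intro Bochner_Integration.integrable_add) auto
        fix t
        \<comment> \<open>this bounds the mean by the mean square\<close>
        have "x \<le> \<delta> + x\<^sup>2 / \<delta>" if "0 \<le> x" for x :: real
        proof (cases "x \<le> \<delta>")
          case True then show ?thesis using \<delta> by (simp add: add_increasing2)
        next
          case False
          then have "x * \<delta> \<le> x * x" using that by (intro mult_left_mono) auto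
          then have "x \<le> x\<^sup>2 / \<delta>" using \<delta> by (simp add: pos_le_divide_eq power2_eq_square)
          then show ?thesis using \<delta> by linarith
        qed
        then show "norm (a i t - a j t) \<le> \<delta> + (norm (a i t - a j t))\<^sup>2 / \<delta>" by simp
      qed
      also have "\<dots> = \<delta> * measure \<nu> (space \<nu>) + I (\<lambda>t. a i t - a j t) / \<delta>"
        unfolding I_def using i2 by (subst Bochner_Integration.integral_add) auto
      also have "I (\<lambda>t. a i t - a j t) / \<delta> < (\<delta> * \<epsilon> / 2) / \<delta>"
        using diff[OF ij(2)] N[OF ij(1)] \<delta> by (intro divide_strict_right_mono) auto
      also have "(\<delta> * \<epsilon> / 2) / \<delta> = \<epsilon> / 2" using \<delta> by simp
      also have "\<delta> * measure \<nu> (space \<nu>) \<le> \<epsilon> / 2"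
      proof -
        have "\<delta> * measure \<nu> (space \<nu>) \<le> \<delta> * (measure \<nu> (space \<nu>) + 1)" using \<delta> by simp
        also have "\<dots> = \<epsilon> / 2" 
        proof -
          have "\<epsilon> / (2 * x) * x = \<epsilon> / 2" if "0 < x" for x :: real using that by simp
          from this[OF add_nonneg_pos[OF measure_nonneg[of \<nu> "space \<nu>"] zero_less_one]]
          show ?thesis unfolding \<delta>_def .
        qed
        finally show ?thesis .
      qed
      finally show ?thesis by simp
    qed
    show ?thesis
    proof (intro exI[of _ N] allI impI)
      fix i j assume ij: "N \<le> i" "N \<le> j"
      show "(\<integral>t. norm (a i t - a j t) \<partial>\<nu>) < \<epsilon>"
      proof (cases "i \<le> j")
        case False
        then have "(\<integral>t. norm (a j t - a i t) \<partial>\<nu>) < \<epsilon>" using le ij by simp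
        then show ?thesis by (simp add: norm_minus_commute)
      qed (use le ij in simp)
    qed
  qed
  obtain r where "strict_mono r" "AE t in \<nu>. Cauchy (\<lambda>i. a (r i) t)"
    using cauchy_L1_AE_cauchy_subseq[OF ai cauchy] by blast
  then show ?thesis using that a(1) by blast
qed

text \<open>Weak compactness without loss of pointwise information: midpoint combinations of late terms have nearly the limit of the
  primitives as their primitive, and where they converge, their limit inherits each linear inequality of all late terms.\<close>

lemma limit_of_primitives:
  fixes \<zeta> :: "nat \<Rightarrow> real \<Rightarrow> 'e::euclidean_space"
  assumes \<zeta>: "\<And>n. loc_int (\<zeta> n)" and N: "loc_int N" and le: "\<And>n t. 0 \<le> t \<Longrightarrow> norm (\<zeta> n t) \<le> N t"
    and lim: "\<And>t. 0 \<le> t \<Longrightarrow> (\<lambda>n. integral {0..t} (\<zeta> n)) \<longlonglongrightarrow> \<Psi> t"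
  obtains \<phi> where "loc_int \<phi>" "\<And>t. 0 \<le> t \<Longrightarrow> \<Psi> t = integral {0..t} \<phi>"
    "AE t in lebesgue. 0 \<le> t \<longrightarrow> (\<forall>v c. (\<forall>\<^sub>F n in sequentially. \<zeta> n t \<bullet> v \<le> c) \<longrightarrow> \<phi> t \<bullet> v \<le> c)"
proof -
  have N0: "0 \<le> N t" if "0 \<le> t" for t using order_trans[OF norm_ge_zero le[OF that]] .
  \<comment> \<open>after division by \<open>N t + 1\<close>, which cannot vanish, all terms lie in the unit ball\<close>
  define z where "z n t = \<zeta> n t /\<^sub>R (N t + 1)" for n t
  \<comment> \<open>a finite measure on the half-line with the same null sets as Lebesgue measure\<close>
  define \<nu> where "\<nu> = density (lebesgue_on {0..}) (\<lambda>t. ennreal (exp (- t :: real)))"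
  have space\<nu>: "space \<nu> = {0..}" and sets\<nu>: "sets \<nu> = sets (lebesgue_on {0..})" by (simp_all add: \<nu>_def)
  have expi: "integrable (lebesgue_on {0..}) (\<lambda>t::real. exp (- t))"
  proof -
    have "(\<lambda>t::real. exp (- t)) absolutely_integrable_on {0..}"
      using integrable_on_exp_minus_to_infinity[of 1 0] by (intro nonnegative_absolutely_integrable_1) auto
    then show ?thesis by (simp add: set_integrable_def integrable_restrict_space)
  qed
  have fin: "finite_measure \<nu>"
  proof
    have "emeasure \<nu> (space \<nu>) = (\<integral>\<^sup>+t. ennreal (exp (- t)) \<partial>lebesgue_on {0..})"
      unfolding \<nu>_def using expi by (subst emeasure_density) (auto intro!: nn_integral_cong simp: borel_measurable_integrable)
    also have "\<dots> < \<infinity>" using expi by (simp add: integrable_iff_bounded)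
    finally show "emeasure \<nu> (space \<nu>) \<noteq> \<infinity>" by simp
  qed
  have zm: "z n \<in> borel_measurable (lebesgue_on {0..})" for n
    unfolding z_def using loc_int_measurable[OF \<zeta>, of n] loc_int_measurable[OF N] by measurable
  have zm\<nu>: "z n \<in> borel_measurable \<nu>" for n using zm[of n] sets\<nu> by (simp cong: measurable_cong_sets)
  have zb: "norm (z n t) \<le> 1" if "t \<in> space \<nu>" for n t
  proof -
    have t: "0 \<le> t" using that by (simp add: space\<nu>)
    have N1: "0 < N t + 1" using N0[OF t] by linarith
    have "norm (z n t) = inverse (N t + 1) * norm (\<zeta> n t)"
      unfolding z_def norm_scaleR by (simp only: abs_of_pos[OF positive_imp_inverse_positive[OF N1]])
    also have "\<dots> \<le> inverse (N t + 1) * (N t + 1)"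
      using le[OF t, of n] N1 by (intro mult_left_mono) auto
    also have "\<dots> = 1" using N1 by simp
    finally show ?thesis .
  qed
  obtain a r where a: "\<And>n. a n \<in> midpoint_combinations z n" and r: "strict_mono r" and C\<nu>: "AE t in \<nu>. Cauchy (\<lambda>i. a (r i) t)"
    by (rule midpoint_combinations_AE_convergent[where z=z, OF fin zm\<nu> zb], assumption) (rule that)
  have "AE t in lebesgue_on {0..}. Cauchy (\<lambda>i. a (r i) t)"
    using C\<nu> expi unfolding \<nu>_def by (subst (asm) AE_density) (auto simp: borel_measurable_integrable)
  then have C: "AE t in lebesgue. t \<in> {0..} \<longrightarrow> Cauchy (\<lambda>i. a (r i) t)" by (subst (asm) AE_restrict_space_iff) auto
  then obtain X where X: "X \<in> null_sets lebesgue" "{t\<in>space lebesgue. \<not> (t \<in> {0..} \<longrightarrow> Cauchy (\<lambda>i. a (r i) t))} \<subseteq> X"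
    unfolding eventually_ae_filter by blast
  have CX: "Cauchy (\<lambda>i. a (r i) t)" if "0 \<le> t" "t \<notin> X" for t using X(2) that by auto
  have negX: "negligible X" using X(1) by (simp add: negligible_iff_null_sets)
  \<comment> \<open>the properties that midpoint combinations inherit from the terms\<close>
  have comb: "b \<in> borel_measurable (lebesgue_on {0..}) \<and> (\<forall>t\<ge>0. norm (b t) \<le> 1) \<and>
      (\<forall>t v c. (\<forall>k\<ge>n. z k t \<bullet> v \<le> c) \<longrightarrow> b t \<bullet> v \<le> c) \<and> loc_int (\<lambda>t. (N t + 1) *\<^sub>R b t) \<and>
      (\<forall>t\<ge>0. \<forall>\<epsilon>. (\<forall>k\<ge>n. norm (integral {0..t} (\<zeta> k) - \<Psi> t) \<le> \<epsilon>) \<longrightarrow> norm (integral {0..t} (\<lambda>s. (N s + 1) *\<^sub>R b s) - \<Psi> t) \<le> \<epsilon>)"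
    if "b \<in> midpoint_combinations z n" for b n
    using that
  proof induction
    case (base k)
    have eq: "(N t + 1) *\<^sub>R z k t = \<zeta> k t" if "0 \<le> t" for t using N0[OF that] by (simp add: z_def)
    have lz: "loc_int (\<lambda>t. (N t + 1) *\<^sub>R z k t)"
      unfolding loc_int_def
    proof
      fix T
      have "\<zeta> k absolutely_integrable_on {0..T}" using \<zeta> by (simp add: loc_int_def)
      then show "(\<lambda>t. (N t + 1) *\<^sub>R z k t) absolutely_integrable_on {0..T}"
        by (rule absolutely_integrable_spike[OF _ negligible_empty]) (simp add: eq)
    qed
    have iz: "integral {0..t} (\<lambda>s. (N s + 1) *\<^sub>R z k s) = integral {0..t} (\<zeta> k)" for t
      by (rule Henstock_Kurzweil_Integration.integral_cong) (simp add: eq)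
    show ?case
    proof (intro conjI allI impI)
      show "norm (z k t) \<le> 1" if "0 \<le> t" for t using zb[of t k] that by (simp add: space\<nu>)
      show "z k t \<bullet> v \<le> c" if "\<forall>k\<ge>n. z k t \<bullet> v \<le> c" for t v c using that base by blast
      show "norm (integral {0..t} (\<lambda>s. (N s + 1) *\<^sub>R z k s) - \<Psi> t) \<le> \<epsilon>"
        if "\<forall>k\<ge>n. norm (integral {0..t} (\<zeta> k) - \<Psi> t) \<le> \<epsilon>" for t \<epsilon> unfolding iz using that base by blast
    qed (rule zm lz)+
  next
    case (midpoint b b')
    have scale: "(N t + 1) *\<^sub>R (1/2) *\<^sub>R (b t + b' t) = (1/2) *\<^sub>R ((N t + 1) *\<^sub>R b t + (N t + 1) *\<^sub>R b' t)" for t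
      by (simp only: scaleR_add_right scaleR_scaleR mult.commute)
    have li: "loc_int (\<lambda>t. (N t + 1) *\<^sub>R b t + (N t + 1) *\<^sub>R b' t)"
      using midpoint.IH by (intro loc_int_add) auto
    have half: "norm ((1/2) *\<^sub>R (p + p') - w) \<le> \<epsilon>" if "norm (p - w) \<le> \<epsilon>" "norm (p' - w) \<le> \<epsilon>" for p p' w :: 'e and \<epsilon>
    proof -
      have "(1/2) *\<^sub>R (p + p') - w = (1/2) *\<^sub>R ((p - w) + (p' - w))" by (simp add: algebra_simps scaleR_2[symmetric])
      also have "norm \<dots> \<le> (1/2) * (norm (p - w) + norm (p' - w))" using norm_triangle_ineq[of "p - w" "p' - w"] by simp
      finally show ?thesis using that by simp
    qed
    show ?case
    proof (intro conjI allI impI)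
      show "(\<lambda>t. (1/2) *\<^sub>R (b t + b' t)) \<in> borel_measurable (lebesgue_on {0..})" by (intro borel_measurable_scaleR borel_measurable_add borel_measurable_const) (use midpoint.IH in blast)+
      show "norm ((1/2) *\<^sub>R (b t + b' t)) \<le> 1" if "0 \<le> t" for t
        using half[of "b t" 0 1 "b' t"] midpoint.IH that by simp
      show "(1/2) *\<^sub>R (b t + b' t) \<bullet> v \<le> c" if "\<forall>k\<ge>n. z k t \<bullet> v \<le> c" for t v c
      proof -
        have "b t \<bullet> v \<le> c" "b' t \<bullet> v \<le> c" using midpoint.IH that by blast+
        then show ?thesis by (simp add: inner_add_left)
      qed
      show "loc_int (\<lambda>t. (N t + 1) *\<^sub>R (1/2) *\<^sub>R (b t + b' t))"
        unfolding scale using li unfolding loc_int_def by (auto intro: absolutely_integrable_scaleR_left)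
      fix t :: real and \<epsilon> assume t: "0 \<le> t" and \<epsilon>: "\<forall>k\<ge>n. norm (integral {0..t} (\<zeta> k) - \<Psi> t) \<le> \<epsilon>"
      have i: "(\<lambda>s. (N s + 1) *\<^sub>R b s) integrable_on {0..t}" "(\<lambda>s. (N s + 1) *\<^sub>R b' s) integrable_on {0..t}"
        using midpoint.IH by (auto intro: loc_int_integrable)
      have "integral {0..t} (\<lambda>s. (N s + 1) *\<^sub>R (1/2) *\<^sub>R (b s + b' s)) =
        (1/2) *\<^sub>R (integral {0..t} (\<lambda>s. (N s + 1) *\<^sub>R b s) + integral {0..t} (\<lambda>s. (N s + 1) *\<^sub>R b' s))"
        unfolding scale integral_cmul by (simp only: Henstock_Kurzweil_Integration.integral_add[OF i])
      moreover have "norm (integral {0..t} (\<lambda>s. (N s + 1) *\<^sub>R b s) - \<Psi> t) \<le> \<epsilon>" "norm (integral {0..t} (\<lambda>s. (N s + 1) *\<^sub>R b' s) - \<Psi> t) \<le> \<epsilon>"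
        using midpoint.IH t \<epsilon> by blast+
      ultimately show "norm (integral {0..t} (\<lambda>s. (N s + 1) *\<^sub>R (1/2) *\<^sub>R (b s + b' s)) - \<Psi> t) \<le> \<epsilon>"
        using half by simp
    qed
  qed
  define b where "b i t = (if t \<in> X then 0 else (N t + 1) *\<^sub>R a (r i) t)" for i t
  define \<phi> where "\<phi> t = lim (\<lambda>i. b i t)" for t
  have conv: "(\<lambda>i. b i t) \<longlonglongrightarrow> \<phi> t" if "0 \<le> t" for t
  proof (cases "t \<in> X")
    case False
    have "convergent (\<lambda>i. a (r i) t)" using CX[OF that False] by (simp add: Cauchy_convergent_iff)
    then have "convergent (\<lambda>i. (N t + 1) *\<^sub>R a (r i) t)" unfolding convergent_def using tendsto_scaleR[OF tendsto_const] by blast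
    then show ?thesis using False by (simp add: \<phi>_def b_def convergent_LIMSEQ_iff)
  qed (simp add: \<phi>_def b_def)
  have bm: "b i \<in> borel_measurable (lebesgue_on {0..})" for i
  proof -
    have "X \<inter> {0..} \<in> sets (lebesgue_on {0..})" using X(1) by (auto simp: sets_restrict_space)
    moreover have "{t\<in>space (lebesgue_on {0..}). t \<in> X} = X \<inter> {0..}" by auto
    moreover have "(\<lambda>t. (N t + 1) *\<^sub>R a (r i) t) \<in> borel_measurable (lebesgue_on {0..})"
      using comb[OF a[of "r i"]] loc_int_measurable by blast
    ultimately show ?thesis unfolding b_def by (intro measurable_If) auto
  qed
  have bb: "norm (b i t) \<le> N t + 1" if "0 \<le> t" for i t
    using comb[OF a[of "r i"]] N0[OF that] that mult_left_mono[of "norm (a (r i) t)" 1 "N t + 1"] by (auto simp: b_def)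
  have \<phi>m: "\<phi> \<in> borel_measurable (lebesgue_on {0..})"
    by (rule borel_measurable_LIMSEQ_metric[OF bm]) (use conv in auto)
  have \<phi>b: "norm (\<phi> t) \<le> N t + 1" if "0 \<le> t" for t
    by (rule tendsto_upperbound[OF tendsto_norm[OF conv[OF that]]]) (use bb[OF that] in auto)
  have N1: "loc_int (\<lambda>t. N t + 1)" by (intro loc_int_add N loc_int_const)
  have \<phi>l: "loc_int \<phi>" by (rule loc_int_dominated[OF \<phi>m N1 \<phi>b])
  have bl: "loc_int (b i)" for i by (rule loc_int_dominated[OF bm N1 bb])
  have prim: "\<Psi> t = integral {0..t} \<phi>" if t: "0 \<le> t" for t
  proof -
    have "(\<lambda>i. integral {0..t} (b i)) \<longlonglongrightarrow> integral {0..t} \<phi>"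
      by (rule dominated_convergence(2)[where h="\<lambda>t. N t + 1"])
         (use bl N1 bb conv in \<open>auto intro: loc_int_integrable\<close>)
    moreover have "(\<lambda>i. integral {0..t} (b i)) \<longlonglongrightarrow> \<Psi> t"
    proof (rule LIMSEQ_I)
      fix \<epsilon> :: real assume "0 < \<epsilon>"
      then obtain n0 where n0: "\<And>k. k \<ge> n0 \<Longrightarrow> norm (integral {0..t} (\<zeta> k) - \<Psi> t) < \<epsilon> / 2"
        using LIMSEQ_D[OF lim[OF t], of "\<epsilon> / 2"] by auto
      have "norm (integral {0..t} (b i) - \<Psi> t) < \<epsilon>" if "i \<ge> n0" for i
      proof -
        have "r i \<ge> n0" using that seq_suble[OF r, of i] by simp
        then have "\<forall>k\<ge>r i. norm (integral {0..t} (\<zeta> k) - \<Psi> t) \<le> \<epsilon> / 2" using n0 by (auto intro: less_imp_le)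
        then have "norm (integral {0..t} (\<lambda>s. (N s + 1) *\<^sub>R a (r i) s) - \<Psi> t) \<le> \<epsilon> / 2" using comb[OF a[of "r i"]] t by blast
        moreover have "integral {0..t} (b i) = integral {0..t} (\<lambda>s. (N s + 1) *\<^sub>R a (r i) s)"
          by (rule integral_spike[OF negX]) (simp add: b_def)
        ultimately show ?thesis using \<open>0 < \<epsilon>\<close> by simp
      qed
      then show "\<exists>no. \<forall>n\<ge>no. norm (integral {0..t} (b n) - \<Psi> t) < \<epsilon>" by blast
    qed
    ultimately show ?thesis by (metis LIMSEQ_unique)
  qed
  have "AE t in lebesgue. t \<notin> X" using X(1) by (rule AE_not_in)
  then have "AE t in lebesgue. 0 \<le> t \<longrightarrow> (\<forall>v c. (\<forall>\<^sub>F n in sequentially. \<zeta> n t \<bullet> v \<le> c) \<longrightarrow> \<phi> t \<bullet> v \<le> c)"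
  proof eventually_elim
    case (elim t)
    show ?case
    proof (intro impI allI)
      fix v c assume t: "0 \<le> t" and "\<forall>\<^sub>F n in sequentially. \<zeta> n t \<bullet> v \<le> c"
      then obtain n0 where n0: "\<And>k. k \<ge> n0 \<Longrightarrow> \<zeta> k t \<bullet> v \<le> c" unfolding eventually_sequentially by blast
      have N1: "N t + 1 > 0" using N0[OF t] by simp
      have "b i t \<bullet> v \<le> c" if "i \<ge> n0" for i
      proof -
        have "r i \<ge> n0" using that seq_suble[OF r, of i] by simp
        then have "\<forall>k\<ge>r i. z k t \<bullet> v \<le> c / (N t + 1)" using n0 N1
          by (auto simp: z_def divide_inverse_commute intro!: mult_left_mono)
        then have "a (r i) t \<bullet> v \<le> c / (N t + 1)" using comb[OF a[of "r i"]] by blast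
        then show ?thesis using elim N1 by (simp add: b_def pos_le_divide_eq mult.commute)
      qed
      then have "\<forall>\<^sub>F i in sequentially. b i t \<bullet> v \<le> c" unfolding eventually_sequentially by blast
      then show "\<phi> t \<bullet> v \<le> c"
        by (rule tendsto_upperbound[OF tendsto_inner[OF conv[OF t] tendsto_const]]) simp
    qed
  qed
  then show ?thesis using that \<phi>l prim by blast
qed

section \<open>Passage to the infinite horizon\<close>

lemma interval_in_sets_lebesgue_on: "{0..b::real} \<in> sets (lebesgue_on {0..})"
  by (subst sets_restrict_space_iff) auto

context control_problem begin

text \<open>The Borel-Cantelli lemma. The weight is at least 1, and every fixed time lies within all late horizons.\<close>

lemma AE_eventually_not:
  assumes P: "\<And>n. {t\<in>{0..}. P n t} \<in> sets (lebesgue_on {0..})"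
    and le: "\<And>n. integral {0..T n} (\<lambda>t. if P n t then M t else 0) \<le> c * (1/2)^n" and T: "\<And>n. real n \<le> T n"
  shows "AE t in lebesgue. 0 \<le> t \<longrightarrow> (\<forall>\<^sub>F n in sequentially. \<not> P n t)"
proof -
  define A where "A n = {t\<in>{0..}. P n t} \<inter> {0..T n}" for n
  have A: "A n \<in> sets lebesgue" for n
  proof -
    have "{t\<in>{0..}. P n t} \<in> sets lebesgue" using P[of n] by (subst (asm) sets_restrict_space_iff) auto
    then show ?thesis unfolding A_def by auto
  qed
  have "bounded (A n)" for n by (rule bounded_subset[of "{0..T n}"]) (auto simp: A_def)
  then have Al: "A n \<in> lmeasurable" for n using A by (rule bounded_set_imp_lmeasurable)
  have mA: "measure lebesgue (A n) \<le> c * (1/2)^n" for n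
  proof -
    have one: "loc_int (\<lambda>t. if P n t then 1 else 0 :: real)" by (rule loc_int_if[OF P loc_int_const])
    have "measure lebesgue (A n) = integral (A n) (\<lambda>t. 1)" by (rule lmeasure_integral[OF Al])
    also have "\<dots> = integral ({0..T n} \<inter> {t\<in>{0..}. P n t}) (\<lambda>t. 1)" by (simp add: A_def Int_commute)
    also have "\<dots> = integral {0..T n} (\<lambda>t. if t \<in> {t\<in>{0..}. P n t} then 1 else 0)" by (simp only: integral_restrict_Int Int_commute)
    also have "\<dots> = integral {0..T n} (\<lambda>t. if P n t then 1 else 0)" by (rule Henstock_Kurzweil_Integration.integral_cong) simp
    also have "\<dots> \<le> integral {0..T n} (\<lambda>t. if P n t then M t else 0)"
      by (rule integral_le[OF loc_int_integrable[OF one order_refl] loc_int_integrable[OF loc_int_if[OF P M(1)] order_refl]])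
         (use M(2) in auto)
    finally show ?thesis using le[of n] by linarith
  qed
  have "AE t in lebesgue. \<forall>\<^sub>F n in sequentially. t \<in> space lebesgue - A n"
  proof (rule borel_cantelli_AE1[OF A])
    show "emeasure lebesgue (A n) < \<infinity>" for n using Al[of n] unfolding fmeasurable_def by blast
    show "summable (\<lambda>n. measure lebesgue (A n))"
      by (rule summable_comparison_test'[of "\<lambda>n. c * (1/2)^n" 0]) (use mA in \<open>auto intro: summable_mult summable_geometric\<close>)
  qed
  then show ?thesis
  proof eventually_elim
    case (elim t)
    show ?case
    proof
      assume t: "0 \<le> t"
      obtain N :: nat where N: "t \<le> real N" using real_arch_simple by blast
      have "\<forall>\<^sub>F n in sequentially. N \<le> n" by (rule eventually_ge_at_top)
      with elim show "\<forall>\<^sub>F n in sequentially. \<not> P n t"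
      proof eventually_elim
        case (elim n)
        then have "t \<le> T n" using T[of n] N by (meson of_nat_mono order_trans)
        then show ?case using elim t by (auto simp: A_def)
      qed
    qed
  qed
qed

text \<open>The gradient is bounded by difference quotients, near \<open>x\<close>, of the Hamiltonian with the parameters \<open>l n\<close> and \<open>\<Psi> n\<close>. Up to
  a function whose Lipschitz constant tends to zero this is the limiting Hamiltonian, and Clarke's derivative
  bounds the quotients of the latter near \<open>x\<close>.\<close>

lemma smooth_grad_limit_clarke:
  assumes t: "0 \<le> t" "p \<in> U t" and x: "norm x \<le> radius m t" "\<And>n. norm (X n) \<le> radius m t" "X \<longlonglongrightarrow> x"
    and e: "\<And>n. 0 < e n" "\<And>n. e n \<le> 1" "e \<longlonglongrightarrow> 0" and kq: "\<And>n. mollifier (e n) (k n) (q n)"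
    and lim: "l \<longlonglongrightarrow> lam" "\<Psi> \<longlonglongrightarrow> \<psi>"
    and c: "clarke_deriv (\<lambda>y. hamiltonian f g y t p lam \<psi>) x v < ereal c"
  shows "\<forall>\<^sub>F n in sequentially. ham_grad (q n) (l n) (\<Psi> n) t (X n) p \<bullet> v \<le> c"
proof -
  define h where "h y = \<psi> \<bullet> f t y p + lam * g t y p" for y
  \<comment> \<open>the gap between \<open>c1\<close> and \<open>c\<close> absorbs the change of the parameters\<close>
  obtain c1 where c1: "clarke_deriv h x v < ereal c1" "c1 < c"
    using ereal_dense2[OF c] unfolding hamiltonian_def h_def by auto
  have "\<forall>\<^sub>F (y, s) in nhds x \<times>\<^sub>F at_right 0. ereal ((h (y + s *\<^sub>R v) - h y) / s) < ereal c1"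
    using Limsup_lessD[OF c1(1)[unfolded clarke_deriv_def]] by (simp add: split_def)
  then obtain Pf Pg where Pf: "eventually Pf (nhds x)" and Pg: "eventually Pg (at_right 0)"
    and PP: "\<And>y s. Pf y \<Longrightarrow> Pg s \<Longrightarrow> (h (y + s *\<^sub>R v) - h y) / s < c1"
    unfolding eventually_prod_filter by auto
  obtain d1 where d1: "d1 > 0" "\<And>y. dist y x < d1 \<Longrightarrow> Pf y" using Pf unfolding eventually_nhds_metric by blast
  obtain d2 where d2: "d2 > 0" "\<And>s. 0 < s \<Longrightarrow> s < d2 \<Longrightarrow> Pg s" using Pg unfolding eventually_at_right_field by auto
  define s0 where "s0 = min (d2 / 2) (1 / (norm v + 1))"
  have v1: "0 < norm v + 1" by (simp add: add_nonneg_pos)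
  have s0: "0 < s0" "s0 < d2" "s0 * norm v \<le> 1"
  proof -
    show "0 < s0" "s0 < d2" using d2(1) v1 by (auto simp: s0_def)
    have "s0 * norm v \<le> 1 / (norm v + 1) * (norm v + 1)" using v1 by (intro mult_mono) (auto simp: s0_def)
    then show "s0 * norm v \<le> 1" using v1 by simp
  qed
  have "(\<lambda>n. (norm (\<Psi> n - \<psi>) + \<bar>l n - lam\<bar>) * M t * norm v) \<longlonglongrightarrow> (norm (\<psi> - \<psi>) + \<bar>lam - lam\<bar>) * M t * norm v"
    by (intro tendsto_intros lim)
  then have "\<forall>\<^sub>F n in sequentially. (norm (\<Psi> n - \<psi>) + \<bar>l n - lam\<bar>) * M t * norm v < c - c1"
    using c1(2) by (intro order_tendstoD(2)) auto
  moreover have "\<forall>\<^sub>F n in sequentially. dist (X n) x < d1 / 2" using x(3) d1(1) by (intro tendstoD) auto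
  moreover have "\<forall>\<^sub>F n in sequentially. e n < d1 / 2" using e(3) d1(1) by (intro order_tendstoD(2)) auto
  ultimately show ?thesis
  proof eventually_elim
    case (elim n)
    show "ham_grad (q n) (l n) (\<Psi> n) t (X n) p \<bullet> v \<le> c"
      unfolding ham_grad_def[OF kq e(1,2)]
    proof (rule smooth_grad_le[OF kq[of n] hf_cont[OF kq e(1,2) t] s0(1)])
      fix y s assume y: "norm (y - X n) \<le> e n" and s: "0 < s" "s \<le> s0"
      have "dist y x < d1" using dist_triangle[of y x "X n"] y elim by (simp add: dist_norm)
      then have "(h (y + s *\<^sub>R v) - h y) / s < c1" using PP d1(2) d2(2) s s0(2) by auto
      then have 1: "h (y + s *\<^sub>R v) - h y \<le> c1 * s" using s by (simp add: divide_less_eq)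
      have sv: "s * norm v \<le> 1" using mult_right_mono[OF s(2), of "norm v"] s0(3) by simp
      have yb: "norm y \<le> radius m t + 2" using norm_triangle_sub[of y "X n"] y x(2)[of n] e(2)[of n] by linarith
      have yv: "norm (y + s *\<^sub>R v) \<le> radius m t + 2"
        using norm_triangle_sub[of y "X n"] norm_triangle_ineq[of y "s *\<^sub>R v"] y x(2)[of n] e(2)[of n] sv s by simp
      have "\<bar>((\<Psi> n - \<psi>) \<bullet> f t (y + s *\<^sub>R v) p + (l n - lam) * g t (y + s *\<^sub>R v) p) - ((\<Psi> n - \<psi>) \<bullet> f t y p + (l n - lam) * g t y p)\<bar>
          \<le> (norm (\<Psi> n - \<psi>) + \<bar>l n - lam\<bar>) * M t * norm (y + s *\<^sub>R v - y)"
        by (rule hf_lip[OF kq e(1,2) t yv yb])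
      also have "\<dots> = ((norm (\<Psi> n - \<psi>) + \<bar>l n - lam\<bar>) * M t * norm v) * s" using s by simp
      also have "\<dots> \<le> (c - c1) * s" using elim s by (intro mult_right_mono) auto
      finally have "((\<Psi> n - \<psi>) \<bullet> f t (y + s *\<^sub>R v) p + (l n - lam) * g t (y + s *\<^sub>R v) p) - ((\<Psi> n - \<psi>) \<bullet> f t y p + (l n - lam) * g t y p) \<le> (c - c1) * s"
        by linarith
      then show "\<Psi> n \<bullet> f t (y + s *\<^sub>R v) p + l n * g t (y + s *\<^sub>R v) p - (\<Psi> n \<bullet> f t y p + l n * g t y p) \<le> c * s"
        using 1 by (simp add: h_def inner_diff_left algebra_simps)
    qed
  qed
qed

lemma ham_limit:
  assumes t: "0 \<le> t" "p \<in> U t" and x: "norm x \<le> radius m t" "\<And>n. norm (X n) \<le> radius m t" "X \<longlonglongrightarrow> x"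
    and e: "\<And>n. 0 < e n" "\<And>n. e n \<le> 1" "e \<longlonglongrightarrow> 0" and kq: "\<And>n. mollifier (e n) (k n) (q n)"
    and lim: "l \<longlonglongrightarrow> lam" "\<Psi> \<longlonglongrightarrow> \<psi>"
  shows "(\<lambda>n. ham (k n) (l n) (\<Psi> n) t (X n) p) \<longlonglongrightarrow> hamiltonian f g x t p lam \<psi>"
proof -
  have z: "(\<lambda>n. e n * M t + M t * norm (X n - x)) \<longlonglongrightarrow> 0 * M t + M t * norm (x - x)"
    by (intro tendsto_intros e x)
  then have z: "(\<lambda>n. e n * M t + M t * norm (X n - x)) \<longlonglongrightarrow> 0" by simp
  have f1: "norm (mollify (k n) f t (X n) p - f t x p) \<le> e n * M t + M t * norm (X n - x)" for n
  proof -
    have "norm (mollify (k n) f t (X n) p - f t x p) \<le> norm (mollify (k n) f t (X n) p - f t (X n) p) + norm (f t (X n) p - f t x p)"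
      using norm_triangle_ineq[of "mollify (k n) f t (X n) p - f t (X n) p" "f t (X n) p - f t x p"] by simp
    also have "\<dots> \<le> e n * m t + m t * norm (X n - x)"
      by (intro add_mono mollify_near_f[OF kq e(1,2) t] f_lip[OF t])
    also have "\<dots> \<le> e n * M t + M t * norm (X n - x)"
      using M(3)[OF t(1)] e(1)[of n] by (intro add_mono mult_left_mono mult_right_mono) auto
    finally show ?thesis .
  qed
  have g1: "norm (mollify (k n) g t (X n) p - g t x p) \<le> e n * M t + M t * norm (X n - x)" for n
  proof -
    have "\<bar>mollify (k n) g t (X n) p - g t (X n) p\<bar> \<le> e n * M t" by (rule mollify_near_g[OF kq e(1,2) t x(2)])
    moreover have "\<bar>g t (X n) p - g t x p\<bar> \<le> M t * norm (X n - x)"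
      by (rule g_lip[OF t]) (use x(1) x(2)[of n] in auto)
    ultimately show ?thesis by simp
  qed
  have "(\<lambda>n. mollify (k n) f t (X n) p) \<longlonglongrightarrow> f t x p" 
    by (rule LIM_zero_cancel, rule Lim_null_comparison[OF _ z]) (use f1 in auto)
  moreover have "(\<lambda>n. mollify (k n) g t (X n) p) \<longlonglongrightarrow> g t x p"
    by (rule LIM_zero_cancel, rule Lim_null_comparison[OF _ z]) (use g1 in auto)
  ultimately show ?thesis
    unfolding ham_def[OF kq e(1,2)] hamiltonian_def by (intro tendsto_intros lim)
qed

text \<open>The \<open>n\<close>-th approximation has horizon at least \<open>n\<close> and errors \<open>(1/2)^n\<close>, which are summable as Borel-Cantelli requires.
  The maximum condition is limited to countably many competitors, since each of them has its own exceptional null set.\<close>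

lemma infinite_horizon:
  assumes u0: "u0 \<in> selectors U" and x0: "trajectory f u0 x0"
    and opt: "\<And>\<epsilon>. 0 < \<epsilon> \<Longrightarrow> \<exists>T>0. \<forall>u\<in>selectors U. \<forall>t\<ge>T. cost f g t u \<le> cost f g t u0 + \<epsilon>"
    and v: "\<And>j::nat. v j \<in> selectors U"
  obtains lam \<psi> \<phi> where "0 \<le> lam" "lam + norm (\<psi> 0) = 1" "loc_int \<phi>"
    "\<And>t. 0 \<le> t \<Longrightarrow> \<psi> t = \<psi> 0 + integral {0..t} \<phi>"
    "AE t in lebesgue. 0 \<le> t \<longrightarrow> - \<phi> t \<in> clarke_gradient (\<lambda>y. hamiltonian f g y t (u0 t) lam (\<psi> t)) (x0 t)"
    "AE t in lebesgue. 0 \<le> t \<longrightarrow> (\<forall>j. hamiltonian f g (x0 t) t (v j t) lam (\<psi> t) \<le> hamiltonian f g (x0 t) t (u0 t) lam (\<psi> t))"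
proof -
  \<comment> \<open>all that \<open>finite_horizon\<close> provides for one \<open>n\<close>, so that the witnesses can be chosen for all \<open>n\<close> at once\<close>
  define S where "S n T e k q w x lam \<psi> \<longleftrightarrow> real n \<le> T \<and> 0 < e \<and> e \<le> (1/2)^n \<and> mollifier e k q \<and> w \<in> selectors U \<and>
      trajectory (mollify k f) w x \<and> deviation w u0 T \<le> 3 * (1/2)^n \<and> adjoint q T w x lam \<psi> \<and>
      (\<forall>v\<in>selectors U. integral {0..T} (\<lambda>t. if 3 * (1/2)^n * M t < 
        ham k lam (\<psi> t) t (x t) (v t) - ham k lam (\<psi> t) t (x t) (w t) then M t else 0) \<le> 1 * (1/2)^n)" 
    for n :: nat and T e :: real and k :: "'x \<Rightarrow> real" and q w x lam \<psi>
  have "\<forall>n. \<exists>T e k q w x lam \<psi>. S n T e k q w x lam \<psi>"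
  proof
    fix n :: nat
    obtain T0 where T0: "T0 > 0" "\<And>u t. u \<in> selectors U \<Longrightarrow> T0 \<le> t \<Longrightarrow> cost f g t u \<le> cost f g t u0 + ((1/2)^n)\<^sup>2"
      using opt[of "((1/2)^n)\<^sup>2"] by auto
    define T where "T = max T0 (real n)"
    have T: "0 \<le> T" "real n \<le> T" "T0 \<le> T" by (auto simp: T_def)
    have pos: "0 < (1/2::real)^n" "(1/2::real)^n \<le> 1" by (auto intro: power_le_one)
    show "\<exists>T e k q w x lam \<psi>. S n T e k q w x lam \<psi>"
    proof (rule finite_horizon[OF T(1) pos(1) pos(1) pos u0])
      show "cost f g T u \<le> cost f g T u0 + ((1/2)^n)\<^sup>2" if "u \<in> selectors U" for u by (rule T0(2)[OF that T(3)])
      fix e and k :: "'x \<Rightarrow> real" and q w x lam \<psi>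
      assume "0 < e" "e \<le> (1/2)^n" "mollifier e k q" "w \<in> selectors U" "trajectory (mollify k f) w x"
        "deviation w u0 T \<le> 3 * (1/2)^n" "adjoint q T w x lam \<psi>"
        "\<And>v. v \<in> selectors U \<Longrightarrow> integral {0..T} (\<lambda>t. if 3 * (1/2)^n * M t < 
          ham k lam (\<psi> t) t (x t) (v t) - ham k lam (\<psi> t) t (x t) (w t) then M t else 0) \<le> (1/2)^n"
      then have "S n T e k q w x lam \<psi>" unfolding S_def using T(2) by simp
      then show ?thesis by blast
    qed
  qed
  then obtain T e k q w x l \<Psi> where S: "\<And>n. S n (T n) (e n) (k n) (q n) (w n) (x n) (l n) (\<Psi> n)" by metis
  have T: "real n \<le> T n" and e: "0 < e n" "e n \<le> (1/2)^n" and kq: "mollifier (e n) (k n) (q n)" and w: "w n \<in> selectors U"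
    and x: "trajectory (mollify (k n) f) (w n) (x n)" and dev: "deviation (w n) u0 (T n) \<le> 3 * (1/2)^n"
    and adj: "adjoint (q n) (T n) (w n) (x n) (l n) (\<Psi> n)"
    and gap: "\<And>v. v \<in> selectors U \<Longrightarrow> integral {0..T n} (\<lambda>t. if 3 * (1/2)^n * M t < 
        ham (k n) (l n) (\<Psi> n t) t (x n t) (v t) - ham (k n) (l n) (\<Psi> n t) t (x n t) (w n t) then M t else 0) \<le> 1 * (1/2)^n" for n
    using S[of n] unfolding S_def by blast+
  have e1: "e n \<le> 1" for n using e(2)[of n] power_le_one[of "1/2::real" n] by (auto intro: order_trans)
  have half: "(\<lambda>n. (1/2::real)^n) \<longlonglongrightarrow> 0" by (rule LIMSEQ_power_zero) simp
  have e0: "e \<longlonglongrightarrow> 0"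
    by (rule tendsto_sandwich[OF _ _ tendsto_const half]) (use e in \<open>auto simp: less_imp_le\<close>)
  note rF = regular_mollify[OF kq e(1) e1]
  note xb = trajectory_bound[OF rF w x] and x0b = trajectory_bound[OF regular_f u0 x0]
  note \<psi> = adjointD[OF kq e(1) e1 adj]
  have xlim: "(\<lambda>n. x n t) \<longlonglongrightarrow> x0 t" if t: "0 \<le> t" for t
  proof -
    have z: "(\<lambda>n. 2 * (e n * integral {0..t} m + 2 * (3 * (1/2)^n)) * growth m t) \<longlonglongrightarrow> 2 * (0 * integral {0..t} m + 2 * (3 * 0)) * growth m t"
      by (intro tendsto_intros e0 half)
    obtain N :: nat where N: "t \<le> real N" using real_arch_simple by blast
    have "norm (x n t - x0 t) \<le> 2 * (e n * integral {0..t} m + 2 * (3 * (1/2)^n)) * growth m t" if n: "n \<ge> N" for n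
    proof -
      have tT: "t \<le> T n" using N T[of n] n by (meson of_nat_mono order_trans)
      have "norm (x n t - x0 t) \<le> 2 * (e n * integral {0..t} m + 2 * deviation (w n) u0 t) * growth m t"
        by (rule trajectory_compare[OF rF regular_f w u0 x x0 t]) (use e(1)[of n] mollify_near_f[OF kq e(1) e1] in auto)
      also have "deviation (w n) u0 t \<le> deviation (w n) u0 (T n)" unfolding deviation_def
        by (rule integral_mono_upper[OF loc_int_deviation[OF w u0] _ t tT]) (use M_nonneg in auto)
      also have "\<dots> \<le> 3 * (1/2)^n" by (rule dev)
      finally show ?thesis by (simp add: less_imp_le)
    qed
    then have "\<forall>\<^sub>F n in sequentially. norm (x n t - x0 t) \<le> 2 * (e n * integral {0..t} m + 2 * (3 * (1/2)^n)) * growth m t"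
      unfolding eventually_sequentially by blast
    then have "(\<lambda>n. x n t - x0 t) \<longlonglongrightarrow> 0" by (rule Lim_null_comparison) (use z in simp)
    then show ?thesis by (rule LIM_zero_cancel)
  qed
  have wev: "AE t in lebesgue. 0 \<le> t \<longrightarrow> (\<forall>\<^sub>F n in sequentially. \<not> w n t \<noteq> u0 t)"
    by (rule AE_eventually_not[where T=T and c=3, OF controls_differ_measurable[OF w u0]])
       (use dev T in \<open>auto simp: deviation_def\<close>)
  \<comment> \<open>the adjoint curves are equibounded and equicontinuous, with the following locally integrable modulus\<close>
  define B where "B t = 2 * (1 + integral {0..t} M) * growth M t" for t
  define NB where "NB t = M t * (B t + 1)" for t
  have Bc: "continuous_on {0..} B" unfolding B_def
    by (intro continuous_intros continuous_indefinite_integral continuous_growth M)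
  have NBl: "loc_int NB" unfolding NB_def by (intro loc_int_mult_continuous M continuous_intros Bc)
  have \<Psi>B: "norm (\<Psi> n t) \<le> B t" if "0 \<le> t" "t \<le> T n" for n t
    unfolding B_def by (rule adjoint_bound[OF kq e(1) e1 w x adj that])
  have B0: "0 \<le> B t" if "0 \<le> t" for t
    unfolding B_def using integral_nonneg[OF loc_int_integrable[OF M(1) order_refl], of t] M_nonneg by (auto simp: less_imp_le)
  \<comment> \<open>the derivative of the adjoint curve, continued by zero beyond the horizon\<close>
  define \<zeta> where "\<zeta> n t = (if t \<le> T n then - ham_grad (q n) (l n) (\<Psi> n t) t (x n t) (w n t) else 0)" for n t
  have \<zeta>l: "loc_int (\<zeta> n)" for n
  proof -
    have "{t\<in>{0..}. t \<le> T n} \<in> sets (lebesgue_on {0..})"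
    proof -
      have "{t\<in>{0..}. t \<le> T n} = {0..T n}" by auto
      then show ?thesis by (simp only: interval_in_sets_lebesgue_on)
    qed
    then have m: "(\<lambda>t. if t \<le> T n then - ham_grad (q n) (l n) (\<Psi> n t) t (x n t) (w n t) else 0) \<in> borel_measurable (lebesgue_on {0..})"
      using loc_int_measurable[OF loc_int_uminus[OF \<psi>(4)[of n]]] by (intro measurable_If) auto
    show ?thesis unfolding \<zeta>_def
      by (rule loc_int_dominated[OF m loc_int_norm[OF \<psi>(4)[of n]]]) auto
  qed
  have \<zeta>N: "norm (\<zeta> n t) \<le> NB t" if t: "0 \<le> t" for n t
  proof (cases "t \<le> T n")
    case True
    have "norm (ham_grad (q n) (l n) (\<Psi> n t) t (x n t) (w n t)) \<le> (norm (\<Psi> n t) + \<bar>l n\<bar>) * M t"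
      by (rule ham_grad_bound[OF kq e(1) e1 t selectorsD(1)[OF w t] xb[OF t]])
    also have "\<dots> \<le> (B t + 1) * M t"
      using \<Psi>B[OF t True] \<psi>(1)[of n] \<psi>(7)[of n] M_nonneg[OF t] by (intro mult_right_mono) auto
    finally show ?thesis using True by (simp add: \<zeta>_def NB_def mult.commute)
  next
    case False
    then show ?thesis using B0[OF t] M_nonneg[OF t] by (simp add: \<zeta>_def NB_def)
  qed
  have \<Psi>\<zeta>: "\<Psi> n t = \<Psi> n 0 + integral {0..t} (\<zeta> n)" if t: "0 \<le> t" "t \<le> T n" for n t
  proof -
    have "\<Psi> n t = \<Psi> n 0 - integral {0..t} (\<lambda>s. ham_grad (q n) (l n) (\<Psi> n s) s (x n s) (w n s))"
      using \<psi>(6)[of t n] t by simp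
    also have "integral {0..t} (\<lambda>s. ham_grad (q n) (l n) (\<Psi> n s) s (x n s) (w n s)) = - integral {0..t} (\<zeta> n)"
      unfolding integral_neg[symmetric]
      by (rule Henstock_Kurzweil_Integration.integral_cong) (use t in \<open>simp add: \<zeta>_def\<close>)
    finally show ?thesis by simp
  qed
  \<comment> \<open>an enumeration of the nonnegative rationals; \<open>l\<close> is attached to each coordinate, so that it converges along the same subsequence\<close>
  define Q where "Q i = \<bar>real_of_rat (from_nat i)\<bar>" for i
  define Y where "Y n i = (if Q i \<le> T n then \<Psi> n (Q i) else 0, l n)" for n i
  have Yc: "compact (cball (0::'x) (B (Q i)) \<times> {0..1::real})" for i by (intro compact_Times) auto
  have YK: "Y n i \<in> cball 0 (B (Q i)) \<times> {0..1}" for n i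
    using \<Psi>B[of "Q i" n] B0[of "Q i"] \<psi>(1)[of n] \<psi>(7)[of n] by (auto simp: Y_def Q_def)
  obtain r L where r: "strict_mono r" "\<And>i. (\<lambda>n. Y (r n) i) \<longlonglongrightarrow> L i"
    using pointwise_convergent_subsequence[of "\<lambda>i. cball 0 (B (Q i)) \<times> {0..1}" Y, OF Yc YK] by metis
  have rT: "\<forall>\<^sub>F n in sequentially. t \<le> T (r n)" for t
  proof -
    obtain N :: nat where N: "t \<le> real N" using real_arch_simple by blast
    have "t \<le> T (r n)" if "n \<ge> N" for n
      using N that seq_suble[OF r(1), of n] T[of "r n"] by (meson of_nat_mono order_trans)
    then show ?thesis unfolding eventually_sequentially by blast
  qed
  have er0: "(\<lambda>n. e (r n)) \<longlonglongrightarrow> 0" and halfr: "(\<lambda>n. (1/2::real)^(r n)) \<longlonglongrightarrow> 0"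
    and xr: "0 \<le> t \<Longrightarrow> (\<lambda>n. x (r n) t) \<longlonglongrightarrow> x0 t" for t
    using LIMSEQ_subseq_LIMSEQ[OF e0 r(1)] LIMSEQ_subseq_LIMSEQ[OF half r(1)] LIMSEQ_subseq_LIMSEQ[OF xlim r(1)]
    by (auto simp: comp_def)
  define lam where "lam = snd (L 0)"
  have llim: "(\<lambda>n. l (r n)) \<longlonglongrightarrow> lam" using tendsto_snd[OF r(2)[of 0]] by (simp add: Y_def lam_def)
  \<comment> \<open>equicontinuity extends the convergence from the rationals to all times\<close>
  have conv: "\<exists>p. (\<lambda>n. \<Psi> (r n) t) \<longlonglongrightarrow> p" if t: "0 \<le> t" for t
  proof -
    have "Cauchy (\<lambda>n. \<Psi> (r n) t)"
    proof (rule CauchyI)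
      fix \<epsilon> :: real assume \<epsilon>: "0 < \<epsilon>"
      have "continuous_on {0..} (\<lambda>s. integral {0..s} NB)" by (rule continuous_indefinite_integral[OF NBl])
      then obtain d where d: "d > 0" "\<And>s. s \<in> {0..} \<Longrightarrow> dist s t < d \<Longrightarrow> dist (integral {0..s} NB) (integral {0..t} NB) < \<epsilon> / 3"
        using t \<epsilon> unfolding continuous_on_iff by (metis atLeast_iff divide_pos_pos zero_less_numeral)
      obtain \<rho> where \<rho>: "t < real_of_rat \<rho>" "real_of_rat \<rho> < t + d" using of_rat_dense[of t "t + d"] d(1) by auto
      define i where "i = to_nat \<rho>"
      have "0 \<le> real_of_rat \<rho>" by (rule order_trans[OF t less_imp_le[OF \<rho>(1)]])
      then have \<rho>0: "0 \<le> \<rho>" by (simp only: zero_le_of_rat_iff)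
      then have Qi: "Q i = real_of_rat \<rho>" by (simp add: Q_def i_def)
      have small: "norm (\<Psi> n (Q i) - \<Psi> n t) < \<epsilon> / 3" if "Q i \<le> T n" for n
      proof -
        have tQ: "t \<le> Q i" using \<rho> Qi by simp
        have "\<Psi> n (Q i) - \<Psi> n t = integral {t..Q i} (\<zeta> n)"
          using \<Psi>\<zeta>[of "Q i" n] \<Psi>\<zeta>[of t n] t tQ that integral_diff_indefinite[OF \<zeta>l t tQ, of n] by simp
        also have "norm \<dots> \<le> integral {t..Q i} NB"
          by (rule norm_integral_le_dominated[OF \<zeta>l NBl t]) (use \<zeta>N t in auto)
        also have "\<dots> = integral {0..Q i} NB - integral {0..t} NB" using integral_diff_indefinite[OF NBl t tQ] by simp
        also have "\<dots> < \<epsilon> / 3"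
        proof -
          have "dist (integral {0..Q i} NB) (integral {0..t} NB) < \<epsilon> / 3"
            by (rule d(2)) (use \<rho> t tQ \<rho>0 in \<open>simp_all add: dist_real_def Qi\<close>)
          then show ?thesis unfolding dist_real_def by linarith
        qed
        finally show ?thesis .
      qed
      have "Cauchy (\<lambda>n. fst (Y (r n) i))" using tendsto_fst[OF r(2)[of i]] by (rule LIMSEQ_imp_Cauchy)
      then obtain N1 where N1: "\<And>a b. N1 \<le> a \<Longrightarrow> N1 \<le> b \<Longrightarrow> norm (fst (Y (r a) i) - fst (Y (r b) i)) < \<epsilon> / 3"
        using CauchyD[of _ "\<epsilon> / 3"] \<epsilon> by (metis divide_pos_pos zero_less_numeral)
      obtain N2 where N2: "\<And>a. N2 \<le> a \<Longrightarrow> Q i \<le> T (r a)" using rT[of "Q i"] unfolding eventually_sequentially by blast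
      have "norm (\<Psi> (r a) t - \<Psi> (r b) t) < \<epsilon>" if ab: "max N1 N2 \<le> a" "max N1 N2 \<le> b" for a b
      proof -
        have s: "norm (\<Psi> (r a) (Q i) - \<Psi> (r a) t) < \<epsilon> / 3" "norm (\<Psi> (r b) (Q i) - \<Psi> (r b) t) < \<epsilon> / 3"
          "norm (\<Psi> (r a) (Q i) - \<Psi> (r b) (Q i)) < \<epsilon> / 3"
          using small N2 ab N1[of a b] by (auto simp: Y_def)
        have "\<Psi> (r a) t - \<Psi> (r b) t = (\<Psi> (r a) (Q i) - \<Psi> (r b) (Q i)) - ((\<Psi> (r a) (Q i) - \<Psi> (r a) t) - (\<Psi> (r b) (Q i) - \<Psi> (r b) t))" by simp
        then have "norm (\<Psi> (r a) t - \<Psi> (r b) t) \<le> norm (\<Psi> (r a) (Q i) - \<Psi> (r b) (Q i)) +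
          (norm (\<Psi> (r a) (Q i) - \<Psi> (r a) t) + norm (\<Psi> (r b) (Q i) - \<Psi> (r b) t))"
          by (simp only: order_trans[OF norm_triangle_ineq4 add_left_mono[OF norm_triangle_ineq4]])
        then show ?thesis using s by linarith
      qed
      then show "\<exists>N. \<forall>a\<ge>N. \<forall>b\<ge>N. norm (\<Psi> (r a) t - \<Psi> (r b) t) < \<epsilon>" by blast
    qed
    then show ?thesis by (simp add: Cauchy_convergent_iff convergent_def)
  qed
  define p where "p t = lim (\<lambda>n. \<Psi> (r n) t)" for t
  have plim: "(\<lambda>n. \<Psi> (r n) t) \<longlonglongrightarrow> p t" if "0 \<le> t" for t
    using conv[OF that] unfolding p_def by (metis limI)
  have lam0: "0 \<le> lam" by (rule tendsto_lowerbound[OF llim]) (use \<psi>(1) in auto)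
  have norm1: "lam + norm (p 0) = 1"
  proof -
    have "(\<lambda>n. l (r n) + norm (\<Psi> (r n) 0)) \<longlonglongrightarrow> lam + norm (p 0)" by (intro tendsto_intros llim plim) simp
    then show ?thesis using \<psi>(2) by (simp add: LIMSEQ_const_iff)
  qed
  have prim: "(\<lambda>n. integral {0..t} (\<zeta> (r n))) \<longlonglongrightarrow> p t - p 0" if t: "0 \<le> t" for t
  proof (rule Lim_transform_eventually)
    show "(\<lambda>n. \<Psi> (r n) t - \<Psi> (r n) 0) \<longlonglongrightarrow> p t - p 0" by (intro tendsto_intros plim t) simp
    show "\<forall>\<^sub>F n in sequentially. \<Psi> (r n) t - \<Psi> (r n) 0 = integral {0..t} (\<zeta> (r n))"
      using rT[of t] by eventually_elim (simp only: \<Psi>\<zeta>[OF t] add_diff_cancel_left')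
  qed
  obtain \<phi> where \<phi>: "loc_int \<phi>" "\<And>t. 0 \<le> t \<Longrightarrow> p t - p 0 = integral {0..t} \<phi>"
    "AE t in lebesgue. 0 \<le> t \<longrightarrow> (\<forall>v c. (\<forall>\<^sub>F n in sequentially. \<zeta> (r n) t \<bullet> v \<le> c) \<longrightarrow> \<phi> t \<bullet> v \<le> c)"
    by (rule limit_of_primitives[of "\<lambda>n. \<zeta> (r n)" NB "\<lambda>t. p t - p 0", OF \<zeta>l NBl \<zeta>N prim], assumption, assumption) (rule that)
  have clarke: "AE t in lebesgue. 0 \<le> t \<longrightarrow> - \<phi> t \<in> clarke_gradient (\<lambda>y. hamiltonian f g y t (u0 t) lam (p t)) (x0 t)"
    using \<phi>(3) wev
  proof eventually_elim
    case (elim t)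
    show ?case
    proof
      assume t: "0 \<le> t"
      note ut = selectorsD(1)[OF u0 t]
      let ?h = "\<lambda>y. hamiltonian f g y t (u0 t) lam (p t)"
      have "\<forall>\<^sub>F n in sequentially. w n t = u0 t" using elim(2) t by simp
      then have wr: "\<forall>\<^sub>F n in sequentially. w (r n) t = u0 t" by (rule eventually_subseq[OF r(1)])
      have key: "- \<phi> t \<bullet> v \<le> c" if c: "clarke_deriv ?h (x0 t) v < ereal c" for v c
      proof -
        have "\<forall>\<^sub>F n in sequentially. ham_grad (q (r n)) (l (r n)) (\<Psi> (r n) t) t (x (r n) t) (u0 t) \<bullet> v \<le> c"
          by (rule smooth_grad_limit_clarke[where e="\<lambda>n. e (r n)" and X="\<lambda>n. x (r n) t" and \<Psi>="\<lambda>n. \<Psi> (r n) t" and l="\<lambda>n. l (r n)",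
                OF t ut x0b[OF t] xb[OF t] xr[OF t] e(1) e1 er0 kq llim plim[OF t] c])
        then have "\<forall>\<^sub>F n in sequentially. \<zeta> (r n) t \<bullet> (- v) \<le> c"
          using wr rT[of t] by eventually_elim (simp add: \<zeta>_def)
        then have "\<phi> t \<bullet> (- v) \<le> c" using elim(1) t by blast
        then show ?thesis by simp
      qed
      show "- \<phi> t \<in> clarke_gradient ?h (x0 t)"
        unfolding clarke_gradient_def
      proof (intro CollectI allI, rule ccontr)
        fix v assume "\<not> ereal (- \<phi> t \<bullet> v) \<le> clarke_deriv ?h (x0 t) v"
        then have "clarke_deriv ?h (x0 t) v < ereal (- \<phi> t \<bullet> v)" by (simp only: not_le)
        then obtain c where c: "clarke_deriv ?h (x0 t) v < ereal c" "ereal c < ereal (- \<phi> t \<bullet> v)"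
          using ereal_dense2 by blast
        have "- \<phi> t \<bullet> v \<le> c" by (rule key[OF c(1)])
        then show False using c(2) by (simp only: less_ereal.simps)
      qed
    qed
  qed
  have max: "AE t in lebesgue. 0 \<le> t \<longrightarrow> (\<forall>j. hamiltonian f g (x0 t) t (v j t) lam (p t) \<le> hamiltonian f g (x0 t) t (u0 t) lam (p t))"
  proof -
    have gapAE: "AE t in lebesgue. 0 \<le> t \<longrightarrow> (\<forall>\<^sub>F n in sequentially. \<not> 3 * (1/2)^n * M t < 
        ham (k n) (l n) (\<Psi> n t) t (x n t) (v j t) - ham (k n) (l n) (\<Psi> n t) t (x n t) (w n t))" for j
    proof (rule AE_eventually_not[where T=T and c=1, OF _ gap[OF v] T])
      fix n
      have lH: "loc_int (\<lambda>t. ham (k n) (l n) (\<Psi> n t) t (x n t) (u t))" if u: "u \<in> selectors U" for u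
        by (rule loc_int_ham_along[OF kq e(1) e1 \<psi>(3) u trajectoryD(1)[OF x] xb])
      have "{t\<in>space (lebesgue_on {0..}). 3 * (1/2)^n * M t < 
        ham (k n) (l n) (\<Psi> n t) t (x n t) (v j t) - ham (k n) (l n) (\<Psi> n t) t (x n t) (w n t)} \<in> sets (lebesgue_on {0..})"
        by (rule borel_measurable_less[OF loc_int_measurable[OF loc_int_mult[OF M(1)]] loc_int_measurable[OF loc_int_diff[OF lH[OF v] lH[OF w]]]])
      then show "{t\<in>{0..}. 3 * (1/2)^n * M t < 
        ham (k n) (l n) (\<Psi> n t) t (x n t) (v j t) - ham (k n) (l n) (\<Psi> n t) t (x n t) (w n t)} \<in> sets (lebesgue_on {0..})" by simp
    qed
    then have "AE t in lebesgue. \<forall>j. 0 \<le> t \<longrightarrow> (\<forall>\<^sub>F n in sequentially. \<not> 3 * (1/2)^n * M t < 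
        ham (k n) (l n) (\<Psi> n t) t (x n t) (v j t) - ham (k n) (l n) (\<Psi> n t) t (x n t) (w n t))"
      unfolding AE_all_countable by (rule allI)
    then show ?thesis using wev
    proof eventually_elim
      case (elim t)
      show ?case
      proof (intro impI allI)
        fix j assume t: "0 \<le> t"
        note ut = selectorsD(1)[OF u0 t] and vt = selectorsD(1)[OF v t, of j]
        have hl: "(\<lambda>n. ham (k (r n)) (l (r n)) (\<Psi> (r n) t) t (x (r n) t) a) \<longlonglongrightarrow> hamiltonian f g (x0 t) t a lam (p t)"
          if a: "a \<in> U t" for a
          by (rule ham_limit[where e="\<lambda>n. e (r n)" and X="\<lambda>n. x (r n) t" and \<Psi>="\<lambda>n. \<Psi> (r n) t" and l="\<lambda>n. l (r n)" and k="\<lambda>n. k (r n)",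
                OF t a x0b[OF t] xb[OF t] xr[OF t] e(1) e1 er0 kq llim plim[OF t]])
        have "\<forall>\<^sub>F n in sequentially. w n t = u0 t" using elim(2) t by simp
        moreover have "\<forall>\<^sub>F n in sequentially. \<not> 3 * (1/2)^n * M t < 
            ham (k n) (l n) (\<Psi> n t) t (x n t) (v j t) - ham (k n) (l n) (\<Psi> n t) t (x n t) (w n t)" using elim(1) t by blast
        ultimately have "\<forall>\<^sub>F n in sequentially. 
            ham (k n) (l n) (\<Psi> n t) t (x n t) (v j t) - ham (k n) (l n) (\<Psi> n t) t (x n t) (u0 t) \<le> 3 * (1/2)^n * M t"
          by eventually_elim simp
        from eventually_subseq[OF r(1) this]
        have "\<forall>\<^sub>F n in sequentially. ham (k (r n)) (l (r n)) (\<Psi> (r n) t) t (x (r n) t) (v j t) -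
            ham (k (r n)) (l (r n)) (\<Psi> (r n) t) t (x (r n) t) (u0 t) \<le> 3 * (1/2)^(r n) * M t" .
        moreover have "(\<lambda>n. ham (k (r n)) (l (r n)) (\<Psi> (r n) t) t (x (r n) t) (v j t) -
            ham (k (r n)) (l (r n)) (\<Psi> (r n) t) t (x (r n) t) (u0 t)) \<longlonglongrightarrow>
            hamiltonian f g (x0 t) t (v j t) lam (p t) - hamiltonian f g (x0 t) t (u0 t) lam (p t)"
          by (intro tendsto_diff hl ut vt)
        moreover have "(\<lambda>n. 3 * (1/2)^(r n) * M t) \<longlonglongrightarrow> 3 * 0 * M t" by (intro tendsto_intros halfr)
        ultimately have "hamiltonian f g (x0 t) t (v j t) lam (p t) - hamiltonian f g (x0 t) t (u0 t) lam (p t) \<le> 3 * 0 * M t"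
          by (intro tendsto_le[OF trivial_limit_sequentially])
        then show "hamiltonian f g (x0 t) t (v j t) lam (p t) \<le> hamiltonian f g (x0 t) t (u0 t) lam (p t)" by simp
      qed
    qed
  qed
  show ?thesis
  proof (rule that[OF lam0 norm1 \<phi>(1) _ clarke max])
    show "p t = p 0 + integral {0..t} \<phi>" if "0 \<le> t" for t
      unfolding \<phi>(2)[OF that, symmetric] by (simp add: algebra_simps)
  qed
qed

end

section \<open>The maximum principle\<close>

lemma L1_locD:
  assumes "l \<in> L1_loc"
  shows "loc_int l" "\<And>t. 0 \<le> t \<Longrightarrow> 0 \<le> l t"
proof -
  have "set_integrable lebesgue {0..T} l" for T
    using assms unfolding L1_loc_def by (auto intro: compact_Icc)
  then show "loc_int l" by (simp add: loc_int_def)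
  show "0 \<le> l t" if "0 \<le> t" for t using assms that by (simp add: L1_loc_def)
qed

text \<open>Bounds that are available on each bounded interval are combined into a single one for the half-line: the one
  with index \<open>j\<close> is used from time \<open>j\<close> to time \<open>j + 1\<close>.\<close>

lemma loc_int_paste:
  assumes l: "\<And>j::nat. loc_int (l j)" "\<And>j t. 0 \<le> t \<Longrightarrow> 0 \<le> l j t"
  shows "loc_int (\<lambda>t. l (nat \<lfloor>t\<rfloor>) t :: real)"
proof -
  have meas: "(\<lambda>t. l (nat \<lfloor>t\<rfloor>) t) \<in> borel_measurable (lebesgue_on {0..})"
  proof (rule measurable_compose_countable'[where I=UNIV and f=l and g="\<lambda>t. nat \<lfloor>t\<rfloor>"])
    show "l j \<in> borel_measurable (lebesgue_on {0..})" for j by (rule loc_int_measurable[OF l(1)])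
    have "(\<lambda>t::real. nat \<lfloor>t\<rfloor>) \<in> borel \<rightarrow>\<^sub>M count_space UNIV" by measurable
    then show "(\<lambda>t::real. nat \<lfloor>t\<rfloor>) \<in> lebesgue_on {0..} \<rightarrow>\<^sub>M count_space UNIV"
      by (intro measurable_restrict_space1 measurable_completion) (simp only: measurable_lborel1 measurable_lborel2)
  qed simp
  show ?thesis
    unfolding loc_int_def
  proof
    fix T :: real
    have sum: "loc_int (\<lambda>t. \<Sum>j\<le>n. l j t)" for n
    proof (induction n)
      case (Suc n)
      then show ?case using loc_int_add[OF Suc l(1)[of "Suc n"]] by simp
    qed (simp add: l(1))
    show "(\<lambda>t. l (nat \<lfloor>t\<rfloor>) t) absolutely_integrable_on {0..T}"
    proof (rule measurable_bounded_by_integrable_imp_absolutely_integrable)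
      show "(\<lambda>t. l (nat \<lfloor>t\<rfloor>) t) \<in> borel_measurable (lebesgue_on {0..T})"
        by (rule measurable_lebesgue_on_subset[OF meas order_refl])
      show "(\<lambda>t. \<Sum>j\<le>nat \<lfloor>T\<rfloor>. l j t) integrable_on {0..T}" by (rule loc_int_integrable[OF sum order_refl])
      fix t assume t: "t \<in> {0..T}"
      then have "nat \<lfloor>t\<rfloor> \<in> {..nat \<lfloor>T\<rfloor>}" by (simp add: nat_mono floor_mono)
      then have "l (nat \<lfloor>t\<rfloor>) t \<le> (\<Sum>j\<le>nat \<lfloor>T\<rfloor>. l j t)" using t l(2) by (intro member_le_sum) auto
      then show "norm (l (nat \<lfloor>t\<rfloor>) t) \<le> (\<Sum>j\<le>nat \<lfloor>T\<rfloor>. l j t)" using l(2) t by simp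
    qed simp
  qed
qed

text \<open>Since \<open>R\<close> increases, the points \<open>(t, x)\<close> with \<open>t \<le> j + 1\<close> and \<open>norm x \<le> R t\<close> lie in one compact cylinder for each \<open>j\<close>.\<close>

lemma integrally_bounded_uniform:
  fixes a :: "real \<Rightarrow> 'e::euclidean_space \<Rightarrow> 'u::euclidean_space \<Rightarrow> 'f::euclidean_space" and R :: "real \<Rightarrow> real"
  assumes a: "integrally_bounded U a" and R: "\<And>s t. 0 \<le> s \<Longrightarrow> s \<le> t \<Longrightarrow> R s \<le> R t"
  obtains l where "loc_int l" "\<And>t. 0 \<le> t \<Longrightarrow> 0 \<le> l t"
    "\<And>t x p. 0 \<le> t \<Longrightarrow> p \<in> U t \<Longrightarrow> norm x \<le> R t \<Longrightarrow> norm (a t x p) \<le> l t"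
proof -
  have "\<exists>l\<in>L1_loc. \<forall>t x p. (t, x) \<in> {0..real j + 1} \<times> cball 0 (R (real j + 1)) \<and> p \<in> U t \<longrightarrow> norm (a t x p) \<le> l t" for j :: nat
  proof -
    have "compact ({0..real j + 1} \<times> cball (0::'e) (R (real j + 1)))" "{0..real j + 1} \<times> cball 0 (R (real j + 1)) \<subseteq> {0..} \<times> UNIV"
      by (intro compact_Times compact_Icc compact_cball) auto
    then show ?thesis using a unfolding integrally_bounded_def by blast
  qed
  then obtain l where l: "\<And>j::nat. l j \<in> L1_loc"
    "\<And>j t x p. (t, x) \<in> {0..real j + 1} \<times> cball 0 (R (real j + 1)) \<Longrightarrow> p \<in> U t \<Longrightarrow> norm (a t x p) \<le> l j t" by metis
  show ?thesis
  proof (rule that[of "\<lambda>t. l (nat \<lfloor>t\<rfloor>) t"])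
    show "loc_int (\<lambda>t. l (nat \<lfloor>t\<rfloor>) t)" by (rule loc_int_paste) (use L1_locD[OF l(1)] in auto)
    fix t :: real assume t: "0 \<le> t"
    show "0 \<le> l (nat \<lfloor>t\<rfloor>) t" by (rule L1_locD(2)[OF l(1) t])
    fix x :: 'e and p assume p: "p \<in> U t" and x: "norm x \<le> R t"
    have t1: "t \<le> real (nat \<lfloor>t\<rfloor>) + 1" using t by linarith
    show "norm (a t x p) \<le> l (nat \<lfloor>t\<rfloor>) t"
      by (rule l(2)[OF _ p]) (use t t1 x R[OF t t1] in auto)
  qed
qed

lemma locally_lipschitz_uniform:
  fixes a :: "real \<Rightarrow> 'e::euclidean_space \<Rightarrow> 'u::euclidean_space \<Rightarrow> 'f::euclidean_space" and R :: "real \<Rightarrow> real"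
  assumes a: "locally_lipschitz U a" and R: "\<And>s t. 0 \<le> s \<Longrightarrow> s \<le> t \<Longrightarrow> R s \<le> R t"
  obtains l where "loc_int l" "\<And>t. 0 \<le> t \<Longrightarrow> 0 \<le> l t"
    "\<And>t x y p. 0 \<le> t \<Longrightarrow> p \<in> U t \<Longrightarrow> norm x \<le> R t \<Longrightarrow> norm y \<le> R t \<Longrightarrow> norm (a t x p - a t y p) \<le> l t * norm (x - y)"
proof -
  have "\<exists>l\<in>L1_loc. \<forall>t x y p. (t, x) \<in> {0..real j + 1} \<times> cball 0 (R (real j + 1)) \<and> (t, y) \<in> {0..real j + 1} \<times> cball 0 (R (real j + 1)) \<and> p \<in> U t
      \<longrightarrow> norm (a t x p - a t y p) \<le> l t * norm (x - y)" for j :: nat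
  proof -
    have "compact ({0..real j + 1} \<times> cball (0::'e) (R (real j + 1)))" "{0..real j + 1} \<times> cball 0 (R (real j + 1)) \<subseteq> {0..} \<times> UNIV"
      by (intro compact_Times compact_Icc compact_cball) auto
    then show ?thesis using a unfolding locally_lipschitz_def by blast
  qed
  then obtain l where l: "\<And>j::nat. l j \<in> L1_loc"
    "\<And>j t x y p. (t, x) \<in> {0..real j + 1} \<times> cball 0 (R (real j + 1)) \<Longrightarrow> (t, y) \<in> {0..real j + 1} \<times> cball 0 (R (real j + 1)) \<Longrightarrow>
      p \<in> U t \<Longrightarrow> norm (a t x p - a t y p) \<le> l j t * norm (x - y)" by metis
  show ?thesis
  proof (rule that[of "\<lambda>t. l (nat \<lfloor>t\<rfloor>) t"])
    show "loc_int (\<lambda>t. l (nat \<lfloor>t\<rfloor>) t)" by (rule loc_int_paste) (use L1_locD[OF l(1)] in auto)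
    fix t :: real assume t: "0 \<le> t"
    show "0 \<le> l (nat \<lfloor>t\<rfloor>) t" by (rule L1_locD(2)[OF l(1) t])
    fix x y :: 'e and p assume p: "p \<in> U t" and x: "norm x \<le> R t" "norm y \<le> R t"
    have t1: "t \<le> real (nat \<lfloor>t\<rfloor>) + 1" using t by linarith
    show "norm (a t x p - a t y p) \<le> l (nat \<lfloor>t\<rfloor>) t * norm (x - y)"
      by (rule l(2)[OF _ _ p]) (use t t1 x R[OF t t1] in auto)
  qed
qed

lemma abs_cont_on_imp_continuous_on:
  assumes "abs_cont_on a b x"
  shows "continuous_on {a..b} x"
  unfolding continuous_on_iff
proof (intro ballI allI impI)
  fix s \<epsilon> :: real assume s: "s \<in> {a..b}" and "0 < \<epsilon>"
  then obtain \<delta> where \<delta>: "\<delta> > 0" "\<And>d S. d division_of S \<Longrightarrow> S \<subseteq> {a..b} \<Longrightarrow> (\<Sum>k\<in>d. Sup k - Inf k) < \<delta> \<Longrightarrow>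
      (\<Sum>k\<in>d. norm (x (Sup k) - x (Inf k))) < \<epsilon>"
    using assms unfolding abs_cont_on_def by metis
  have *: "norm (x v - x u) < \<epsilon>" if uv: "a \<le> u" "u \<le> v" "v \<le> b" "v - u < \<delta>" for u v
    using \<delta>(2)[of "{{u..v}}" "{u..v}"] uv division_of_self[of u v] by simp
  have "dist (x t) (x s) < \<epsilon>" if t: "t \<in> {a..b}" "dist t s < \<delta>" for t
  proof (cases "s \<le> t")
    case True
    then show ?thesis using *[of s t] s t by (auto simp: dist_norm)
  next
    case False
    then show ?thesis using *[of t s] s t by (auto simp: dist_norm norm_minus_commute)
  qed
  then show "\<exists>\<delta>>0. \<forall>t\<in>{a..b}. dist t s < \<delta> \<longrightarrow> dist (x t) (x s) < \<epsilon>" using \<delta>(1) by blast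
qed

lemma primitive_loc_abs_cont:
  fixes h :: "real \<Rightarrow> 'e::euclidean_space"
  assumes h: "loc_int h" and x: "\<And>t. 0 \<le> t \<Longrightarrow> x t = c + integral {0..t} h"
  shows "loc_abs_cont x"
    "AE t\<in>{0..} in lebesgue. (x has_vector_derivative h t) (at t within {0..})"
proof -
  show "loc_abs_cont x" unfolding loc_abs_cont_def
  proof (intro allI impI, elim conjE)
    fix a b :: real assume ab: "0 \<le> a" "a \<le> b"
    show "abs_cont_on a b x"
    proof (rule dominated_imp_abs_cont_on[where m="\<lambda>t. norm (h t)"])
      show "(\<lambda>t. norm (h t)) absolutely_integrable_on {a..b}" by (rule loc_intD[OF ab(1) loc_int_norm[OF h]])
      fix r s assume rs: "a \<le> r" "r \<le> s" "s \<le> b"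
      have "x s - x r = integral {r..s} h" using x[of s] x[of r] rs ab integral_diff_indefinite[OF h, of r s] by simp
      then show "norm (x s - x r) \<le> integral {r..s} (\<lambda>t. norm (h t))"
        using norm_integral_le_dominated[OF h loc_int_norm[OF h], of r s] rs ab by simp
    qed simp
  qed
  show "AE t\<in>{0..} in lebesgue. (x has_vector_derivative h t) (at t within {0..})"
    using AE_has_derivative_indefinite_integral[OF h]
  proof eventually_elim
    case (elim t)
    show ?case
    proof
      assume t: "t \<in> {0..}"
      with elim have "((\<lambda>t. c + integral {0..t} h) has_vector_derivative h t) (at t within {0..})"
        by (auto intro!: derivative_eq_intros)
      then show "(x has_vector_derivative h t) (at t within {0..})"
        by (rule has_vector_derivative_transform[OF t, rotated]) (use x in auto)
    qed
  qed
qed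

context control_problem begin

text \<open>The two halves of the fundamental theorem of calculus for the Lebesgue integral.\<close>

lemma solves_iff_trajectory:
  assumes u: "u \<in> selectors U"
  shows "solves f u x \<longleftrightarrow> trajectory f u x"
proof
  assume x: "trajectory f u x"
  note x' = primitive_loc_abs_cont[OF trajectoryD(2)[OF x], of x 0]
  show "solves f u x" unfolding solves_def
    using x' trajectoryD(3,4)[OF x] by simp
next
  assume "solves f u x"
  then have ac: "loc_abs_cont x" and x0: "x 0 = 0"
    and der: "AE t\<in>{0..} in lebesgue. (x has_vector_derivative f t (x t) (u t)) (at t within {0..})"
    by (auto simp: solves_def)
  have c: "continuous_on {0..} x"
  proof (rule continuous_on_eq_continuous_within[THEN iffD2], rule ballI)
    fix t :: real assume t: "t \<in> {0..}"
    have "abs_cont_on 0 (t + 1) x" using ac t by (simp add: loc_abs_cont_def)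
    then have "continuous_on {0..t+1} x" by (rule abs_cont_on_imp_continuous_on)
    then have "continuous (at t within {0..t+1}) x"
      using t by (auto simp: continuous_on_eq_continuous_within)
    moreover have "at t within {0..t+1} = at t within {0..}"
      using t by (intro at_within_nhd[of _ "{..<t+1}"]) auto
    ultimately show "continuous (at t within {0..}) x" by simp
  qed
  have lip: "norm (f t x (u t) - f t y (u t)) \<le> m t * norm (x - y)" if "0 \<le> t" for t x y
    by (rule f_lip[OF that selectorsD(1)[OF u that]])
  have li: "loc_int (\<lambda>t. f t (x t) (u t))"
    by (rule loc_int_field_along_curve[OF f_car[OF u] c m(1) lip field_zero_loc_int[OF regular_f u]])
  obtain N where N: "N \<in> null_sets lebesgue"
      "{t\<in>space lebesgue. \<not> (t \<in> {0..} \<longrightarrow> (x has_vector_derivative f t (x t) (u t)) (at t within {0..}))} \<subseteq> N"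
    using der unfolding eventually_ae_filter by blast
  have "x t = integral {0..t} (\<lambda>s. f s (x s) (u s))" if t: "0 \<le> t" for t
  proof -
    have "((\<lambda>s. f s (x s) (u s)) has_integral x t - x 0) {0..t}"
    proof (rule fundamental_theorem_of_calculus_abs_cont[OF t])
      show "abs_cont_on 0 t x" using ac t by (simp add: loc_abs_cont_def)
      show "negligible N" using N by (simp add: negligible_iff_null_sets)
      fix s assume "s \<in> {0..t} - N"
      then have "(x has_vector_derivative f s (x s) (u s)) (at s within {0..})" using N(2) by auto
      then show "(x has_vector_derivative f s (x s) (u s)) (at s within {0..t})"
        by (rule has_vector_derivative_within_subset) auto
    qed
    then show ?thesis using x0 by (simp add: integral_unique)
  qed
  then show "trajectory f u x" using c li by (simp add: trajectory_def)
qed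

lemma traj_eq:
  assumes u: "u \<in> selectors U" and x: "trajectory f u x" and t: "0 \<le> t"
  shows "traj f u t = x t"
proof -
  define y where "y = restrict x {0..}"
  have yx: "y t = x t" if "0 \<le> t" for t using that by (simp add: y_def)
  have y: "trajectory f u y"
  proof -
    have "integral {0..t} (\<lambda>s. f s (y s) (u s)) = integral {0..t} (\<lambda>s. f s (x s) (u s))" for t
      by (rule Henstock_Kurzweil_Integration.integral_cong) (simp add: yx)
    moreover have "continuous_on {0..} y" using trajectoryD(1)[OF x] by (rule continuous_on_eq) (simp add: yx)
    moreover have "loc_int (\<lambda>t. f t (y t) (u t))"
      unfolding loc_int_def
    proof
      fix T
      have "(\<lambda>t. f t (x t) (u t)) absolutely_integrable_on {0..T}" using trajectoryD(2)[OF x] by (simp add: loc_int_def)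
      then show "(\<lambda>t. f t (y t) (u t)) absolutely_integrable_on {0..T}"
        by (rule absolutely_integrable_spike[OF _ negligible_empty]) (simp add: yx)
    qed
    ultimately show ?thesis using trajectoryD(3)[OF x] by (simp add: trajectory_def yx)
  qed
  have "traj f u = y"
    unfolding traj_def
  proof (rule the_equality)
    show "y \<in> extensional {0..} \<and> solves f u y" using y solves_iff_trajectory[OF u] by (simp add: y_def)
    fix z assume z: "z \<in> extensional {0..} \<and> solves f u z"
    then have "trajectory f u z" using solves_iff_trajectory[OF u] by simp
    then have "z t = y t" if "0 \<le> t" for t using trajectory_unique[OF regular_f u _ y that] by blast
    then show "z = y" using z by (intro extensionalityI[of z "{0..}" y]) (auto simp: y_def)
  qed
  then show ?thesis using yx[OF t] by simp
qed

lemma J_eq_cost: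
  assumes u: "u \<in> selectors U" and T: "0 \<le> T"
  shows "J f g T u = cost f g T u"
proof -
  obtain x where x: "trajectory f u x" using trajectory_exists[OF regular_f u] by blast
  note xb = trajectory_bound[OF regular_f u x]
  have li: "loc_int (\<lambda>t. g t (x t) (u t))"
  proof (rule loc_int_dominated[OF caratheodory_field_compose[OF g_car[OF u] continuous_measurable[OF trajectoryD(1)[OF x]]] M(1)])
    show "norm (g t (x t) (u t)) \<le> M t" if "0 \<le> t" for t
      using g_bound[OF that selectorsD(1)[OF u that], of "x t"] xb[OF that] by simp
  qed
  have "J f g T u = (LINT t:{0..T}|lebesgue. g t (x t) (u t))"
    unfolding J_def by (rule set_lebesgue_integral_cong) (use traj_eq[OF u x] in auto)
  also have "\<dots> = integral {0..T} (\<lambda>t. g t (x t) (u t))"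
    by (rule set_lebesgue_integral_eq_integral(2)) (use li in \<open>simp add: loc_int_def\<close>)
  finally show ?thesis using cost_eq[OF regular_f u x] by simp
qed

end

theorem theorem1:
  fixes U :: "real \<Rightarrow> 'u::euclidean_space set"
    and f :: "real \<Rightarrow> real ^ 'm \<Rightarrow> 'u \<Rightarrow> real ^ 'm"
    and g :: "real \<Rightarrow> real ^ 'm \<Rightarrow> 'u \<Rightarrow> real"
    and x0 :: "real \<Rightarrow> real ^ 'm"
    and u0 :: "real \<Rightarrow> 'u"
  assumes u: "condition_u U"
    and fg: "condition_fg U f g"
    and meas_f: "superposition_measurable U f"
    and meas_g: "superposition_measurable U g"
    and x0: "continuous_on {0..} x0"
    and opt: "unif_overtaking_optimal_pair U f g x0 u0"
  shows "\<exists>lam0\<in>{0..1}. \<exists>psi0. continuous_on {0..} psi0 \<and> (x0, u0, lam0, psi0) \<in> extremals U f g"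
proof -
  have u0: "u0 \<in> selectors U" and ov: "\<And>\<epsilon>. \<epsilon> > 0 \<Longrightarrow> \<exists>T>0. \<forall>u\<in>selectors U. \<forall>t\<ge>T. J f g t u0 \<ge> J f g t u - \<epsilon>"
    and x0t: "\<And>t. 0 \<le> t \<Longrightarrow> x0 t = traj f u0 t"
    using opt by (auto simp: unif_overtaking_optimal_pair_def unif_overtaking_optimal_def)
  have cf: "caratheodory U f" "integrally_bounded U f" "continuability U f"
    and cg: "caratheodory U g" "integrally_bounded U g" "locally_lipschitz U g"
    using fg by (auto simp: condition_fg_def)
  obtain L where L: "L \<in> L1_loc" "\<forall>K. compact K \<and> K \<subseteq> {0..} \<times> UNIV \<longrightarrow>
        (\<forall>t x x' p. (t, x) \<in> K \<and> (t, x') \<in> K \<and> p \<in> U t \<longrightarrow> norm (f t x p - f t x' p) \<le> L t * norm (x - x'))"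
    using cf(3) unfolding continuability_def by (elim conjE bexE)
  \<comment> \<open>\<open>L\<close> serves all compact sets, so the finite set with these two points suffices\<close>
  have Llip: "norm (f t x p - f t y p) \<le> L t * norm (x - y)" if "0 \<le> t" "p \<in> U t" for t x y p
    using L(2)[rule_format, of "{t} \<times> {x, y}" t x y p] that by (auto intro!: compact_Times finite_imp_compact)
  obtain m1 where m1: "loc_int m1" "\<And>t. 0 \<le> t \<Longrightarrow> 0 \<le> m1 t"
    "\<And>t x p. 0 \<le> t \<Longrightarrow> p \<in> U t \<Longrightarrow> norm x \<le> 1 \<Longrightarrow> norm (f t x p) \<le> m1 t"
    by (rule integrally_bounded_uniform[OF cf(2), of "\<lambda>_. 1"]) (auto intro: that)
  define m where "m t = L t + m1 t" for t
  have m: "loc_int m" "\<And>t. 0 \<le> t \<Longrightarrow> 0 \<le> m t"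
    unfolding m_def using L1_locD[OF L(1)] m1 by (auto intro: loc_int_add)
  have R: "radius m s + 2 \<le> radius m t + 2" if "0 \<le> s" "s \<le> t" for s t
    using radius_mono[OF m that] by simp
  obtain lf where lf: "loc_int lf" "\<And>t. 0 \<le> t \<Longrightarrow> 0 \<le> lf t"
    "\<And>t x p. 0 \<le> t \<Longrightarrow> p \<in> U t \<Longrightarrow> norm x \<le> radius m t + 2 \<Longrightarrow> norm (f t x p) \<le> lf t"
    by (rule integrally_bounded_uniform[OF cf(2) R]) (auto intro: that)
  obtain lg where lg: "loc_int lg" "\<And>t. 0 \<le> t \<Longrightarrow> 0 \<le> lg t"
    "\<And>t x p. 0 \<le> t \<Longrightarrow> p \<in> U t \<Longrightarrow> norm x \<le> radius m t + 2 \<Longrightarrow> norm (g t x p) \<le> lg t"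
    by (rule integrally_bounded_uniform[OF cg(2) R]) (auto intro: that)
  obtain kg where kg: "loc_int kg" "\<And>t. 0 \<le> t \<Longrightarrow> 0 \<le> kg t"
    "\<And>t x y p. 0 \<le> t \<Longrightarrow> p \<in> U t \<Longrightarrow> norm x \<le> radius m t + 2 \<Longrightarrow> norm y \<le> radius m t + 2 \<Longrightarrow> norm (g t x p - g t y p) \<le> kg t * norm (x - y)"
    by (rule locally_lipschitz_uniform[OF cg(3) R]) (auto intro: that)
  define M where "M t = 1 + m t + lf t + lg t + kg t" for t
  have M: "loc_int M" "1 \<le> M t" "m t \<le> M t" "lf t \<le> M t" "lg t \<le> M t" "kg t \<le> M t" if "0 \<le> t" for t
    unfolding M_def using m(2)[OF that] lf(2)[OF that] lg(2)[OF that] kg(2)[OF that]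
    by (auto intro!: loc_int_add loc_int_const m(1) lf(1) lg(1) kg(1))
  have cont: "continuous_on UNIV (\<lambda>x. a t x p)" if "caratheodory U a" "0 \<le> t" "p \<in> U t"
    for a :: "real \<Rightarrow> real ^ 'm \<Rightarrow> 'u \<Rightarrow> 'f::euclidean_space" and t p
  proof -
    have c: "continuous_on (UNIV \<times> U t) (\<lambda>(y, p). a t y p)" using that by (simp add: caratheodory_def)
    have "continuous_on UNIV (\<lambda>x::real ^ 'm. (x, p))" by (intro continuous_on_Pair continuous_on_id continuous_on_const)
    from continuous_on_compose2[OF c this] that show ?thesis by auto
  qed
  have car: "caratheodory_field (\<lambda>t x. a t x (u t))" if "caratheodory U a" "superposition_measurable U a" "u \<in> selectors U"
    for a :: "real \<Rightarrow> real ^ 'm \<Rightarrow> 'u \<Rightarrow> 'f::euclidean_space" and u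
    using that cont[OF that(1)] unfolding caratheodory_field_def superposition_measurable_def selectors_def by auto
  interpret control_problem U f g m M
  proof
    show "norm (f t x p - f t y p) \<le> m t * norm (x - y)" if "0 \<le> t" "p \<in> U t" for t x y p
      using Llip[OF that, of x y] mult_right_mono[of "L t" "m t" "norm (x - y)"] m1(2)[OF that(1)] by (simp add: m_def)
    show "norm (f t x p) \<le> m t" if "0 \<le> t" "p \<in> U t" "norm x \<le> 1" for t x p
      using m1(3)[OF that] L1_locD(2)[OF L(1) that(1)] by (simp add: m_def)
    show "norm (f t x p) \<le> M t" if "0 \<le> t" "p \<in> U t" "norm x \<le> radius m t + 2" for t x p
      using lf(3)[OF that] M(4)[OF that(1)] by simp
    show "\<bar>g t x p\<bar> \<le> M t" if "0 \<le> t" "p \<in> U t" "norm x \<le> radius m t + 2" for t x p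
      using lg(3)[OF that] M(5)[OF that(1)] by simp
    show "\<bar>g t x p - g t y p\<bar> \<le> M t * norm (x - y)"
      if "0 \<le> t" "p \<in> U t" "norm x \<le> radius m t + 2" "norm y \<le> radius m t + 2" for t x y p
      using kg(3)[OF that] mult_right_mono[OF M(6)[OF that(1)], of "norm (x - y)"] by simp
    show "loc_int M" by (rule M(1)[OF order_refl])
  qed (use M m cont car cf(1) cg(1) meas_f meas_g in auto)
  obtain x where x: "trajectory f u0 x" using trajectory_exists[OF regular_f u0] by blast
  have x0x: "x0 t = x t" if "0 \<le> t" for t using traj_eq[OF u0 x that] x0t[OF that] by simp
  have ov': "\<exists>T>0. \<forall>u\<in>selectors U. \<forall>t\<ge>T. cost f g t u \<le> cost f g t u0 + \<epsilon>" if \<epsilon>: "\<epsilon> > 0" for \<epsilon>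
  proof -
    obtain T where T: "T > 0" "\<And>u t. u \<in> selectors U \<Longrightarrow> t \<ge> T \<Longrightarrow> J f g t u0 \<ge> J f g t u - \<epsilon>" using ov[OF \<epsilon>] by blast
    have "cost f g t u \<le> cost f g t u0 + \<epsilon>" if "u \<in> selectors U" "t \<ge> T" for u t
      using T(2)[OF that] J_eq_cost[OF that(1), of t] J_eq_cost[OF u0, of t] T(1) that(2) by simp
    then show ?thesis using T(1) by blast
  qed
  have gU: "graph U \<in> sets borel" and cU: "\<And>t. 0 \<le> t \<Longrightarrow> closed (U t)"
    using u by (auto simp: condition_u_def compact_imp_closed)
  obtain v :: "nat \<Rightarrow> real \<Rightarrow> 'u" where v: "\<And>k. v k \<in> selectors U"
    "AE t in lebesgue. 0 \<le> t \<longrightarrow> U t \<subseteq> closure (range (\<lambda>k. v k t))"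
    using dense_selectors_exist[OF gU cU u0] by blast
  obtain lam \<psi> \<phi> where lam: "0 \<le> lam" "lam + norm (\<psi> 0) = 1" and \<phi>: "loc_int \<phi>" "\<And>t. 0 \<le> t \<Longrightarrow> \<psi> t = \<psi> 0 + integral {0..t} \<phi>"
    and cl: "AE t in lebesgue. 0 \<le> t \<longrightarrow> - \<phi> t \<in> clarke_gradient (\<lambda>y. hamiltonian f g y t (u0 t) lam (\<psi> t)) (x t)"
    and max: "AE t in lebesgue. 0 \<le> t \<longrightarrow> (\<forall>j. hamiltonian f g (x t) t (v j t) lam (\<psi> t) \<le> hamiltonian f g (x t) t (u0 t) lam (\<psi> t))"
    by (rule infinite_horizon[where v=v, OF u0 x ov' v(1)], assumption) (rule that)
  have lam1: "lam \<le> 1" using lam(2) norm_ge_zero[of "\<psi> 0"] by linarith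
  have x0i: "x0 t = 0 + integral {0..t} (\<lambda>s. f s (x0 s) (u0 s))" if t: "0 \<le> t" for t
  proof -
    have "integral {0..t} (\<lambda>s. f s (x0 s) (u0 s)) = integral {0..t} (\<lambda>s. f s (x s) (u0 s))"
      by (rule Henstock_Kurzweil_Integration.integral_cong) (simp add: x0x)
    then show ?thesis using trajectoryD(3)[OF x t] x0x[OF t] by simp
  qed
  have x0l: "loc_int (\<lambda>s. f s (x0 s) (u0 s))"
    unfolding loc_int_def
  proof
    fix T
    have "(\<lambda>t. f t (x t) (u0 t)) absolutely_integrable_on {0..T}" using trajectoryD(2)[OF x] by (simp add: loc_int_def)
    then show "(\<lambda>t. f t (x0 t) (u0 t)) absolutely_integrable_on {0..T}"
      by (rule absolutely_integrable_spike[OF _ negligible_empty]) (simp add: x0x)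
  qed
  have x0p: "loc_abs_cont x0" "AE t\<in>{0..} in lebesgue. (x0 has_vector_derivative f t (x0 t) (u0 t)) (at t within {0..})"
    using primitive_loc_abs_cont[OF x0l, of x0 0] x0i by blast+
  have \<psi>p: "loc_abs_cont \<psi>" "AE t\<in>{0..} in lebesgue. (\<psi> has_vector_derivative \<phi> t) (at t within {0..})"
    using primitive_loc_abs_cont[OF \<phi>(1), of \<psi> "\<psi> 0"] \<phi>(2) by blast+
  have "continuous_on {0..} (\<lambda>t. \<psi> 0 + integral {0..t} \<phi>)"
    by (intro continuous_intros continuous_indefinite_integral \<phi>(1))
  then have \<psi>c: "continuous_on {0..} \<psi>" by (rule continuous_on_eq) (simp add: \<phi>(2)[symmetric])
  have "AE t\<in>{0..} in lebesgue.
        (x0 has_vector_derivative f t (x0 t) (u0 t)) (at t within {0..}) \<and>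
        (\<exists>\<zeta>\<in>clarke_gradient (\<lambda>y. hamiltonian f g y t (u0 t) lam (\<psi> t)) (x0 t).
           (\<psi> has_vector_derivative - \<zeta>) (at t within {0..})) \<and>
        (SUP p\<in>U t. hamiltonian f g (x0 t) t p lam (\<psi> t)) = hamiltonian f g (x0 t) t (u0 t) lam (\<psi> t)"
    using x0p(2) \<psi>p(2) v(2) cl max
  proof eventually_elim
    case (elim t)
    show ?case
    proof (intro impI conjI)
      assume "t \<in> {0..}"
      then have t: "0 \<le> t" by simp
      show "(x0 has_vector_derivative f t (x0 t) (u0 t)) (at t within {0..})" using elim(1) t by simp
      show "\<exists>\<zeta>\<in>clarke_gradient (\<lambda>y. hamiltonian f g y t (u0 t) lam (\<psi> t)) (x0 t). (\<psi> has_vector_derivative - \<zeta>) (at t within {0..})"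
        using elim(2,4) t by (intro bexI[of _ "- \<phi> t"]) (simp_all add: x0x)
      let ?h = "\<lambda>p. hamiltonian f g (x0 t) t p lam (\<psi> t)"
      \<comment> \<open>the maximum condition is known for the values of the \<open>v k\<close>, which are dense in \<open>U t\<close>\<close>
      have hc: "continuous_on (U t) ?h"
      proof -
        have 1: "continuous_on (UNIV \<times> U t) (\<lambda>(y, p). f t y p)" "continuous_on (UNIV \<times> U t) (\<lambda>(y, p). g t y p)"
          using cf(1) cg(1) t by (auto simp: caratheodory_def)
        have "continuous_on (U t) (\<lambda>p. f t (x0 t) p)" "continuous_on (U t) (\<lambda>p. g t (x0 t) p)"
        proof -
          have c: "continuous_on (U t) (\<lambda>p. (x0 t, p))" by (intro continuous_on_Pair continuous_on_id continuous_on_const)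
          show "continuous_on (U t) (\<lambda>p. f t (x0 t) p)" "continuous_on (U t) (\<lambda>p. g t (x0 t) p)"
            using continuous_on_compose2[OF 1(1) c] continuous_on_compose2[OF 1(2) c] by auto
        qed
        then show ?thesis unfolding hamiltonian_def by (intro continuous_intros)
      qed
      have "?h p \<le> ?h (u0 t)" if p: "p \<in> U t" for p
      proof -
        have "p \<in> closure (range (\<lambda>k. v k t))" using elim(3) t p by auto
        then obtain s where s: "\<And>n. s n \<in> range (\<lambda>k. v k t)" "s \<longlonglongrightarrow> p" by (auto simp: closure_sequential)
        have sU: "s n \<in> U t" for n using s(1)[of n] selectorsD(1)[OF v(1) t] by auto
        have "(\<lambda>n. ?h (s n)) \<longlonglongrightarrow> ?h p"
          by (rule continuous_on_tendsto_compose[OF hc s(2) p]) (simp add: sU)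
        moreover have "?h (s n) \<le> ?h (u0 t)" for n using s(1)[of n] elim(5) t by (auto simp: x0x)
        ultimately show ?thesis by (intro tendsto_upperbound[of "\<lambda>n. ?h (s n)"]) auto
      qed
      then show "(SUP p\<in>U t. ?h p) = ?h (u0 t)"
        using selectorsD(1)[OF u0 t] by (intro cSup_eq_maximum) auto
    qed
  qed
  then have "(x0, u0, lam, \<psi>) \<in> extremals U f g"
    unfolding extremals_def using x0p(1) \<psi>p(1) u0 lam lam1 x0i[of 0] by simp
  then show ?thesis using lam lam1 \<psi>c by (intro bexI[of _ lam] exI[of _ \<psi>]) auto
qed

end
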